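(* Let $1\le p,q<\infty$ and $\alpha,\beta>-1$. Let $\Phi\in\mathscr{L}\cup\mathscr{U}$, let $\vec{\varepsilon}\in\{0,1\}^2$, put $\omega=\mathcal{T}_\Phi^{\vec{\varepsilon}}$, and let $k\in\mathbb{R}$. Then the following assertions are equivalent. (a) The operator $P_\beta$ is bounded on $L^{p,q}(\mathbb{C}_+,\omega^{k}(\operatorname{Im} z)\,dV_\alpha(z))$. (b) The operator $P_\beta^+$ is bounded on $L^{p,q}(\mathbb{C}_+,\omega^{k}(\operatorname{Im} z)\,dV_\alpha(z))$. (c) The parameters satisfy $\alpha+1<q(\beta+1)$.
   Context: $\mathbb{C}_+=\{z\in\mathbb{C}:\operatorname{Im} z>0\}$, and $dV_\alpha(x+iy)=y^\alpha\,dx\,dy$. Growth functions and weights: a growth function is a continuous, nondecreasing, onto function $\Phi:[0,\infty)\to[0,\infty)$, not identically null. For $r>0$, $\Phi$ is of upper-type $r$ (resp. lower-type $r$) if there is $C_r>0$ such that for all $t\ge 1$ (resp. all $0<t\le 1$) and all $s>0$, $\Phi(st)\le C_r t^r\Phi(s)$. $\mathscr{U}^r$ ($r\ge1$) is the set of growth functions of upper-type $r$ such that $t\mapsto\Phi(t)/t$ is nondecreasing on $(0,\infty)$; $\mathscr{L}_r$ ($0<r\le1$) is the set of growth functions of lower-type $r$ such that $t\mapsto\Phi(t)/t$ is nonincreasing on $(0,\infty)$. $\mathscr{U}=\bigcup_{r\ge1}\mathscr{U}^r$, $\mathscr{L}=\bigcup_{0<r\le1}\mathscr{L}_r$. For $\vec{\varepsilon}=(\varepsilon_1,\varepsilon_2)\in\{0,1\}^2$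 and $t>0$, $\mathcal{T}_\Phi^{\vec{\varepsilon}}(t)=1+\varepsilon_1\ln_+(\Phi(1/t))+\varepsilon_2\ln_+(\Phi(t))$, where $\ln_+=\max(\ln,0)$. Spaces: $L^{p,q}(\mathbb{C}_+,\omega^k(\operatorname{Im} z)dV_\alpha(z))$ is the space of measurable functions $f$ on $\mathbb{C}_+$ such that $\int_0^\infty\left(\int_{\mathbb{R}}|f(x+iy)|^p\,dx\right)^{q/p}\omega^k(y)y^\alpha\,dy<\infty$, the norm being the $q$-th root of this quantity. Operators: for $\beta>-1$, the Bergman projection is $P_\beta f(z)=\int_{\mathbb{C}_+}K_\beta(z,w)f(w)\,dV_\beta(w)$ with $K_\beta(z,w)=\frac{c_\beta}{(z-\bar w)^{2+\beta}}$, where $c_\beta$ is the constant depending only on $\beta$ for which $P_\beta$ is the orthogonal projection of $L^2(\mathbb{C}_+,dV_\beta)$ onto its closed subspace of holomorphic functions. $P_\beta^+$ is the operator with kernel $|K_\beta(z,w)|$, i.e. $P_\beta^+f(z)=\int_{\mathbb{C}_+}|K_\beta(z,w)|f(w)\,dV_\beta(w)$. *)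

theory Defs
  imports "HOL-Complex_Analysis.Complex_Analysis"
begin

section \<open>Growth functions and weights\<close>

text \<open>Functions on \<open>[0, \<infinity>)\<close> are represented by functions of type \<^typ>\<open>real \<Rightarrow> real\<close>;
  their values at negative arguments are irrelevant.\<close>

definition growth_function :: "(real \<Rightarrow> real) \<Rightarrow> bool" where
  "growth_function \<Phi> \<longleftrightarrow>
     continuous_on {0..} \<Phi> \<and> mono_on {0..} \<Phi> \<and> \<Phi> ` {0..} = {0..} \<and> (\<exists>t\<ge>0. \<Phi> t \<noteq> 0)"

definition upper_type :: "real \<Rightarrow> (real \<Rightarrow> real) \<Rightarrow> bool" where
  "upper_type r \<Phi> \<longleftrightarrow> (\<exists>C>0. \<forall>t\<ge>1. \<forall>s>0. \<Phi> (s * t) \<le> C * t powr r * \<Phi> s)"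

definition lower_type :: "real \<Rightarrow> (real \<Rightarrow> real) \<Rightarrow> bool" where
  "lower_type r \<Phi> \<longleftrightarrow> (\<exists>C>0. \<forall>t. 0 < t \<and> t \<le> 1 \<longrightarrow> (\<forall>s>0. \<Phi> (s * t) \<le> C * t powr r * \<Phi> s))"

definition upper_growth_type :: "real \<Rightarrow> (real \<Rightarrow> real) set" where
  "upper_growth_type r =
     {\<Phi>. growth_function \<Phi> \<and> upper_type r \<Phi> \<and> mono_on {0<..} (\<lambda>t. \<Phi> t / t)}"

definition lower_growth_type :: "real \<Rightarrow> (real \<Rightarrow> real) set" where
  "lower_growth_type r =
     {\<Phi>. growth_function \<Phi> \<and> lower_type r \<Phi> \<and> antimono_on {0<..} (\<lambda>t. \<Phi> t / t)}"

definition upper_growth :: "(real \<Rightarrow> real) set" where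
  "upper_growth = (\<Union>r\<in>{1..}. upper_growth_type r)"

definition lower_growth :: "(real \<Rightarrow> real) set" where
  "lower_growth = (\<Union>r\<in>{0<..1}. lower_growth_type r)"

text \<open>Since \<open>ln 0 = 0\<close> in the library, this agrees at \<open>0\<close> with the convention
  \<open>max (-\<infinity>) 0 = 0\<close>.\<close>

definition ln_plus :: "real \<Rightarrow> real" where
  "ln_plus x = max (ln x) 0"

definition log_weight :: "(real \<Rightarrow> real) \<Rightarrow> real \<times> real \<Rightarrow> real \<Rightarrow> real" where
  "log_weight \<Phi> \<epsilon> t = 1 + fst \<epsilon> * ln_plus (\<Phi> (1 / t)) + snd \<epsilon> * ln_plus (\<Phi> t)"


section \<open>Mixed norm spaces on the upper half-plane\<close>

text \<open>Functions on the upper half-plane are represented by functions of type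
  \<^typ>\<open>complex \<Rightarrow> complex\<close>; every notion below depends only on their values on the half-plane.\<close>

definition upper_half_plane :: "complex set" where
  "upper_half_plane = {z. Im z > 0}"

definition half_plane_measure :: "real \<Rightarrow> complex measure" where
  "half_plane_measure \<alpha> =
     density (lebesgue_on upper_half_plane) (\<lambda>z. ennreal (Im z powr \<alpha>))"

definition ennreal_powr :: "ennreal \<Rightarrow> real \<Rightarrow> ennreal" where
  "ennreal_powr x a = (if x = \<infinity> then \<infinity> else ennreal (enn2real x powr a))"

text \<open>The mixed norm of \<open>f\<close> with respect to the weight \<open>w (Im z)\<close> times the measure of index
  \<open>\<alpha>\<close>; it takes the value \<open>\<infinity>\<close> outside of the space. It is used for \<open>p, q \<ge> 1\<close> only, where
  the exponents of \<^const>\<open>ennreal_powr\<close> are positive.\<close>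

definition mixed_norm ::
    "real \<Rightarrow> real \<Rightarrow> (real \<Rightarrow> real) \<Rightarrow> real \<Rightarrow> (complex \<Rightarrow> complex) \<Rightarrow> ennreal" where
  "mixed_norm p q w \<alpha> f =
     ennreal_powr
       (\<integral>\<^sup>+y\<in>{0<..}.
          (ennreal_powr (\<integral>\<^sup>+x. ennreal (cmod (f (Complex x y)) powr p) \<partial>lebesgue) (q / p)
            * ennreal (w y * y powr \<alpha>)) \<partial>lebesgue)
       (1 / q)"

definition mixed_space ::
    "real \<Rightarrow> real \<Rightarrow> (real \<Rightarrow> real) \<Rightarrow> real \<Rightarrow> (complex \<Rightarrow> complex) set" where
  "mixed_space p q w \<alpha> =
     {f. f \<in> borel_measurable (lebesgue_on upper_half_plane) \<and> mixed_norm p q w \<alpha> f < \<infinity>}"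


section \<open>Integral operators and the Bergman projection\<close>

definition integral_op ::
    "real \<Rightarrow> (complex \<Rightarrow> complex \<Rightarrow> complex) \<Rightarrow> (complex \<Rightarrow> complex) \<Rightarrow> complex \<Rightarrow> complex" where
  "integral_op \<beta> K f z = (LINT w|half_plane_measure \<beta>. K z w * f w)"

text \<open>Boundedness includes that the defining integral converges absolutely for every \<open>f\<close> in the
  space, because the Bochner integral of a non-integrable function is \<open>0\<close> by convention.\<close>

definition integral_op_bounded ::
    "real \<Rightarrow> (complex \<Rightarrow> complex \<Rightarrow> complex)
      \<Rightarrow> real \<Rightarrow> real \<Rightarrow> (real \<Rightarrow> real) \<Rightarrow> real \<Rightarrow> bool" where
  "integral_op_bounded \<beta> K p q w \<alpha> \<longleftrightarrow>
     (\<exists>C::real. \<forall>f\<in>mixed_space p q w \<alpha>.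
        (\<forall>z\<in>upper_half_plane. integrable (half_plane_measure \<beta>) (\<lambda>u. K z u * f u)) \<and>
        integral_op \<beta> K f \<in> mixed_space p q w \<alpha> \<and>
        mixed_norm p q w \<alpha> (integral_op \<beta> K f) \<le> ennreal C * mixed_norm p q w \<alpha> f)"

text \<open>For \<open>z\<close> and \<open>w\<close> in the upper half-plane, \<open>z - cnj w\<close> lies there too, away from the branch
  cut of the principal power.\<close>

definition bergman_kernel :: "complex \<Rightarrow> real \<Rightarrow> complex \<Rightarrow> complex \<Rightarrow> complex" where
  "bergman_kernel c \<beta> z w = c / (z - cnj w) powr (of_real (2 + \<beta>))"

definition abs_bergman_kernel :: "complex \<Rightarrow> real \<Rightarrow> complex \<Rightarrow> complex \<Rightarrow> complex" where
  "abs_bergman_kernel c \<beta> z w = of_real (cmod (bergman_kernel c \<beta> z w))"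

definition half_plane_L2 :: "real \<Rightarrow> (complex \<Rightarrow> complex) set" where
  "half_plane_L2 \<beta> =
     {f. f \<in> borel_measurable (half_plane_measure \<beta>) \<and>
         integrable (half_plane_measure \<beta>) (\<lambda>z. (cmod (f z))\<^sup>2)}"

definition bergman_L2 :: "real \<Rightarrow> (complex \<Rightarrow> complex) set" where
  "bergman_L2 \<beta> = {f \<in> half_plane_L2 \<beta>. f holomorphic_on upper_half_plane}"

text \<open>\<open>c\<close> is the normalizing constant of the Bergman kernel: the integral operator with kernel
  \<^term>\<open>bergman_kernel c \<beta>\<close> is the orthogonal projection of \<^term>\<open>half_plane_L2 \<beta>\<close> onto
  \<^term>\<open>bergman_L2 \<beta>\<close>. For \<open>\<beta> > -1\<close> there is exactly one such constant,
  \<open>c = 2 powr \<beta> * (\<beta> + 1) * \<i> powr (\<beta> + 2) / pi\<close>.\<close>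

definition bergman_constant :: "real \<Rightarrow> complex \<Rightarrow> bool" where
  "bergman_constant \<beta> c \<longleftrightarrow>
     (\<forall>f\<in>half_plane_L2 \<beta>.
        (\<forall>z\<in>upper_half_plane.
           integrable (half_plane_measure \<beta>) (\<lambda>w. bergman_kernel c \<beta> z w * f w)) \<and>
        integral_op \<beta> (bergman_kernel c \<beta>) f \<in> bergman_L2 \<beta> \<and>
        (\<forall>g\<in>bergman_L2 \<beta>.
           (LINT z|half_plane_measure \<beta>.
              (f z - integral_op \<beta> (bergman_kernel c \<beta>) f z) * cnj (g z)) = 0))"

end

theory Submission
  imports Defs
begin

text \<open>Sufficiency. On a horizontal line the kernel acts by convolution, so Minkowski's inequality bounds
  the \<open>L\<^sup>p\<close> norms of the rows of \<open>P\<^sup>+ f\<close> by the Hardy operator with kernel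
  \<open>v powr \<beta> / (y + v) powr (1 + \<beta>)\<close> applied to those of \<open>f\<close>. This operator is an average of dilations,
  and the weight changes under a dilation by \<open>t\<close> at most by a factor \<open>A max t (1 / t) powr \<delta>\<close> with
  \<open>\<delta>\<close> arbitrarily small; the resulting integral over \<open>t\<close> converges exactly under (c).

  Necessity. Near the boundary the weight is almost constant on windows of any fixed logarithmic
  length, so test functions scaled into such a window do not see it. They are
  \<open>\<psi>(u) v powr (-1 - \<beta>)\<close> with \<open>\<psi>\<close> supported in \<open>u < 0\<close>, evaluated at points far to the right, where
  \<open>z - cnj u\<close> lies in a narrow sector and the holomorphic kernel has no cancellation. A long range of
  heights \<open>v\<close> in the test function contradicts boundedness if \<open>q > 1\<close>, a long range of heights in the
  image if \<open>p = q = 1\<close>, and \<open>\<psi>(u) = \<bar>u\<bar> powr (-1 / p)\<close> on a long interval if \<open>q = 1 < p\<close>. The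
  normalizing constant matters only through being nonzero.\<close>

section \<open>Real powers of extended nonnegative reals\<close>

text \<open>Assertions (a) and (b) are never compared directly. Condition (c) gives both through one
  bound for the positive operator, and each of them gives (c) through one test inequality that asks
  of the kernel only a lower bound in a sector. No duality enters, so \<open>p = 1\<close> and
  \<open>q = 1\<close> raise no question of conjugate exponents.

  The upper bound is proved for Borel functions with values in \<open>[0, \<infinity>]\<close>,
  where every integral exists; absolute convergence of the defining integral is then read off from
  finiteness of the norm.

  The obstacle to necessity is the critical case \<open>\<alpha> + 1 = q * (\<beta> + 1)\<close>,
  where powers of the height diverge only logarithmically and the weight contributes logarithms of
  its own. The constant in the test inequality must therefore be independent of the length of the
  window; this is why the weight is held within the absolute factor 2 on it. If
  \<open>\<alpha> + 1\<close> exceeds the critical value, the excess acts in the favourable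
  direction both for the test function and for its image.\<close>

lemma ennreal_powr_top [simp]: "ennreal_powr top a = top"
  by (simp add: ennreal_powr_def)

lemma ennreal_powr_0 [simp]: "ennreal_powr 0 a = 0"
  by (simp add: ennreal_powr_def)

lemma ennreal_powr_ennreal: "0 \<le> x \<Longrightarrow> ennreal_powr (ennreal x) a = ennreal (x powr a)"
  by (simp add: ennreal_powr_def)

lemma ennreal_powr_1 [simp]: "ennreal_powr x 1 = x"
  by (cases x) (auto simp: ennreal_powr_ennreal)

lemma ennreal_powr_eq_0_iff [simp]: "ennreal_powr x a = 0 \<longleftrightarrow> x = 0"
  by (cases x) (auto simp: ennreal_powr_ennreal)

lemma ennreal_powr_eq_top_iff [simp]: "ennreal_powr x a = top \<longleftrightarrow> x = top"
  by (cases x) (auto simp: ennreal_powr_ennreal)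

lemma ennreal_powr_less_top_iff [simp]: "ennreal_powr x a < top \<longleftrightarrow> x < top"
  by (cases x) (auto simp: ennreal_powr_ennreal)

lemma ennreal_powr_mono: "0 \<le> a \<Longrightarrow> x \<le> y \<Longrightarrow> ennreal_powr x a \<le> ennreal_powr y a"
  by (cases x; cases y) (auto simp: ennreal_powr_ennreal powr_mono2 top_unique)

lemma ennreal_powr_powr: "ennreal_powr (ennreal_powr x a) b = ennreal_powr x (a * b)"
  by (cases x) (auto simp: ennreal_powr_ennreal powr_powr)

lemma ennreal_powr_powr_inverse [simp]:
  "0 < a \<Longrightarrow> ennreal_powr (ennreal_powr x a) (1 / a) = x"
  "0 < a \<Longrightarrow> ennreal_powr (ennreal_powr x (1 / a)) a = x"
  by (simp_all add: ennreal_powr_powr)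

text \<open>The conventions \<open>0 powr a = 0\<close> and \<open>ennreal_powr top a = top\<close>
  for every \<open>a\<close> match \<open>0 * top = 0\<close>, so multiplicativity holds for
  exponents of either sign.\<close>

lemma ennreal_powr_mult: "ennreal_powr (x * y) a = ennreal_powr x a * ennreal_powr y a"
proof (cases x; cases y)
  fix r s :: real assume "x = ennreal r" "0 \<le> r" "y = ennreal s" "0 \<le> s"
  then show ?thesis
    by (simp add: ennreal_mult[symmetric] ennreal_powr_ennreal powr_mult)
next
  fix r :: real assume "x = ennreal r" "0 \<le> r" "y = top"
  then show ?thesis
    by (cases "r = 0") (auto simp: ennreal_powr_ennreal ennreal_mult_top)
next
  fix r :: real assume "y = ennreal r" "0 \<le> r" "x = top"
  then show ?thesis
    by (cases "r = 0") (auto simp: ennreal_powr_ennreal ennreal_top_mult)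
qed (auto simp: ennreal_mult_top)

lemma ennreal_inverse_mult_self: "x \<noteq> 0 \<Longrightarrow> x \<noteq> top \<Longrightarrow> inverse x * x = (1 :: ennreal)"
  using ennreal_divide_self[of x] by (simp add: divide_ennreal_def mult.commute less_top)

lemma measurable_ennreal_powr [measurable (raw)]:
  assumes [measurable]: "f \<in> borel_measurable M"
  shows "(\<lambda>x. ennreal_powr (f x) a) \<in> borel_measurable M"
  unfolding ennreal_powr_def by measurable

section \<open>Minkowski's integral inequality\<close>

text \<open>The power \<open>t powr p\<close> lies above its tangent at any \<open>l > 0\<close>.
  Integrating this against the density \<open>n\<close> and taking for \<open>l\<close> the mean of
  \<open>a\<close> gives the claim. The mass of \<open>n\<close> is not normalised, which accounts
  for the factor with exponent \<open>p - 1\<close>.\<close>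

lemma jensen_nn_integral_powr:
  fixes a n :: "'a \<Rightarrow> ennreal"
  assumes p: "1 \<le> p" and [measurable]: "a \<in> borel_measurable N" "n \<in> borel_measurable N"
    and fin: "(\<integral>\<^sup>+s. n s \<partial>N) < top"
  shows "ennreal_powr (\<integral>\<^sup>+s. a s * n s \<partial>N) p
      \<le> ennreal_powr (\<integral>\<^sup>+s. n s \<partial>N) (p - 1) * (\<integral>\<^sup>+s. ennreal_powr (a s) p * n s \<partial>N)"
proof -
  define W where "W = (\<integral>\<^sup>+s. n s \<partial>N)"
  define A where "A = (\<integral>\<^sup>+s. a s * n s \<partial>N)"
  define B where "B = (\<integral>\<^sup>+s. ennreal_powr (a s) p * n s \<partial>N)"
  \<comment> \<open>The tangent inequality at \<open>l\<close>, from Young's inequality with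
    exponents \<open>p\<close> and \<open>p / (p - 1)\<close>; for \<open>p = 1\<close> there is no
    finite conjugate exponent and the claim is trivial.\<close>
  have young: "ennreal (p * l powr (p - 1)) * t \<le> ennreal_powr t p + ennreal ((p - 1) * l powr p)"
    if l: "0 < l" for l :: real and t
  proof (cases t)
    case (real r)
    have "p * l powr (p - 1) * r \<le> r powr p + (p - 1) * l powr p"
    proof (cases "p = 1")
      case True then show ?thesis using real l by simp
    next
      case False
      then have p1: "p > 1" using p by simp
      have "r * l powr (p - 1) \<le> r powr p / p + (l powr (p - 1)) powr (p / (p - 1)) / (p / (p - 1))"
        by (rule Youngs_inequality) (use p1 real l in \<open>auto simp: field_simps\<close>)
      also have "(l powr (p - 1)) powr (p / (p - 1)) = l powr p"
        using p1 by (simp add: powr_powr)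
      finally show ?thesis using p1 by (simp add: field_simps)
    qed
    then show ?thesis
      using real p l
      by (simp add: ennreal_powr_ennreal ennreal_mult[symmetric] ennreal_plus[symmetric] del: ennreal_plus)
  qed auto
  have key: "ennreal (p * l powr (p - 1)) * A \<le> B + ennreal ((p - 1) * l powr p) * W"
    if l: "0 < l" for l :: real
  proof -
    have "ennreal (p * l powr (p - 1)) * A = (\<integral>\<^sup>+s. (ennreal (p * l powr (p - 1)) * a s) * n s \<partial>N)"
      unfolding A_def by (subst nn_integral_cmult[symmetric]) (auto simp: mult_ac)
    also have "\<dots> \<le> (\<integral>\<^sup>+s. (ennreal_powr (a s) p + ennreal ((p - 1) * l powr p)) * n s \<partial>N)"
      by (intro nn_integral_mono mult_right_mono young l) auto
    also have "\<dots> = B + ennreal ((p - 1) * l powr p) * W"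
      unfolding B_def W_def by (subst nn_integral_cmult[symmetric])
        (auto simp: distrib_right nn_integral_add)
    finally show ?thesis .
  qed
  show ?thesis
  proof (cases "W = 0 \<or> A = 0")
    case True
    have "A = 0"
    proof (cases "A = 0")
      case False
      then have "W = 0" using True by simp
      then have "AE s in N. n s = 0" unfolding W_def by (subst (asm) nn_integral_0_iff_AE) auto
      then have "A = (\<integral>\<^sup>+s. 0 \<partial>N)" unfolding A_def by (intro nn_integral_cong_AE) auto
      then show ?thesis by simp
    qed
    then show ?thesis unfolding A_def by simp
  next
    case False
    show ?thesis
    proof (cases "B = top")
      case True
      then show ?thesis using False unfolding B_def[symmetric] W_def[symmetric]
        by (simp add: ennreal_mult_top)
    next
      case Bfin: False
      obtain b where b: "B = ennreal b" "0 \<le> b" using Bfin by (cases B) auto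
      obtain w where w: "W = ennreal w" "0 < w" using fin False unfolding W_def[symmetric]
        by (cases W) (auto simp: order.strict_iff_order)
      have "A \<noteq> top"
      proof
        assume "A = top"
        with key[of 1] p b w show False
          by (auto simp: ennreal_mult_top top_unique ennreal_mult[symmetric] ennreal_plus[symmetric] simp del: ennreal_plus)
      qed
      then obtain r where r: "A = ennreal r" "0 < r" using False
        by (cases A) (auto simp: order.strict_iff_order)
      \<comment> \<open>The mean of \<open>a\<close> with respect to \<open>n\<close>; it maximises
        \<open>p * l powr (p - 1) * r - (p - 1) * l powr p * w\<close>.\<close>
      define l where "l = r / w"
      have l: "0 < l" using r w by (simp add: l_def)
      have "p * l powr (p - 1) * r \<le> b + (p - 1) * l powr p * w"
        using key[OF l] p b w r by (simp add: ennreal_mult[symmetric] ennreal_plus[symmetric] del: ennreal_plus)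
      moreover have "l powr p = l powr (p - 1) * l" using l by (simp add: powr_diff)
      moreover have "l * w = r" using w by (simp add: l_def)
      ultimately have "l powr (p - 1) * r \<le> b"
      proof -
        assume 1: "p * l powr (p - 1) * r \<le> b + (p - 1) * l powr p * w"
          and 2: "l powr p = l powr (p - 1) * l" and 3: "l * w = r"
        have "(p - 1) * l powr p * w = (p - 1) * (l powr (p - 1) * r)"
          unfolding 2 3[symmetric] by simp
        with 1 show ?thesis by (simp add: algebra_simps)
      qed
      moreover have "l powr (p - 1) * w powr (p - 1) = r powr (p - 1)"
        using r w by (simp add: l_def powr_divide)
      ultimately have "r powr (p - 1) * r \<le> w powr (p - 1) * b"
        using mult_left_mono[of "l powr (p - 1) * r" b "w powr (p - 1)"] by (simp add: mult_ac)
      moreover have "r powr (p - 1) * r = r powr p" using r by (simp add: powr_diff)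
      ultimately show ?thesis
        unfolding A_def[symmetric] B_def[symmetric] W_def[symmetric] using b w r
        by (simp add: ennreal_powr_ennreal ennreal_mult[symmetric])
    qed
  qed
qed

text \<open>Jensen's inequality in place of duality: with \<open>n s\<close> the norm of the slice
  at \<open>s\<close>, write \<open>h\<close> as \<open>(h / n) * n\<close> and use \<open>n\<close>
  as the density. After exchanging the integrals, every normalised slice has norm at most 1.\<close>

lemma minkowski_nn_integral:
  fixes h :: "'a \<Rightarrow> 'b \<Rightarrow> ennreal"
  assumes "sigma_finite_measure M" "sigma_finite_measure N"
    and p: "1 \<le> p" and [measurable]: "case_prod h \<in> borel_measurable (M \<Otimes>\<^sub>M N)"
  shows "ennreal_powr (\<integral>\<^sup>+x. ennreal_powr (\<integral>\<^sup>+s. h x s \<partial>N) p \<partial>M) (1 / p)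
      \<le> (\<integral>\<^sup>+s. ennreal_powr (\<integral>\<^sup>+x. ennreal_powr (h x s) p \<partial>M) (1 / p) \<partial>N)"
proof -
  interpret M: sigma_finite_measure M by fact
  interpret N: sigma_finite_measure N by fact
  interpret pair_sigma_finite M N ..
  define n where "n s = ennreal_powr (\<integral>\<^sup>+x. ennreal_powr (h x s) p \<partial>M) (1 / p)" for s
  have n_meas [measurable]: "n \<in> borel_measurable N" unfolding n_def by measurable
  define W where "W = (\<integral>\<^sup>+s. n s \<partial>N)"
  have n_powr: "(\<integral>\<^sup>+x. ennreal_powr (h x s) p \<partial>M) = ennreal_powr (n s) p" for s
    unfolding n_def using p by simp
  have "(\<integral>\<^sup>+x. ennreal_powr (\<integral>\<^sup>+s. h x s \<partial>N) p \<partial>M) \<le> ennreal_powr W p"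
  proof (cases "W = top")
    case False
    then have Wfin: "W < top" by (simp add: less_top)
    have nfin: "AE s in N. n s \<noteq> top"
      using nn_integral_PInf_AE[OF n_meas] False unfolding W_def by auto
    \<comment> \<open>Where \<open>n s = 0\<close>, the factorisation of \<open>h x s\<close>
      through \<open>n s\<close> needs \<open>h x s = 0\<close>. This is known for almost every
      \<open>x\<close> at fixed \<open>s\<close>; exchanging the quantifiers makes it usable inside
      the integral over \<open>s\<close>.\<close>
    have "AE s in N. AE x in M. n s = 0 \<longrightarrow> h x s = 0"
    proof (rule AE_I2)
      fix s assume [measurable]: "s \<in> space N"
      show "AE x in M. n s = 0 \<longrightarrow> h x s = 0"
      proof (cases "n s = 0")
        case True
        then have "(\<integral>\<^sup>+x. ennreal_powr (h x s) p \<partial>M) = 0" by (simp add: n_powr)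
        then have "AE x in M. ennreal_powr (h x s) p = 0" by (subst (asm) nn_integral_0_iff_AE) auto
        then show ?thesis by auto
      qed auto
    qed
    then have good: "AE x in M. AE s in N. n s = 0 \<longrightarrow> h x s = 0"
      by (subst AE_commute) auto
    have *: "(\<integral>\<^sup>+s. (\<integral>\<^sup>+x. ennreal_powr (h x s * inverse (n s)) p * n s \<partial>M) \<partial>N) \<le> W"
      unfolding W_def
    proof (rule nn_integral_mono_AE, use nfin AE_space in eventually_elim)
      case (elim s)
      show ?case
      proof (cases "n s = 0")
        case False
        have [measurable]: "(\<lambda>x. h x s) \<in> borel_measurable M" using elim(2) by measurable
        have "(\<integral>\<^sup>+x. ennreal_powr (h x s * inverse (n s)) p * n s \<partial>M)
            = (\<integral>\<^sup>+x. ennreal_powr (h x s) p * (ennreal_powr (inverse (n s)) p * n s) \<partial>M)"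
          by (simp add: ennreal_powr_mult mult.assoc)
        also have "\<dots> = ennreal_powr (n s) p * (ennreal_powr (inverse (n s)) p * n s)"
          by (subst nn_integral_multc) (auto simp: n_powr)
        also have "\<dots> = ennreal_powr (n s * inverse (n s)) p * n s"
          by (simp add: ennreal_powr_mult mult.assoc)
        also have "\<dots> \<le> n s"
          using False elim(1) ennreal_powr_ennreal[of 1 p] by (simp add: mult.commute[of "n s" "inverse (n s)"] ennreal_inverse_mult_self)
        finally show ?thesis .
      qed simp
    qed
    have "(\<integral>\<^sup>+x. ennreal_powr (\<integral>\<^sup>+s. h x s \<partial>N) p \<partial>M)
        \<le> (\<integral>\<^sup>+x. ennreal_powr W (p - 1) * (\<integral>\<^sup>+s. ennreal_powr (h x s * inverse (n s)) p * n s \<partial>N) \<partial>M)"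
    proof (rule nn_integral_mono_AE, use good AE_space in eventually_elim)
      case (elim x)
      have [measurable]: "h x \<in> borel_measurable N" using elim(2) by measurable
      have "(\<integral>\<^sup>+s. h x s \<partial>N) = (\<integral>\<^sup>+s. (h x s * inverse (n s)) * n s \<partial>N)"
      proof (rule nn_integral_cong_AE, use elim(1) nfin in eventually_elim)
        case (elim s)
        then show ?case
          by (cases "n s = 0")
             (simp_all add: mult.assoc ennreal_inverse_mult_self)
      qed
      then show ?case
        using jensen_nn_integral_powr[of p "\<lambda>s. h x s * inverse (n s)" N n] p Wfin
        unfolding W_def by simp
    qed
    also have "\<dots> = ennreal_powr W (p - 1) * (\<integral>\<^sup>+s. (\<integral>\<^sup>+x. ennreal_powr (h x s * inverse (n s)) p * n s \<partial>M) \<partial>N)"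
      by (subst nn_integral_cmult) (auto simp: Fubini')
    also have "\<dots> \<le> ennreal_powr W (p - 1) * W"
      by (rule mult_left_mono[OF *]) simp
    also have "\<dots> = ennreal_powr W p"
      using Wfin by (cases W) (auto simp: ennreal_powr_ennreal ennreal_mult[symmetric] powr_diff)
    finally show ?thesis .
  qed simp
  then have "ennreal_powr (\<integral>\<^sup>+x. ennreal_powr (\<integral>\<^sup>+s. h x s \<partial>N) p \<partial>M) (1 / p)
      \<le> ennreal_powr (ennreal_powr W p) (1 / p)"
    by (rule ennreal_powr_mono[rotated]) (use p in simp)
  then show ?thesis
    using p unfolding W_def n_def by simp
qed

section \<open>Integration over the half-plane\<close>

lemma Complex_measurable [measurable]:
  assumes [measurable]: "f \<in> borel_measurable M" "g \<in> borel_measurable M"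
  shows "(\<lambda>x. Complex (f x) (g x)) \<in> borel_measurable M"
  unfolding Complex_eq by measurable

lemma upper_half_plane_borel [measurable]: "upper_half_plane \<in> sets borel"
  unfolding upper_half_plane_def by measurable

lemma lborel_complex_eq:
  "(lborel :: complex measure) = distr (lborel \<Otimes>\<^sub>M lborel) borel (\<lambda>x. Complex (fst x) (snd x))"
proof (rule lborel_eqI)
  fix l u :: complex
  assume le: "\<And>b. b \<in> Basis \<Longrightarrow> l \<bullet> b \<le> u \<bullet> b"
  have "Re l \<le> Re u" "Im l \<le> Im u" using le[of 1] le[of \<i>] by auto
  moreover have "(\<lambda>x. Complex (fst x) (snd x)) -` box l u \<inter> space (lborel \<Otimes>\<^sub>M lborel)
      = {Re l<..<Re u} \<times> {Im l<..<Im u}"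
    by (auto simp: box_def Basis_complex_def space_pair_measure)
  ultimately show "emeasure (distr (lborel \<Otimes>\<^sub>M lborel) borel (\<lambda>x. Complex (fst x) (snd x))) (box l u)
      = ennreal (\<Prod>b\<in>Basis. (u - l) \<bullet> b)"
    by (subst emeasure_distr)
       (auto simp: lborel.emeasure_pair_measure_Times Basis_complex_def ennreal_mult'')
qed simp

lemma nn_integral_lborel_complex:
  fixes h :: "complex \<Rightarrow> ennreal"
  assumes [measurable]: "h \<in> borel_measurable borel"
  shows "(\<integral>\<^sup>+w. h w \<partial>lborel) = (\<integral>\<^sup>+v. \<integral>\<^sup>+u. h (Complex u v) \<partial>lborel \<partial>lborel)"
  unfolding lborel_complex_eq
  by (subst nn_integral_distr) (simp_all add: lborel_pair.nn_integral_snd[symmetric])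

lemma AE_lborel_complexD:
  assumes "AE w in lborel. P w"
  shows "AE v in lborel. AE u in lborel. P (Complex u v)"
proof -
  obtain N where N: "{w \<in> space lborel. \<not> P w} \<subseteq> N" "emeasure lborel N = 0" "N \<in> sets lborel"
    using AE_E[OF assms] by blast
  have [measurable]: "N \<in> sets borel" using N(3) by simp
  have "(\<integral>\<^sup>+v. \<integral>\<^sup>+u. indicator N (Complex u v) \<partial>lborel \<partial>lborel) = emeasure lborel N"
    using nn_integral_lborel_complex[of "indicator N"] by simp
  then have "(\<integral>\<^sup>+v. \<integral>\<^sup>+u. indicator N (Complex u v) \<partial>lborel \<partial>lborel) = 0"
    using N(2) by simp
  then have "AE v in lborel. (\<integral>\<^sup>+u. indicator N (Complex u v) \<partial>lborel) = 0"
    by (subst (asm) nn_integral_0_iff_AE) simp_all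
  then show ?thesis
  proof eventually_elim
    case (elim v)
    then have "AE u in lborel. indicator N (Complex u v) = (0::ennreal)"
      by (subst (asm) nn_integral_0_iff_AE) simp_all
    then show ?case
    proof eventually_elim
      case (elim u)
      then have "Complex u v \<notin> N" by (auto simp: indicator_def split: if_splits)
      then show ?case using N(1) by auto
    qed
  qed
qed

lemma nn_integral_half_plane:
  assumes [measurable]: "h \<in> borel_measurable borel"
  shows "(\<integral>\<^sup>+w. h w \<partial>half_plane_measure \<beta>)
    = (\<integral>\<^sup>+v. (\<integral>\<^sup>+u. h (Complex u v) \<partial>lborel) * ennreal (v powr \<beta>) * indicator {0<..} v \<partial>lborel)"
proof -
  have [measurable]: "upper_half_plane \<in> sets lebesgue" by (rule sets_completionI_sets) simp
  have "(\<integral>\<^sup>+w. h w \<partial>half_plane_measure \<beta>)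
      = (\<integral>\<^sup>+w. ennreal (Im w powr \<beta>) * h w \<partial>lebesgue_on upper_half_plane)"
    unfolding half_plane_measure_def
    by (rule nn_integral_density) (auto intro!: measurable_restrict_space1 measurable_completion)
  also have "\<dots> = (\<integral>\<^sup>+w. ennreal (Im w powr \<beta>) * h w * indicator upper_half_plane w \<partial>lborel)"
    by (subst nn_integral_restrict_space) (auto simp: nn_integral_completion)
  also have "\<dots> = (\<integral>\<^sup>+v. \<integral>\<^sup>+u. h (Complex u v) * (ennreal (v powr \<beta>) * indicator {0<..} v) \<partial>lborel \<partial>lborel)"
    by (subst nn_integral_lborel_complex)
       (auto intro!: nn_integral_cong simp: upper_half_plane_def indicator_def mult_ac)
  finally show ?thesis
    by (simp add: nn_integral_multc mult.assoc)
qed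

text \<open>A single row of a Lebesgue measurable function need not be measurable, so iterated
  integrals are taken of a Borel function that agrees with it almost everywhere.\<close>

lemma borel_representative:
  assumes f: "f \<in> borel_measurable (lebesgue_on upper_half_plane)"
  obtains g :: "complex \<Rightarrow> complex" where "g \<in> borel_measurable borel"
    "AE w in lborel. w \<in> upper_half_plane \<longrightarrow> f w = g w"
proof -
  have [measurable]: "upper_half_plane \<in> sets lebesgue" by (rule sets_completionI_sets) simp
  define f' where "f' w = indicator upper_half_plane w *\<^sub>R f w" for w
  have f': "f' \<in> borel_measurable lebesgue"
    using f unfolding f'_def by (subst (asm) borel_measurable_restrict_space_iff) auto
  have "(\<lambda>w. Re (f' w)) \<in> borel_measurable lebesgue" "(\<lambda>w. Im (f' w)) \<in> borel_measurable lebesgue"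
    using f' by simp_all
  then obtain a b where ab [measurable]: "a \<in> borel_measurable lborel" "b \<in> borel_measurable lborel"
    and AE: "AE w in lborel. Re (f' w) = a w" "AE w in lborel. Im (f' w) = b w"
    using completion_ex_borel_measurable_real by metis
  show ?thesis
  proof
    show "(\<lambda>w. Complex (a w) (b w)) \<in> borel_measurable borel" by measurable
    show "AE w in lborel. w \<in> upper_half_plane \<longrightarrow> f w = Complex (a w) (b w)"
      using AE by eventually_elim (auto simp: f'_def complex_eq_iff)
  qed
qed

lemma AE_half_plane_measureI:
  assumes "AE w in lborel. w \<in> upper_half_plane \<longrightarrow> P w"
  shows "AE w in half_plane_measure \<beta>. P w"
proof -
  have [measurable]: "upper_half_plane \<in> sets lebesgue" by (rule sets_completionI_sets) simp
  have "AE w in lebesgue. w \<in> upper_half_plane \<longrightarrow> P w"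
    using assms by (rule AE_completion)
  then have "AE w in lebesgue_on upper_half_plane. P w"
    by (subst AE_restrict_space_iff) auto
  then show ?thesis unfolding half_plane_measure_def
    by (subst AE_density) (auto intro!: measurable_restrict_space1 measurable_completion)
qed

lemma measurable_half_plane_measure:
  "f \<in> borel_measurable (lebesgue_on upper_half_plane) \<Longrightarrow> f \<in> borel_measurable (half_plane_measure \<beta>)"
  by (simp add: half_plane_measure_def)

lemma borel_measurable_lebesgue_onI: "f \<in> borel_measurable borel \<Longrightarrow> f \<in> borel_measurable (lebesgue_on S)"
  by (auto intro!: measurable_restrict_space1 measurable_completion)

text \<open>Restricting to the half-plane by an indicator turns the measure into one over \<^term>\<open>lborel\<close>, to which
  the joint measurability of parameter integrals applies.\<close>

lemma integral_half_plane:
  fixes h :: "complex \<Rightarrow> complex"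
  assumes [measurable]: "h \<in> borel_measurable borel"
  shows "(LINT w|half_plane_measure \<beta>. h w)
    = (LINT w|lborel. (indicator upper_half_plane w * Im w powr \<beta>) *\<^sub>R h w)"
proof -
  have [measurable]: "upper_half_plane \<in> sets lebesgue" by (rule sets_completionI_sets) simp
  have "(LINT w|half_plane_measure \<beta>. h w) = (LINT w|lebesgue_on upper_half_plane. Im w powr \<beta> *\<^sub>R h w)"
    unfolding half_plane_measure_def
    by (rule integral_density) (auto intro!: borel_measurable_lebesgue_onI)
  also have "\<dots> = (LINT w|lebesgue. indicator upper_half_plane w *\<^sub>R (Im w powr \<beta> *\<^sub>R h w))"
    by (subst integral_restrict_space) auto
  also have "\<dots> = (LINT w|lborel. indicator upper_half_plane w *\<^sub>R (Im w powr \<beta> *\<^sub>R h w))"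
    by (rule integral_completion) measurable
  finally show ?thesis by (simp add: mult.assoc)
qed

section \<open>The mixed norm of extended nonnegative functions\<close>

text \<open>Values in \<open>ennreal\<close> allow the positive operator to be inserted before
  anything is known about its finiteness.\<close>

definition mixed_nn_norm ::
    "real \<Rightarrow> real \<Rightarrow> (real \<Rightarrow> real) \<Rightarrow> real \<Rightarrow> (complex \<Rightarrow> ennreal) \<Rightarrow> ennreal" where
  "mixed_nn_norm p q w \<alpha> F =
     ennreal_powr
       (\<integral>\<^sup>+y. ennreal_powr (\<integral>\<^sup>+x. ennreal_powr (F (Complex x y)) p \<partial>lborel) (q / p)
            * ennreal (w y * y powr \<alpha>) * indicator {0<..} y \<partial>lborel) (1 / q)"

lemma mixed_norm_eq:
  "mixed_norm p q w \<alpha> f = mixed_nn_norm p q w \<alpha> (\<lambda>z. ennreal (cmod (f z)))"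
  unfolding mixed_norm_def mixed_nn_norm_def
  by (simp add: nn_integral_completion ennreal_powr_ennreal)

lemma mixed_nn_norm_mono:
  assumes "0 < p" "0 < q" "\<And>z. z \<in> upper_half_plane \<Longrightarrow> F z \<le> G z"
  shows "mixed_nn_norm p q w \<alpha> F \<le> mixed_nn_norm p q w \<alpha> G"
  unfolding mixed_nn_norm_def
proof (intro ennreal_powr_mono nn_integral_mono)
  fix y :: real
  show "ennreal_powr (\<integral>\<^sup>+x. ennreal_powr (F (Complex x y)) p \<partial>lborel) (q / p)
            * ennreal (w y * y powr \<alpha>) * indicator {0<..} y
      \<le> ennreal_powr (\<integral>\<^sup>+x. ennreal_powr (G (Complex x y)) p \<partial>lborel) (q / p)
            * ennreal (w y * y powr \<alpha>) * indicator {0<..} y"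
  proof (cases "0 < y")
    case True
    then show ?thesis using assms
      by (intro mult_right_mono ennreal_powr_mono nn_integral_mono) (auto simp: upper_half_plane_def)
  qed simp
qed (use assms in auto)

text \<open>A null set meets almost every row in a null set, so the iterated norm does not depend on
  the representative.\<close>

lemma mixed_nn_norm_cong_AE:
  assumes "AE z in lborel. z \<in> upper_half_plane \<longrightarrow> F z = G z"
  shows "mixed_nn_norm p q w \<alpha> F = mixed_nn_norm p q w \<alpha> G"
  unfolding mixed_nn_norm_def
proof (intro arg_cong[where f = "\<lambda>x. ennreal_powr x (1 / q)"] nn_integral_cong_AE,
    use AE_lborel_complexD[OF assms] in eventually_elim)
  case (elim y)
  show ?case
  proof (cases "0 < y")
    case True
    have "AE x in lborel. ennreal_powr (F (Complex x y)) p = ennreal_powr (G (Complex x y)) p"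
      using elim by eventually_elim (use True in \<open>auto simp: upper_half_plane_def\<close>)
    then show ?thesis by (simp cong: nn_integral_cong_AE)
  qed simp
qed

lemma measurable_weight:
  fixes w :: "real \<Rightarrow> real"
  assumes "w \<in> borel_measurable (restrict_space borel {0<..})"
  shows "(\<lambda>y. ennreal (w y * y powr \<alpha>) * indicator {0<..} y) \<in> borel_measurable borel"
proof -
  have [measurable]: "(\<lambda>y. indicator {0<..} y *\<^sub>R w y) \<in> borel_measurable borel"
    using assms by (subst (asm) borel_measurable_restrict_space_iff) auto
  have "(\<lambda>y. ennreal ((indicator {0<..} y *\<^sub>R w y) * y powr \<alpha>)) \<in> borel_measurable borel"
    by measurable
  also have "(\<lambda>y. ennreal ((indicator {0<..} y *\<^sub>R w y) * y powr \<alpha>))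
      = (\<lambda>y. ennreal (w y * y powr \<alpha>) * indicator {0<..} y)"
    by (auto simp: indicator_def)
  finally show ?thesis .
qed

lemma mixed_nn_norm_cmult:
  assumes "0 < p" "0 < q" and [measurable]: "F \<in> borel_measurable borel" "w \<in> borel_measurable (restrict_space borel {0<..})"
  shows "mixed_nn_norm p q w \<alpha> (\<lambda>z. a * F z) = a * mixed_nn_norm p q w \<alpha> F"
proof -
  have [measurable]: "(\<lambda>y. ennreal (w y * y powr \<alpha>) * indicator {0<..} y) \<in> borel_measurable borel"
    by (rule measurable_weight) fact
  have 1: "(\<integral>\<^sup>+x. ennreal_powr (a * F (Complex x y)) p \<partial>lborel)
      = ennreal_powr a p * (\<integral>\<^sup>+x. ennreal_powr (F (Complex x y)) p \<partial>lborel)" for y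
    by (simp add: ennreal_powr_mult nn_integral_cmult)
  show ?thesis unfolding mixed_nn_norm_def 1
    unfolding ennreal_powr_mult ennreal_powr_powr mult.assoc
    using assms(1,2)
    by (subst nn_integral_cmult) (auto simp: ennreal_powr_mult ennreal_powr_powr)
qed

section \<open>Integrals of powers\<close>

lemma nn_integral_powr_from_0_finite:
  fixes a c :: real
  assumes "-1 < a" "0 \<le> c"
  shows "(\<integral>\<^sup>+t. ennreal (t powr a) * indicator {0..c} t \<partial>lborel) < top"
proof -
  obtain I where "((\<lambda>x. x powr a) has_integral I) {0..c}"
    using integrable_on_powr_from_0[OF assms] by (auto simp: integrable_on_def)
  then have "integral\<^sup>N lborel (\<lambda>t. ennreal (t powr a) * indicator {0..c} t) = ennreal I"
    by (intro nn_integral_has_integral_lebesgue') auto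
  then show ?thesis by simp
qed

lemma nn_integral_powr_to_inf_finite:
  fixes a :: real
  assumes "a < -1"
  shows "(\<integral>\<^sup>+t. ennreal (t powr a) * indicator {1..} t \<partial>lborel) < top"
proof -
  have "(\<integral>\<^sup>+t. ennreal (t powr a) * indicator {1..} t \<partial>lborel)
      = ennreal (0 - 1 powr (a + 1) / (a + 1))"
  proof (rule nn_integral_FTC_atLeast[where F = "\<lambda>t. t powr (a + 1) / (a + 1)"])
    show "((\<lambda>t. t powr (a + 1) / (a + 1)) has_real_derivative x powr a) (at x)" if "1 \<le> x" for x
      using that assms by (auto intro!: derivative_eq_intros)
    have "((\<lambda>t::real. t powr (a + 1)) \<longlongrightarrow> 0) at_top"
      using assms by (intro tendsto_neg_powr filterlim_ident) auto
    then show "((\<lambda>t. t powr (a + 1) / (a + 1)) \<longlongrightarrow> 0) at_top"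
      by (auto intro: tendsto_divide_zero)
  qed auto
  then show ?thesis by simp
qed

lemma nn_integral_kernel_line_finite:
  fixes m :: real
  assumes "1 < m"
  shows "(\<integral>\<^sup>+s. ennreal (cmod (Complex s 1) powr -m) \<partial>lborel) < top"
proof -
  let ?g = "\<lambda>s::real. ennreal (s powr -m) * indicator {1..} s"
  have le: "ennreal (cmod (Complex s 1) powr -m) \<le> indicator {-1<..<1} s + ?g s + ?g (-s)" for s
  proof -
    have *: "\<bar>s\<bar> \<le> cmod (Complex s 1)" "1 \<le> cmod (Complex s 1)"
      using abs_Re_le_cmod[of "Complex s 1"] abs_Im_le_cmod[of "Complex s 1"] by auto
    consider "\<bar>s\<bar> < 1" | "1 \<le> s" | "1 \<le> -s" by linarith
    then show ?thesis
    proof cases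
      case 1
      have "cmod (Complex s 1) powr -m \<le> 1 powr -m"
        using * assms by (intro powr_mono2') auto
      then have "ennreal (cmod (Complex s 1) powr -m) \<le> 1"
        by (metis ennreal_1 ennreal_leI powr_one_eq_one)
      then show ?thesis using 1 by (auto simp: indicator_def)
    next
      case 2
      have "cmod (Complex s 1) powr -m \<le> s powr -m" using * 2 assms by (intro powr_mono2') auto
      then show ?thesis using 2 by (auto simp: indicator_def intro!: add_increasing ennreal_leI)
    next
      case 3
      have "cmod (Complex s 1) powr -m \<le> (-s) powr -m" using * 3 assms by (intro powr_mono2') auto
      then show ?thesis using 3 by (auto simp: indicator_def intro!: add_increasing ennreal_leI)
    qed
  qed
  have g: "(\<integral>\<^sup>+s. ?g s \<partial>lborel) < top" using assms by (intro nn_integral_powr_to_inf_finite) auto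
  have "(\<integral>\<^sup>+s. ?g s \<partial>lborel) = (\<integral>\<^sup>+s. ?g (-s) \<partial>lborel)"
    using nn_integral_real_affine[of ?g "-1" 0] by simp
  then have g': "(\<integral>\<^sup>+s. ?g (-s) \<partial>lborel) < top" using g by simp
  have "(\<integral>\<^sup>+s. ennreal (cmod (Complex s 1) powr -m) \<partial>lborel)
      \<le> (\<integral>\<^sup>+s. indicator {-1<..<1} s + ?g s + ?g (-s) \<partial>lborel)"
    by (rule nn_integral_mono) (rule le)
  also have "\<dots> = (\<integral>\<^sup>+s. indicator {-1<..<1::real} s \<partial>lborel) + (\<integral>\<^sup>+s. ?g s \<partial>lborel) + (\<integral>\<^sup>+s. ?g (-s) \<partial>lborel)"
    by (simp add: nn_integral_add)
  also have "\<dots> < top" using g g' by simp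
  finally show ?thesis .
qed

text \<open>Substitute \<open>s = b * t\<close>: homogeneity of degree \<open>- m\<close> and the
  Jacobian \<open>b\<close> combine to the exponent \<open>1 - m\<close>. With
  \<open>m = 2 + \<beta>\<close> this is the decay of the row kernel in
  \<open>b = y + v\<close>.\<close>

lemma nn_integral_kernel_line:
  fixes m b :: real
  assumes "0 < b"
  shows "(\<integral>\<^sup>+s. ennreal (cmod (Complex s b) powr -m) \<partial>lborel)
    = ennreal (b powr (1 - m)) * (\<integral>\<^sup>+s. ennreal (cmod (Complex s 1) powr -m) \<partial>lborel)"
proof -
  have "(\<integral>\<^sup>+s. ennreal (cmod (Complex s b) powr -m) \<partial>lborel)
      = ennreal b * (\<integral>\<^sup>+s. ennreal (cmod (Complex (0 + b * s) b) powr -m) \<partial>lborel)"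
    using assms nn_integral_real_affine[of "\<lambda>s. ennreal (cmod (Complex s b) powr -m)" b 0] by simp
  also have "\<dots> = ennreal b * (\<integral>\<^sup>+s. ennreal (b powr -m) * ennreal (cmod (Complex s 1) powr -m) \<partial>lborel)"
  proof (intro arg_cong[where f = "\<lambda>x. ennreal b * x"] nn_integral_cong)
    fix s :: real
    have "Complex (0 + b * s) b = of_real b * Complex s 1" by (simp add: complex_eq_iff)
    then have "cmod (Complex (0 + b * s) b) = b * cmod (Complex s 1)"
      using assms by (simp add: norm_mult)
    then show "ennreal (cmod (Complex (0 + b * s) b) powr -m)
        = ennreal (b powr -m) * ennreal (cmod (Complex s 1) powr -m)"
      using assms by (simp add: powr_mult ennreal_mult)
  qed
  also have "\<dots> = (ennreal b * ennreal (b powr -m)) * (\<integral>\<^sup>+s. ennreal (cmod (Complex s 1) powr -m) \<partial>lborel)"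
    by (subst nn_integral_cmult) (auto simp: mult.assoc)
  also have "ennreal b * ennreal (b powr -m) = ennreal (b powr (1 - m))"
    using assms by (simp add: ennreal_mult[symmetric] powr_diff powr_minus_divide)
  finally show ?thesis .
qed

text \<open>The Mellin-type constant that controls the Hardy operator with kernel
  \<open>v powr \<beta> / (y + v) powr (1 + \<beta>)\<close>; the factor \<open>max t (1 / t) powr d\<close> absorbs the
  oscillation of the weight.\<close>

lemma hardy_constant_finite:
  fixes a b d :: real
  assumes "0 \<le> d" "d < a" "a + d < b + 1"
  shows "(\<integral>\<^sup>+t. ennreal (t powr (b - a) * (1 + t) powr (-1 - b) * max t (1 / t) powr d) * indicator {0<..} t \<partial>lborel) < top"
proof -
  \<comment> \<open>The two majorants use up the two strict inequalities:
    \<open>b - a - d > -1\<close> at 0 and \<open>-1 - a + d < -1\<close> at infinity.\<close>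
  have le: "ennreal (t powr (b - a) * (1 + t) powr (-1 - b) * max t (1 / t) powr d) * indicator {0<..} t
     \<le> ennreal (t powr (b - a - d)) * indicator {0..1} t + ennreal (t powr (-1 - a + d)) * indicator {1..} t" for t
  proof -
    consider "t \<le> 0" | "0 < t" "t \<le> 1" | "1 < t" by linarith
    then show ?thesis
    proof cases
      case 2
      have "(1 + t) powr (-1 - b) \<le> 1 powr (-1 - b)"
        using 2 assms by (intro powr_mono2') auto
      moreover have "max t (1 / t) = 1 / t" using 2 by (simp add: field_simps max_def)
           (smt (verit) mult_le_one)
      ultimately have "t powr (b - a) * (1 + t) powr (-1 - b) * max t (1 / t) powr d \<le> t powr (b - a) * 1 * (1 / t) powr d"
        by (intro mult_mono) auto
      also have "\<dots> = t powr (b - a - d)" using 2 by (simp add: powr_diff powr_divide)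
      finally have "ennreal (t powr (b - a) * (1 + t) powr (-1 - b) * max t (1 / t) powr d) * indicator {0<..} t
          \<le> ennreal (t powr (b - a - d)) * indicator {0..1} t"
        using 2 by (simp add: ennreal_leI)
      then show ?thesis by (rule add_increasing2[OF zero_le])
    next
      case 3
      have "(1 + t) powr (-1 - b) \<le> t powr (-1 - b)"
        using 3 assms by (intro powr_mono2') auto
      moreover have "1 / t \<le> t" using 3 by (simp add: divide_le_eq) (smt (verit) mult_less_cancel_left1)
      then have "max t (1 / t) = t" by simp
      ultimately have "t powr (b - a) * (1 + t) powr (-1 - b) * max t (1 / t) powr d \<le> t powr (b - a) * t powr (-1 - b) * t powr d"
        by (intro mult_mono) auto
      also have "\<dots> = t powr (-1 - a + d)" using 3 by (simp add: powr_add[symmetric] add_ac)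
      finally show ?thesis using 3 by (auto simp: indicator_def intro!: ennreal_leI)
    qed auto
  qed
  have "(\<integral>\<^sup>+t. ennreal (t powr (b - a) * (1 + t) powr (-1 - b) * max t (1 / t) powr d) * indicator {0<..} t \<partial>lborel)
    \<le> (\<integral>\<^sup>+t. ennreal (t powr (b - a - d)) * indicator {0..1} t + ennreal (t powr (-1 - a + d)) * indicator {1..} t \<partial>lborel)"
    by (rule nn_integral_mono) (rule le)
  also have "\<dots> = (\<integral>\<^sup>+t. ennreal (t powr (b - a - d)) * indicator {0..1} t \<partial>lborel)
      + (\<integral>\<^sup>+t. ennreal (t powr (-1 - a + d)) * indicator {1..} t \<partial>lborel)"
    by (rule nn_integral_add) auto
  also have "\<dots> < top"
    using nn_integral_powr_from_0_finite[of "b - a - d" 1] nn_integral_powr_to_inf_finite[of "-1 - a + d"] assms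
    by simp
  finally show ?thesis .
qed

section \<open>The positive operator\<close>

lemma measurable_cnj [measurable]: "cnj \<in> borel_measurable borel"
  by (intro borel_measurable_continuous_onI continuous_intros)

text \<open>The kernel is taken without its normalising constant; both kernels of the theorem have
  this modulus up to the factor \<open>cmod c\<close>.\<close>

definition positive_op :: "real \<Rightarrow> (complex \<Rightarrow> ennreal) \<Rightarrow> complex \<Rightarrow> ennreal" where
  "positive_op \<beta> h z = (\<integral>\<^sup>+w. ennreal (cmod (z - cnj w) powr (-2 - \<beta>)) * h w \<partial>half_plane_measure \<beta>)"

lemma positive_op_eq:
  assumes [measurable]: "h \<in> borel_measurable borel"
  shows "positive_op \<beta> h (Complex x y) = (\<integral>\<^sup>+v. (\<integral>\<^sup>+s. ennreal (cmod (Complex s (y + v)) powr (-2 - \<beta>))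
      * h (Complex (x - s) v) \<partial>lborel) * ennreal (v powr \<beta>) * indicator {0<..} v \<partial>lborel)"
proof -
  have diff: "Complex x y - cnj (Complex u v) = Complex (x - u) (y + v)" for u v
    by (simp add: complex_eq_iff)
  have "(\<integral>\<^sup>+u. ennreal (cmod (Complex (x - u) (y + v)) powr (-2 - \<beta>)) * h (Complex u v) \<partial>lborel)
      = (\<integral>\<^sup>+s. ennreal (cmod (Complex s (y + v)) powr (-2 - \<beta>)) * h (Complex (x - s) v) \<partial>lborel)" for v
    by (subst nn_integral_real_affine[where c = "-1" and t = x]) simp_all
  then show ?thesis
    unfolding positive_op_def by (subst nn_integral_half_plane) (measurable, simp add: diff)
qed

definition row_norm :: "real \<Rightarrow> (complex \<Rightarrow> ennreal) \<Rightarrow> real \<Rightarrow> ennreal" where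
  "row_norm p h y = ennreal_powr (\<integral>\<^sup>+x. ennreal_powr (h (Complex x y)) p \<partial>lborel) (1 / p)"

lemma measurable_row_norm [measurable]:
  assumes [measurable]: "h \<in> borel_measurable borel"
  shows "row_norm p h \<in> borel_measurable borel"
  unfolding row_norm_def by measurable

text \<open>Minkowski's inequality is applied to the pair \<open>(v, s)\<close>. Translation by
  \<open>s\<close> does not change a row norm, so the integral over \<open>s\<close> acts on the
  kernel alone and leaves \<open>v powr \<beta> * (y + v) powr (-1 - \<beta>)\<close> up to a
  constant. This is homogeneous of degree -1, and \<open>v = y * t\<close> removes \<open>y\<close>
  from the kernel.\<close>

lemma row_norm_positive_op:
  assumes p: "1 \<le> p" and [measurable]: "h \<in> borel_measurable borel" and y: "0 < y"
  shows "row_norm p (positive_op \<beta> h) y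
    \<le> (\<integral>\<^sup>+s. ennreal (cmod (Complex s 1) powr (-2 - \<beta>)) \<partial>lborel) *
       (\<integral>\<^sup>+t. row_norm p h (y * t) * ennreal ((1 + t) powr (-1 - \<beta>) * t powr \<beta>) * indicator {0<..} t \<partial>lborel)"
proof -
  let ?C = "\<integral>\<^sup>+s. ennreal (cmod (Complex s 1) powr (-2 - \<beta>)) \<partial>lborel"
  define k where "k v s = ennreal (cmod (Complex s (y + v)) powr (-2 - \<beta>)) * (ennreal (v powr \<beta>) * indicator {0<..} v)"
    for v s :: real
  have [measurable]: "case_prod k \<in> borel_measurable (borel \<Otimes>\<^sub>M borel)"
    unfolding k_def by measurable
  have op: "positive_op \<beta> h (Complex x y) = (\<integral>\<^sup>+vs. h (Complex (x - snd vs) (fst vs)) * k (fst vs) (snd vs) \<partial>(lborel \<Otimes>\<^sub>M lborel))" for x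
  proof -
    have "(\<integral>\<^sup>+s. ennreal (cmod (Complex s (y + v)) powr (-2 - \<beta>)) * h (Complex (x - s) v) \<partial>lborel)
        * ennreal (v powr \<beta>) * indicator {0<..} v = (\<integral>\<^sup>+s. h (Complex (x - s) v) * k v s \<partial>lborel)" for v
      unfolding mult.assoc by (subst nn_integral_multc[symmetric]) (auto simp: k_def mult_ac)
    then show ?thesis
      by (simp add: positive_op_eq lborel.nn_integral_fst[symmetric])
  qed
  have "row_norm p (positive_op \<beta> h) y
    \<le> (\<integral>\<^sup>+vs. ennreal_powr (\<integral>\<^sup>+x. ennreal_powr (h (Complex (x - snd vs) (fst vs)) * k (fst vs) (snd vs)) p \<partial>lborel) (1 / p)
         \<partial>(lborel \<Otimes>\<^sub>M lborel))"
    unfolding row_norm_def op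
    by (rule minkowski_nn_integral) (use p in \<open>auto intro: lborel.sigma_finite_measure_axioms lborel_pair.sigma_finite_measure_axioms\<close>)
  also have "\<dots> = (\<integral>\<^sup>+vs. row_norm p h (fst vs) * k (fst vs) (snd vs) \<partial>(lborel \<Otimes>\<^sub>M lborel))"
  proof (rule nn_integral_cong)
    fix vs :: "real \<times> real"
    have "(\<integral>\<^sup>+x. ennreal_powr (h (Complex (x - snd vs) (fst vs)) * k (fst vs) (snd vs)) p \<partial>lborel)
        = (\<integral>\<^sup>+x. ennreal_powr (h (Complex (x - snd vs) (fst vs))) p \<partial>lborel) * ennreal_powr (k (fst vs) (snd vs)) p"
      by (simp add: ennreal_powr_mult nn_integral_multc)
    also have "(\<integral>\<^sup>+x. ennreal_powr (h (Complex (x - snd vs) (fst vs))) p \<partial>lborel)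
        = (\<integral>\<^sup>+x. ennreal_powr (h (Complex x (fst vs))) p \<partial>lborel)"
      using nn_integral_real_affine[of "\<lambda>x. ennreal_powr (h (Complex x (fst vs))) p" 1 "- snd vs"] by simp
    finally show "ennreal_powr (\<integral>\<^sup>+x. ennreal_powr (h (Complex (x - snd vs) (fst vs)) * k (fst vs) (snd vs)) p \<partial>lborel) (1 / p)
        = row_norm p h (fst vs) * k (fst vs) (snd vs)"
      using p by (simp add: ennreal_powr_mult row_norm_def)
  qed
  also have "\<dots> = (\<integral>\<^sup>+v. row_norm p h v * (\<integral>\<^sup>+s. k v s \<partial>lborel) \<partial>lborel)"
    by (simp add: lborel.nn_integral_fst[symmetric] nn_integral_cmult)
  also have "\<dots> = (\<integral>\<^sup>+v. row_norm p h v * (?C * ennreal ((y + v) powr (-1 - \<beta>) * v powr \<beta>) * indicator {0<..} v) \<partial>lborel)"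
  proof (rule nn_integral_cong)
    fix v :: real
    show "row_norm p h v * (\<integral>\<^sup>+s. k v s \<partial>lborel)
      = row_norm p h v * (?C * ennreal ((y + v) powr (-1 - \<beta>) * v powr \<beta>) * indicator {0<..} v)"
    proof (cases "0 < v")
      case True
      have "(\<integral>\<^sup>+s. k v s \<partial>lborel) = (\<integral>\<^sup>+s. ennreal (cmod (Complex s (y + v)) powr - (2 + \<beta>)) \<partial>lborel) * ennreal (v powr \<beta>)"
        using True unfolding k_def by (simp add: nn_integral_multc)
      also have "\<dots> = ennreal ((y + v) powr (-1 - \<beta>)) * ?C * ennreal (v powr \<beta>)"
        using True y by (subst nn_integral_kernel_line) auto
      finally show ?thesis using True by (simp add: ennreal_mult mult_ac)
    qed (simp add: k_def)
  qed
  also have "\<dots> = (\<integral>\<^sup>+v. ?C * (row_norm p h v * ennreal ((y + v) powr (-1 - \<beta>) * v powr \<beta>) * indicator {0<..} v) \<partial>lborel)"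
    by (simp add: mult_ac)
  also have "\<dots> = ?C * (\<integral>\<^sup>+v. row_norm p h v * ennreal ((y + v) powr (-1 - \<beta>) * v powr \<beta>) * indicator {0<..} v \<partial>lborel)"
    by (rule nn_integral_cmult) measurable
  also have "(\<integral>\<^sup>+v. row_norm p h v * ennreal ((y + v) powr (-1 - \<beta>) * v powr \<beta>) * indicator {0<..} v \<partial>lborel)
    = ennreal y * (\<integral>\<^sup>+t. row_norm p h (y * t) * ennreal ((y + y * t) powr (-1 - \<beta>) * (y * t) powr \<beta>) * indicator {0<..} (y * t) \<partial>lborel)"
    using y nn_integral_real_affine[of "\<lambda>v. row_norm p h v * ennreal ((y + v) powr (-1 - \<beta>) * v powr \<beta>) * indicator {0<..} v" y 0]
    by simp
  also have "\<dots> = (\<integral>\<^sup>+t. ennreal y * (row_norm p h (y * t) * ennreal ((y + y * t) powr (-1 - \<beta>) * (y * t) powr \<beta>) * indicator {0<..} (y * t)) \<partial>lborel)"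
    by (rule nn_integral_cmult[symmetric]) measurable
  also have "\<dots> = (\<integral>\<^sup>+t. row_norm p h (y * t) * ennreal ((1 + t) powr (-1 - \<beta>) * t powr \<beta>) * indicator {0<..} t \<partial>lborel)"
  proof (rule nn_integral_cong)
    fix t :: real
    show "ennreal y * (row_norm p h (y * t) * ennreal ((y + y * t) powr (-1 - \<beta>) * (y * t) powr \<beta>) * indicator {0<..} (y * t))
      = row_norm p h (y * t) * ennreal ((1 + t) powr (-1 - \<beta>) * t powr \<beta>) * indicator {0<..} t"
    proof (cases "0 < t")
      case True
      have "y + y * t = y * (1 + t)" by (simp add: algebra_simps)
      then have "y * ((y + y * t) powr (-1 - \<beta>) * (y * t) powr \<beta>)
          = (y powr 1 * y powr (-1 - \<beta>) * y powr \<beta>) * ((1 + t) powr (-1 - \<beta>) * t powr \<beta>)"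
        using y True by (simp add: powr_mult mult_ac)
      also have "y powr 1 * y powr (-1 - \<beta>) * y powr \<beta> = 1"
        using y by (simp only: powr_add[symmetric]) simp
      finally have "ennreal y * ennreal ((y + y * t) powr (-1 - \<beta>) * (y * t) powr \<beta>) = ennreal ((1 + t) powr (-1 - \<beta>) * t powr \<beta>)"
        using y by (simp add: ennreal_mult[symmetric])
      then show ?thesis using True y by (simp add: mult.left_commute[of "ennreal y"])
    next
      case False
      then show ?thesis using y by (auto simp: indicator_def zero_less_mult_iff)
    qed
  qed
  finally show ?thesis .
qed

lemma mixed_nn_norm_eq_row_norm:
  assumes "0 < p"
  shows "mixed_nn_norm p q w \<alpha> F = ennreal_powr (\<integral>\<^sup>+y. ennreal_powr (row_norm p F y) q
      * (ennreal (w y * y powr \<alpha>) * indicator {0<..} y) \<partial>lborel) (1 / q)"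
  using assms unfolding mixed_nn_norm_def row_norm_def by (simp add: ennreal_powr_powr mult.assoc)

text \<open>After the substitution \<open>v = y t\<close> the Hardy operator is an average of dilations, so Minkowski's
  inequality reduces it to the norms of the single dilations.\<close>

lemma hardy_dilation_bound:
  fixes w :: "real \<Rightarrow> real" and F k :: "real \<Rightarrow> ennreal"
  assumes q: "1 \<le> q" and w [measurable]: "w \<in> borel_measurable (restrict_space borel {0<..})"
    and A: "0 \<le> A" and wt: "\<And>t v. 0 < t \<Longrightarrow> 0 < v \<Longrightarrow> 0 \<le> w v \<and> w (v / t) \<le> A * max t (1 / t) powr \<delta> * w v"
    and F [measurable]: "F \<in> borel_measurable borel" and k [measurable]: "k \<in> borel_measurable borel"
  shows "ennreal_powr (\<integral>\<^sup>+y. ennreal_powr (\<integral>\<^sup>+t. F (y * t) * k t * indicator {0<..} t \<partial>lborel) q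
        * (ennreal (w y * y powr \<alpha>) * indicator {0<..} y) \<partial>lborel) (1 / q)
    \<le> (\<integral>\<^sup>+t. k t * ennreal (t powr (-(\<alpha> + 1) / q) * (A powr (1 / q) * max t (1 / t) powr (\<delta> / q))) * indicator {0<..} t \<partial>lborel)
      * ennreal_powr (\<integral>\<^sup>+y. ennreal_powr (F y) q * (ennreal (w y * y powr \<alpha>) * indicator {0<..} y) \<partial>lborel) (1 / q)"
proof -
  define W where "W y = ennreal (w y * y powr \<alpha>) * indicator {0<..} y" for y
  have W [measurable]: "W \<in> borel_measurable borel"
    unfolding W_def using w by (rule measurable_weight)
  define J where "J = (\<integral>\<^sup>+y. ennreal_powr (F y) q * W y \<partial>lborel)"
  have W0: "W y = 0" if "y \<le> 0" for y using that by (simp add: W_def)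
  \<comment> \<open>Substituting \<open>v = y * t\<close> moves the dilation onto the weight:
    \<open>t powr (- \<alpha>)\<close> comes from the power of the height, \<open>1 / t\<close> from
    the Jacobian, the rest from \<open>wt\<close>.\<close>
  have dil: "(\<integral>\<^sup>+y. ennreal_powr (F (y * t)) q * W y \<partial>lborel)
      \<le> ennreal (t powr (- (\<alpha> + 1)) * (A * max t (1 / t) powr \<delta>)) * J" if t: "0 < t" for t
  proof -
    have "(\<integral>\<^sup>+y. ennreal_powr (F (y * t)) q * W y \<partial>lborel)
        = ennreal (1 / t) * (\<integral>\<^sup>+v. ennreal_powr (F v) q * W (v / t) \<partial>lborel)"
      using t by (subst nn_integral_real_affine[where c = "1 / t" and t = 0]) simp_all
    also have "\<dots> \<le> ennreal (1 / t) * (\<integral>\<^sup>+v. ennreal (t powr (- \<alpha>) * (A * max t (1 / t) powr \<delta>)) * (ennreal_powr (F v) q * W v) \<partial>lborel)"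
    proof (intro mult_left_mono nn_integral_mono)
      fix v :: real
      show "ennreal_powr (F v) q * W (v / t) \<le> ennreal (t powr (- \<alpha>) * (A * max t (1 / t) powr \<delta>)) * (ennreal_powr (F v) q * W v)"
      proof (cases "0 < v")
        case True
        have "w (v / t) * (v / t) powr \<alpha> \<le> (A * max t (1 / t) powr \<delta> * w v) * (v / t) powr \<alpha>"
          using wt[OF t True] by (intro mult_right_mono) auto
        also have "\<dots> = t powr (- \<alpha>) * (A * max t (1 / t) powr \<delta>) * (w v * v powr \<alpha>)"
          using t True by (simp add: powr_divide powr_minus field_simps)
        finally have "W (v / t) \<le> ennreal (t powr (- \<alpha>) * (A * max t (1 / t) powr \<delta>)) * W v"
          using t True A wt[OF t True] unfolding W_def by (simp add: ennreal_mult[symmetric] ennreal_leI)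
        then show ?thesis
          by (metis mult.left_commute mult_left_mono zero_le)
      next
        case False
        then show ?thesis using t by (simp add: W0 divide_nonpos_pos)
      qed
    qed simp
    also have "\<dots> = (ennreal (1 / t) * ennreal (t powr (- \<alpha>) * (A * max t (1 / t) powr \<delta>))) * J"
      unfolding J_def by (subst nn_integral_cmult) (simp_all add: mult.assoc)
    also have "ennreal (1 / t) * ennreal (t powr (- \<alpha>) * (A * max t (1 / t) powr \<delta>))
        = ennreal (t powr (- (\<alpha> + 1)) * (A * max t (1 / t) powr \<delta>))"
    proof -
      have "t powr (- (\<alpha> + 1)) = 1 / t * t powr (- \<alpha>)"
        using t by (simp add: powr_diff)
      then show ?thesis using t A by (simp add: ennreal_mult[symmetric] mult.assoc)
    qed
    finally show ?thesis .
  qed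
  \<comment> \<open>The weight is moved into the inner integral as its \<open>q\<close>-th root, so
    that Minkowski's inequality applies with Lebesgue measure in \<open>y\<close>.\<close>
  have "ennreal_powr (\<integral>\<^sup>+y. ennreal_powr (\<integral>\<^sup>+t. F (y * t) * k t * indicator {0<..} t \<partial>lborel) q * W y \<partial>lborel) (1 / q)
      = ennreal_powr (\<integral>\<^sup>+y. ennreal_powr (\<integral>\<^sup>+t. ennreal_powr (W y) (1 / q) * (F (y * t) * k t * indicator {0<..} t) \<partial>lborel) q \<partial>lborel) (1 / q)"
    using q by (simp add: nn_integral_cmult ennreal_powr_mult mult.commute)
  also have "\<dots> \<le> (\<integral>\<^sup>+t. ennreal_powr (\<integral>\<^sup>+y. ennreal_powr (ennreal_powr (W y) (1 / q) * (F (y * t) * k t * indicator {0<..} t)) q \<partial>lborel) (1 / q) \<partial>lborel)"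
    by (rule minkowski_nn_integral) (use q in \<open>auto intro: lborel.sigma_finite_measure_axioms\<close>)
  also have "\<dots> \<le> (\<integral>\<^sup>+t. (k t * ennreal (t powr (-(\<alpha> + 1) / q) * (A powr (1 / q) * max t (1 / t) powr (\<delta> / q))) * indicator {0<..} t)
      * ennreal_powr J (1 / q) \<partial>lborel)"
  proof (rule nn_integral_mono)
    fix t :: real
    show "ennreal_powr (\<integral>\<^sup>+y. ennreal_powr (ennreal_powr (W y) (1 / q) * (F (y * t) * k t * indicator {0<..} t)) q \<partial>lborel) (1 / q)
      \<le> (k t * ennreal (t powr (-(\<alpha> + 1) / q) * (A powr (1 / q) * max t (1 / t) powr (\<delta> / q))) * indicator {0<..} t)
      * ennreal_powr J (1 / q)"
    proof (cases "0 < t")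
      case True
      have "(\<integral>\<^sup>+y. ennreal_powr (ennreal_powr (W y) (1 / q) * (F (y * t) * k t * indicator {0<..} t)) q \<partial>lborel)
        = (\<integral>\<^sup>+y. ennreal_powr (k t) q * (ennreal_powr (F (y * t)) q * W y) \<partial>lborel)"
        using q True by (intro nn_integral_cong) (simp add: ennreal_powr_mult mult_ac)
      also have "\<dots> = ennreal_powr (k t) q * (\<integral>\<^sup>+y. ennreal_powr (F (y * t)) q * W y \<partial>lborel)"
        by (rule nn_integral_cmult) measurable
      also have "\<dots> \<le> ennreal_powr (k t) q * (ennreal (t powr (- (\<alpha> + 1)) * (A * max t (1 / t) powr \<delta>)) * J)"
        by (intro mult_left_mono dil True) simp
      finally have "ennreal_powr (\<integral>\<^sup>+y. ennreal_powr (ennreal_powr (W y) (1 / q) * (F (y * t) * k t * indicator {0<..} t)) q \<partial>lborel) (1 / q)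
        \<le> ennreal_powr (ennreal_powr (k t) q * (ennreal (t powr (- (\<alpha> + 1)) * (A * max t (1 / t) powr \<delta>)) * J)) (1 / q)"
        by (rule ennreal_powr_mono[rotated]) (use q in simp)
      also have "\<dots> = k t * (ennreal (t powr (-(\<alpha> + 1) / q) * (A powr (1 / q) * max t (1 / t) powr (\<delta> / q))) * ennreal_powr J (1 / q))"
        using q A True by (simp add: ennreal_powr_mult ennreal_powr_ennreal powr_mult powr_powr)
      finally show ?thesis using True by (simp add: mult.assoc)
    qed simp
  qed
  also have "\<dots> = (\<integral>\<^sup>+t. k t * ennreal (t powr (-(\<alpha> + 1) / q) * (A powr (1 / q) * max t (1 / t) powr (\<delta> / q))) * indicator {0<..} t \<partial>lborel)
      * ennreal_powr J (1 / q)"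
    by (rule nn_integral_multc) measurable
  finally show ?thesis unfolding W_def J_def .
qed

text \<open>The constant is the kernel integral over a line times \<open>A powr (1 / q)\<close>
  times the integral of \<open>hardy_constant_finite\<close> with
  \<open>a = (\<alpha> + 1) / q\<close>, \<open>b = \<beta>\<close>,
  \<open>d = \<delta> / q\<close>; the conditions on \<open>\<delta>\<close> are its convergence
  conditions multiplied by \<open>q\<close>.\<close>

lemma positive_op_bound:
  fixes p q \<alpha> \<beta> A \<delta> :: real
  assumes p: "1 \<le> p" and q: "1 \<le> q" and \<beta>: "-1 < \<beta>"
    and w: "w \<in> borel_measurable (restrict_space borel {0<..})"
    and A: "0 \<le> A" and wt: "\<And>t v. 0 < t \<Longrightarrow> 0 < v \<Longrightarrow> 0 \<le> w v \<and> w (v / t) \<le> A * max t (1 / t) powr \<delta> * w v"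
    and \<delta>: "0 \<le> \<delta>" "\<delta> < \<alpha> + 1" "\<alpha> + 1 + \<delta> < q * (\<beta> + 1)"
  shows "\<exists>C::real. 0 \<le> C \<and> (\<forall>h\<in>borel_measurable borel.
    mixed_nn_norm p q w \<alpha> (positive_op \<beta> h) \<le> ennreal C * mixed_nn_norm p q w \<alpha> h)"
proof -
  define C0 where "C0 = (\<integral>\<^sup>+s. ennreal (cmod (Complex s 1) powr (-2 - \<beta>)) \<partial>lborel)"
  define k where "k t = ennreal ((1 + t) powr (-1 - \<beta>) * t powr \<beta>)" for t :: real
  define C1 where "C1 = (\<integral>\<^sup>+t. k t * ennreal (t powr (-(\<alpha> + 1) / q) * (A powr (1 / q) * max t (1 / t) powr (\<delta> / q))) * indicator {0<..} t \<partial>lborel)"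
  have [measurable]: "k \<in> borel_measurable borel" unfolding k_def by measurable
  have C0: "C0 < top" using nn_integral_kernel_line_finite[of "2 + \<beta>"] \<beta> unfolding C0_def by simp
  have C1: "C1 < top"
  proof -
    have "C1 = (\<integral>\<^sup>+t. ennreal (A powr (1 / q)) * (ennreal (t powr (\<beta> - (\<alpha> + 1) / q) * (1 + t) powr (-1 - \<beta>) * max t (1 / t) powr (\<delta> / q)) * indicator {0<..} t) \<partial>lborel)"
      unfolding C1_def
    proof (rule nn_integral_cong)
      fix t :: real
      show "k t * ennreal (t powr (-(\<alpha> + 1) / q) * (A powr (1 / q) * max t (1 / t) powr (\<delta> / q))) * indicator {0<..} t
        = ennreal (A powr (1 / q)) * (ennreal (t powr (\<beta> - (\<alpha> + 1) / q) * (1 + t) powr (-1 - \<beta>) * max t (1 / t) powr (\<delta> / q)) * indicator {0<..} t)"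
      proof (cases "0 < t")
        case True
        have "t powr (\<beta> - (\<alpha> + 1) / q) = t powr \<beta> * t powr (-(\<alpha> + 1) / q)"
          unfolding powr_add[symmetric] by (rule arg_cong[where f = "\<lambda>x. t powr x"]) (simp add: diff_divide_distrib add_divide_distrib)
        then show ?thesis using True
          unfolding k_def by (simp add: ennreal_mult[symmetric] mult_ac)
      qed simp
    qed
    also have "\<dots> = ennreal (A powr (1 / q)) * (\<integral>\<^sup>+t. ennreal (t powr (\<beta> - (\<alpha> + 1) / q) * (1 + t) powr (-1 - \<beta>) * max t (1 / t) powr (\<delta> / q)) * indicator {0<..} t \<partial>lborel)"
      by (rule nn_integral_cmult) measurable
    also have "\<dots> < top"
    proof -
      have "\<delta> / q < (\<alpha> + 1) / q" "(\<alpha> + 1) / q + \<delta> / q < \<beta> + 1" "0 \<le> \<delta> / q"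
        using q \<delta> by (auto simp: field_simps)
      from hardy_constant_finite[OF this(3,1,2)] show ?thesis
        by (simp add: ennreal_mult_less_top)
    qed
    finally show ?thesis .
  qed
  show ?thesis
  proof (intro exI conjI ballI)
    show "0 \<le> enn2real (C0 * C1)" by simp
    fix h :: "complex \<Rightarrow> ennreal" assume h [measurable]: "h \<in> borel_measurable borel"
    define W where "W y = ennreal (w y * y powr \<alpha>) * indicator {0<..} y" for y
    have W [measurable]: "W \<in> borel_measurable borel"
      unfolding W_def using w by (rule measurable_weight)
    let ?T = "\<lambda>y. \<integral>\<^sup>+t. row_norm p h (y * t) * k t * indicator {0<..} t \<partial>lborel"
    have "mixed_nn_norm p q w \<alpha> (positive_op \<beta> h) \<le> ennreal_powr (\<integral>\<^sup>+y. ennreal_powr (C0 * ?T y) q * W y \<partial>lborel) (1 / q)"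
      unfolding mixed_nn_norm_eq_row_norm[OF less_le_trans[OF zero_less_one p]] W_def[symmetric]
    proof (intro ennreal_powr_mono nn_integral_mono)
      fix y :: real
      show "ennreal_powr (row_norm p (positive_op \<beta> h) y) q * W y \<le> ennreal_powr (C0 * ?T y) q * W y"
      proof (cases "0 < y")
        case True
        then show ?thesis using row_norm_positive_op[OF p h True, of \<beta>] q
          unfolding C0_def k_def by (intro mult_right_mono ennreal_powr_mono) auto
      qed (simp add: W_def)
    qed (use q in simp)
    also have "\<dots> = ennreal_powr (ennreal_powr C0 q * (\<integral>\<^sup>+y. ennreal_powr (?T y) q * W y \<partial>lborel)) (1 / q)"
      by (subst nn_integral_cmult[symmetric]) (simp_all add: ennreal_powr_mult mult.assoc)
    also have "\<dots> = C0 * ennreal_powr (\<integral>\<^sup>+y. ennreal_powr (?T y) q * W y \<partial>lborel) (1 / q)"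
      using q by (simp add: ennreal_powr_mult)
    also have "\<dots> \<le> C0 * (C1 * mixed_nn_norm p q w \<alpha> h)"
      unfolding mixed_nn_norm_eq_row_norm[OF less_le_trans[OF zero_less_one p]] W_def C1_def
      by (intro mult_left_mono hardy_dilation_bound q w A wt) simp_all
    finally show "mixed_nn_norm p q w \<alpha> (positive_op \<beta> h) \<le> ennreal (enn2real (C0 * C1)) * mixed_nn_norm p q w \<alpha> h"
      using C0 C1 by (simp add: mult.assoc ennreal_mult_less_top)
  qed
qed

section \<open>Finiteness of the positive operator at every point\<close>

lemma measurable_positive_op [measurable]:
  assumes [measurable]: "h \<in> borel_measurable borel"
  shows "positive_op \<beta> h \<in> borel_measurable borel"
proof -
  have "positive_op \<beta> h = (\<lambda>z. \<integral>\<^sup>+v. (\<integral>\<^sup>+u. ennreal (cmod (z - cnj (Complex u v)) powr (-2 - \<beta>)) * h (Complex u v) \<partial>lborel)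
      * ennreal (v powr \<beta>) * indicator {0<..} v \<partial>lborel)"
    unfolding positive_op_def by (rule ext, rule nn_integral_half_plane) measurable
  also have "\<dots> \<in> borel_measurable borel" by measurable
  finally show ?thesis .
qed

lemma space_half_plane_measure [simp]: "space (half_plane_measure \<beta>) = upper_half_plane"
  by (simp add: half_plane_measure_def)

text \<open>A comparison of Harnack type: since \<open>cmod (z - cnj w) \<ge> Im z\<close> for all
  \<open>w\<close>, replacing \<open>z\<close> by \<open>z0\<close> enlarges this distance at most
  by a factor \<open>R\<close> that depends only on the two points.\<close>

lemma positive_op_comparable:
  assumes \<beta>: "-1 < \<beta>" and z: "z \<in> upper_half_plane" "z0 \<in> upper_half_plane"
    and [measurable]: "h \<in> borel_measurable borel"
    and fin: "positive_op \<beta> h z0 < top"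
  shows "positive_op \<beta> h z < top"
proof -
  define R where "R = cmod (z0 - z) / Im z + 1"
  have Im: "0 < Im z" using z by (simp add: upper_half_plane_def)
  have R: "1 \<le> R" using Im by (simp add: R_def)
  have le: "cmod (z - cnj w) powr (-2 - \<beta>) \<le> R powr (2 + \<beta>) * cmod (z0 - cnj w) powr (-2 - \<beta>)"
    if w: "w \<in> upper_half_plane" for w
  proof -
    have 1: "Im z \<le> cmod (z - cnj w)"
      using abs_Im_le_cmod[of "z - cnj w"] w Im by (auto simp: upper_half_plane_def)
    have pos: "0 < cmod (z0 - cnj w)"
      using w z by (auto simp: upper_half_plane_def complex_eq_iff)
    have "cmod (z0 - cnj w) \<le> cmod (z0 - z) + cmod (z - cnj w)"
      using norm_triangle_ineq[of "z0 - z" "z - cnj w"] by simp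
    also have "cmod (z0 - z) = cmod (z0 - z) / Im z * Im z" using Im by simp
    also have "\<dots> \<le> cmod (z0 - z) / Im z * cmod (z - cnj w)" using 1 Im by (intro mult_left_mono) auto
    finally have le: "cmod (z0 - cnj w) \<le> R * cmod (z - cnj w)" by (simp add: R_def algebra_simps)
    have "cmod (z - cnj w) powr (-2 - \<beta>) = R powr (2 + \<beta>) * (R * cmod (z - cnj w)) powr (-2 - \<beta>)"
      using R by (simp add: powr_mult powr_add[symmetric] mult.assoc[symmetric])
    also have "\<dots> \<le> R powr (2 + \<beta>) * cmod (z0 - cnj w) powr (-2 - \<beta>)"
      using le pos \<beta> by (intro mult_left_mono powr_mono2') auto
    finally show ?thesis .
  qed
  have "positive_op \<beta> h z \<le> (\<integral>\<^sup>+w. ennreal (R powr (2 + \<beta>)) * (ennreal (cmod (z0 - cnj w) powr (-2 - \<beta>)) * h w) \<partial>half_plane_measure \<beta>)"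
    unfolding positive_op_def
  proof (rule nn_integral_mono)
    fix w assume "w \<in> space (half_plane_measure \<beta>)"
    then have "ennreal (cmod (z - cnj w) powr (-2 - \<beta>)) \<le> ennreal (R powr (2 + \<beta>)) * ennreal (cmod (z0 - cnj w) powr (-2 - \<beta>))"
      using le[of w] by (simp add: ennreal_mult[symmetric] ennreal_leI)
    then show "ennreal (cmod (z - cnj w) powr (-2 - \<beta>)) * h w
        \<le> ennreal (R powr (2 + \<beta>)) * (ennreal (cmod (z0 - cnj w) powr (-2 - \<beta>)) * h w)"
      unfolding mult.assoc[symmetric] by (rule mult_right_mono) simp
  qed
  also have "\<dots> = ennreal (R powr (2 + \<beta>)) * positive_op \<beta> h z0"
    unfolding positive_op_def
    by (rule nn_integral_cmult) (intro measurable_half_plane_measure borel_measurable_lebesgue_onI, measurable)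
  also have "\<dots> < top" using fin by (simp add: ennreal_mult_less_top)
  finally show ?thesis .
qed

lemma mixed_nn_norm_top:
  assumes p: "0 < p" and q: "0 < q" and w: "\<And>y. 0 < y \<Longrightarrow> 0 < w y"
  shows "mixed_nn_norm p q w \<alpha> (\<lambda>_. top) = top"
proof -
  have "(\<integral>\<^sup>+y. (top :: ennreal) * ennreal (w y * y powr \<alpha>) * indicator {0<..} y \<partial>lborel) = (\<integral>\<^sup>+y. (top :: ennreal) * indicator {0<..} (y::real) \<partial>lborel)"
  proof (rule nn_integral_cong)
    fix y :: real
    show "(top :: ennreal) * ennreal (w y * y powr \<alpha>) * indicator {0<..} y = top * indicator {0<..} y"
    proof (cases "0 < y")
      case True
      then have "0 < w y * y powr \<alpha>" using w by simp
      then have "ennreal (w y * y powr \<alpha>) \<noteq> 0" by (simp only: ennreal_eq_0_iff not_le)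
      then show ?thesis using True by (simp add: ennreal_top_mult)
    qed simp
  qed
  also have "\<dots> = top"
  proof -
    have "emeasure lborel {0<..<1::real} \<le> emeasure lborel {0::real<..}" by (rule emeasure_mono) auto
    then show ?thesis by (subst nn_integral_cmult_indicator) (auto simp: ennreal_top_mult)
  qed
  finally show ?thesis
    unfolding mixed_nn_norm_def by (simp add: ennreal_top_mult)
qed

text \<open>A function that is infinite everywhere has infinite norm, so the value is finite
  somewhere and by comparability everywhere. This yields convergence of the defining integral at
  every point, not just at almost every one.\<close>

lemma positive_op_finite:
  assumes p: "0 < p" and q: "0 < q" and \<beta>: "-1 < \<beta>" and w: "\<And>y. 0 < y \<Longrightarrow> 0 < w y"
    and h: "h \<in> borel_measurable borel"
    and fin: "mixed_nn_norm p q w \<alpha> (positive_op \<beta> h) < top" and z: "z \<in> upper_half_plane"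
  shows "positive_op \<beta> h z < top"
proof -
  have "\<exists>z0\<in>upper_half_plane. positive_op \<beta> h z0 < top"
  proof (rule ccontr)
    assume "\<not> ?thesis"
    then have "mixed_nn_norm p q w \<alpha> (\<lambda>_. top) \<le> mixed_nn_norm p q w \<alpha> (positive_op \<beta> h)"
      by (intro mixed_nn_norm_mono p q) (auto simp: less_top)
    then show False using fin mixed_nn_norm_top[of p q w \<alpha>] p q w
      by (simp add: top_unique)
  qed
  then show ?thesis using positive_op_comparable[OF \<beta> z _ h] by blast
qed

section \<open>Sufficiency\<close>

text \<open>Serves both kernels, through their common modulus on the half-plane. Measurability is
  asked of the cut-off kernel, since only its values on the half-plane are meaningful.\<close>

lemma integral_op_boundedI:
  fixes K :: "complex \<Rightarrow> complex \<Rightarrow> complex"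
  assumes K [measurable]: "(\<lambda>(z, u). indicator upper_half_plane z * indicator upper_half_plane u * K z u) \<in> borel_measurable (borel \<Otimes>\<^sub>M borel)"
    and Kn: "\<And>z u. z \<in> upper_half_plane \<Longrightarrow> u \<in> upper_half_plane \<Longrightarrow> cmod (K z u) = b * cmod (z - cnj u) powr (-2 - \<beta>)"
    and b: "0 \<le> b" and p: "1 \<le> p" and q: "1 \<le> q" and \<beta>: "-1 < \<beta>"
    and w [measurable]: "w \<in> borel_measurable (restrict_space borel {0<..})" and w_pos: "\<And>y. 0 < y \<Longrightarrow> 0 < w y"
    and C: "0 \<le> C" "\<And>h. h \<in> borel_measurable borel \<Longrightarrow>
      mixed_nn_norm p q w \<alpha> (positive_op \<beta> h) \<le> ennreal C * mixed_nn_norm p q w \<alpha> h"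
  shows "integral_op_bounded \<beta> K p q w \<alpha>"
  unfolding integral_op_bounded_def
proof (intro exI[of _ "b * C"] ballI)
  fix f assume f: "f \<in> mixed_space p q w \<alpha>"
  then have f_meas: "f \<in> borel_measurable (lebesgue_on upper_half_plane)" and f_fin: "mixed_norm p q w \<alpha> f < top"
    by (auto simp: mixed_space_def)
  obtain g where g [measurable]: "g \<in> borel_measurable borel" and fg: "AE u in lborel. u \<in> upper_half_plane \<longrightarrow> f u = g u"
    using borel_representative[OF f_meas] .
  define K' where "K' z u = indicator upper_half_plane z * indicator upper_half_plane u * K z u" for z u
  have K' [measurable]: "case_prod K' \<in> borel_measurable (borel \<Otimes>\<^sub>M borel)"
    unfolding K'_def using K by simp
  have K'_eq: "K' z u = K z u" if "z \<in> upper_half_plane" "u \<in> upper_half_plane" for z u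
    using that by (simp add: K'_def)
  define h where "h u = ennreal (cmod (g u))" for u
  have h [measurable]: "h \<in> borel_measurable borel" unfolding h_def by measurable
  have norm_f: "mixed_norm p q w \<alpha> f = mixed_nn_norm p q w \<alpha> h"
    unfolding mixed_norm_eq by (rule mixed_nn_norm_cong_AE, use fg in eventually_elim) (auto simp: h_def)
  have bound: "mixed_nn_norm p q w \<alpha> (positive_op \<beta> h) \<le> ennreal C * mixed_norm p q w \<alpha> f"
    using C(2)[OF h] by (simp add: norm_f)
  also have "\<dots> < top" using f_fin by (simp add: ennreal_mult_less_top)
  finally have "mixed_nn_norm p q w \<alpha> (positive_op \<beta> h) < top" .
  then have op_fin: "positive_op \<beta> h z < top" if "z \<in> upper_half_plane" for z
    using positive_op_finite[of p q \<beta> w h \<alpha> z] w_pos p q \<beta> h that by simp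
  have fgM: "AE u in half_plane_measure \<beta>. f u = g u"
    by (rule AE_half_plane_measureI) (rule fg)
  have nn: "(\<integral>\<^sup>+u. ennreal (norm (K z u * f u)) \<partial>half_plane_measure \<beta>) = ennreal b * positive_op \<beta> h z"
    if z: "z \<in> upper_half_plane" for z
  proof -
    have "(\<integral>\<^sup>+u. ennreal (norm (K z u * f u)) \<partial>half_plane_measure \<beta>)
        = (\<integral>\<^sup>+u. ennreal b * (ennreal (cmod (z - cnj u) powr (-2 - \<beta>)) * h u) \<partial>half_plane_measure \<beta>)"
    proof (rule nn_integral_cong_AE, use fgM AE_space in eventually_elim)
      case (elim u)
      then show ?case using Kn[OF z, of u] b by (simp add: norm_mult h_def ennreal_mult mult.assoc)
    qed
    also have "\<dots> = ennreal b * positive_op \<beta> h z"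
      unfolding positive_op_def
      by (rule nn_integral_cmult) (intro measurable_half_plane_measure borel_measurable_lebesgue_onI, measurable)
    finally show ?thesis .
  qed
  have int: "integrable (half_plane_measure \<beta>) (\<lambda>u. K z u * f u)" if z: "z \<in> upper_half_plane" for z
  proof (rule integrableI_bounded)
    have "(\<lambda>u. K' z u) \<in> borel_measurable borel" by measurable
    then have "(\<lambda>u. K' z u) \<in> borel_measurable (half_plane_measure \<beta>)"
      by (intro measurable_half_plane_measure borel_measurable_lebesgue_onI)
    then have "(\<lambda>u. K' z u * f u) \<in> borel_measurable (half_plane_measure \<beta>)"
      using measurable_half_plane_measure[OF f_meas] by (rule borel_measurable_times)
    then show "(\<lambda>u. K z u * f u) \<in> borel_measurable (half_plane_measure \<beta>)"
      by (subst measurable_cong[where g = "\<lambda>u. K' z u * f u"]) (auto simp: K'_eq z)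
    show "(\<integral>\<^sup>+u. ennreal (norm (K z u * f u)) \<partial>half_plane_measure \<beta>) < \<infinity>"
      using op_fin[OF z] by (simp add: nn[OF z] ennreal_mult_less_top)
  qed
  have op_eq: "integral_op \<beta> K f z = (LINT u|lborel. (indicator upper_half_plane u * Im u powr \<beta>) *\<^sub>R (K' z u * g u))"
    if z: "z \<in> upper_half_plane" for z
  proof -
    have "integral_op \<beta> K f z = (LINT u|half_plane_measure \<beta>. K' z u * g u)"
      unfolding integral_op_def
    proof (rule integral_cong_AE)
      show "(\<lambda>u. K z u * f u) \<in> borel_measurable (half_plane_measure \<beta>)" using int[OF z] by auto
      show "(\<lambda>u. K' z u * g u) \<in> borel_measurable (half_plane_measure \<beta>)"
        by (intro measurable_half_plane_measure borel_measurable_lebesgue_onI, measurable)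
      show "AE u in half_plane_measure \<beta>. K z u * f u = K' z u * g u"
        using fgM AE_space by eventually_elim (auto simp: K'_eq z)
    qed
    also have "\<dots> = (LINT u|lborel. (indicator upper_half_plane u * Im u powr \<beta>) *\<^sub>R (K' z u * g u))"
      by (rule integral_half_plane) measurable
    finally show ?thesis .
  qed
  have "(\<lambda>z. LINT u|lborel. (indicator upper_half_plane u * Im u powr \<beta>) *\<^sub>R (K' z u * g u)) \<in> borel_measurable borel"
    by measurable
  then have "(\<lambda>z. LINT u|lborel. (indicator upper_half_plane u * Im u powr \<beta>) *\<^sub>R (K' z u * g u)) \<in> borel_measurable (lebesgue_on upper_half_plane)"
    by (rule borel_measurable_lebesgue_onI)
  then have meas: "integral_op \<beta> K f \<in> borel_measurable (lebesgue_on upper_half_plane)"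
    by (subst measurable_cong[OF op_eq]) auto
  have "mixed_norm p q w \<alpha> (integral_op \<beta> K f) \<le> mixed_nn_norm p q w \<alpha> (\<lambda>z. ennreal b * positive_op \<beta> h z)"
    unfolding mixed_norm_eq
  proof (rule mixed_nn_norm_mono)
    fix z assume z: "z \<in> upper_half_plane"
    show "ennreal (cmod (integral_op \<beta> K f z)) \<le> ennreal b * positive_op \<beta> h z"
      unfolding integral_op_def nn[OF z, symmetric] by (rule integral_norm_bound_ennreal) (rule int[OF z])
  qed (use p q in auto)
  also have "\<dots> = ennreal b * mixed_nn_norm p q w \<alpha> (positive_op \<beta> h)"
    using p q by (intro mixed_nn_norm_cmult) auto
  also have "\<dots> \<le> ennreal b * (ennreal C * mixed_norm p q w \<alpha> f)"
    by (intro mult_left_mono bound) simp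
  also have "\<dots> = ennreal (b * C) * mixed_norm p q w \<alpha> f"
    using b C(1) by (simp add: ennreal_mult mult.assoc)
  finally have le: "mixed_norm p q w \<alpha> (integral_op \<beta> K f) \<le> ennreal (b * C) * mixed_norm p q w \<alpha> f" .
  also have "\<dots> < top" using f_fin by (simp add: ennreal_mult_less_top)
  finally show "(\<forall>z\<in>upper_half_plane. integrable (half_plane_measure \<beta>) (\<lambda>u. K z u * f u)) \<and>
        integral_op \<beta> K f \<in> mixed_space p q w \<alpha> \<and>
        mixed_norm p q w \<alpha> (integral_op \<beta> K f) \<le> ennreal (b * C) * mixed_norm p q w \<alpha> f"
    using le meas int by (auto simp: mixed_space_def)
qed

section \<open>Modulus and measurability of the two Bergman kernels\<close>

lemma cmod_bergman_kernel:
  assumes "z \<in> upper_half_plane" "u \<in> upper_half_plane"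
  shows "cmod (bergman_kernel c \<beta> z u) = cmod c * cmod (z - cnj u) powr (-2 - \<beta>)"
proof -
  have "cmod ((z - cnj u) powr of_real (2 + \<beta>)) = cmod (z - cnj u) powr (2 + \<beta>)"
  proof -
    have "z - cnj u \<noteq> 0" using assms by (auto simp: upper_half_plane_def complex_eq_iff)
    then show ?thesis by (simp add: powr_def)
  qed
  moreover have "-2 - \<beta> = - (2 + \<beta>)" by simp
  ultimately show ?thesis
    by (simp only: bergman_kernel_def divide_inverse norm_mult norm_inverse powr_minus)
qed

lemma cmod_abs_bergman_kernel: "cmod (abs_bergman_kernel c \<beta> z u) = cmod (bergman_kernel c \<beta> z u)"
  by (simp add: abs_bergman_kernel_def)

text \<open>The principal power is continuous on the upper half-plane, which contains
  \<open>z - cnj u\<close>; cut off to that set it is Borel, and the cut-off does not alter the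
  kernel there.\<close>

lemma measurable_bergman_kernel:
  "(\<lambda>(z, u). indicator upper_half_plane z * indicator upper_half_plane u * bergman_kernel c \<beta> z u) \<in> borel_measurable (borel \<Otimes>\<^sub>M borel)"
proof -
  define P where "P \<zeta> = indicator upper_half_plane \<zeta> *\<^sub>R \<zeta> powr (of_real (2 + \<beta>))" for \<zeta> :: complex
  have "continuous_on upper_half_plane (\<lambda>\<zeta>. \<zeta> powr (of_real (2 + \<beta>)))"
    by (intro continuous_intros) (auto simp: upper_half_plane_def complex_nonpos_Reals_iff)
  then have [measurable]: "P \<in> borel_measurable borel"
    unfolding P_def by (intro borel_measurable_continuous_on_indicator) auto
  have "(\<lambda>(z, u). indicator upper_half_plane z * indicator upper_half_plane u * (c / P (z - cnj u))) \<in> borel_measurable (borel \<Otimes>\<^sub>M borel)"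
    by measurable
  also have "(\<lambda>(z, u). indicator upper_half_plane z * indicator upper_half_plane u * (c / P (z - cnj u)))
    = (\<lambda>(z, u). indicator upper_half_plane z * indicator upper_half_plane u * bergman_kernel c \<beta> z u)"
    by (auto simp: fun_eq_iff indicator_def P_def bergman_kernel_def upper_half_plane_def)
  finally show ?thesis .
qed

lemma measurable_abs_bergman_kernel:
  "(\<lambda>(z, u). indicator upper_half_plane z * indicator upper_half_plane u * abs_bergman_kernel c \<beta> z u) \<in> borel_measurable (borel \<Otimes>\<^sub>M borel)"
proof -
  note [measurable] = measurable_bergman_kernel[of c \<beta>]
  have "(\<lambda>x. complex_of_real (cmod (case x of (z, u) \<Rightarrow> indicator upper_half_plane z * indicator upper_half_plane u * bergman_kernel c \<beta> z u)))
     \<in> borel_measurable (borel \<Otimes>\<^sub>M borel)"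
    by measurable
  also have "(\<lambda>x. complex_of_real (cmod (case x of (z, u) \<Rightarrow> indicator upper_half_plane z * indicator upper_half_plane u * bergman_kernel c \<beta> z u)))
    = (\<lambda>(z, u). indicator upper_half_plane z * indicator upper_half_plane u * abs_bergman_kernel c \<beta> z u)"
    by (auto simp: fun_eq_iff indicator_def abs_bergman_kernel_def)
  finally show ?thesis .
qed

section \<open>Logarithmic weights\<close>

lemma growth_function_nonneg: "growth_function \<Phi> \<Longrightarrow> 0 \<le> t \<Longrightarrow> 0 \<le> \<Phi> t"
  unfolding growth_function_def by (metis atLeast_iff imageI)

lemma growth_function_mono: "growth_function \<Phi> \<Longrightarrow> 0 \<le> s \<Longrightarrow> s \<le> t \<Longrightarrow> \<Phi> s \<le> \<Phi> t"
  unfolding growth_function_def mono_on_def by auto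

text \<open>Monotonicity and surjectivity force \<open>\<Phi> 0 = 0\<close>, so a positive value is
  attained at a positive argument.\<close>

lemma growth_function_attains:
  assumes "growth_function \<Phi>" "0 < r"
  obtains t where "0 < t" "\<Phi> t = r"
proof -
  obtain t where t: "0 \<le> t" "\<Phi> t = r"
    using assms unfolding growth_function_def by (metis atLeast_iff imageE less_imp_le)
  obtain s where s: "0 \<le> s" "\<Phi> s = 0"
    using assms unfolding growth_function_def by (metis atLeast_iff imageE order_refl)
  have "\<Phi> 0 = 0"
    using growth_function_mono[OF assms(1) _ s(1)] growth_function_nonneg[OF assms(1), of 0] s by auto
  then have "0 < t" using t assms(2) by (cases "t = 0") auto
  then show ?thesis using t that by blast
qed

text \<open>Puts the two classes on one footing: if \<open>\<Phi> t / t\<close> is nonincreasing,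
  then \<open>\<Phi> (s * t) \<le> t * \<Phi> s\<close> for \<open>t \<ge> 1\<close>, which is upper
  type 1 with constant 1. The bound \<open>1 \<le> C\<close> keeps \<open>ln C\<close>
  nonnegative.\<close>

lemma growth_upper_bound:
  assumes "\<Phi> \<in> lower_growth \<union> upper_growth"
  obtains C r where "growth_function \<Phi>" "1 \<le> C" "0 \<le> r" "\<And>s t. 0 < s \<Longrightarrow> 1 \<le> t \<Longrightarrow> \<Phi> (s * t) \<le> C * t powr r * \<Phi> s"
proof (cases "\<Phi> \<in> upper_growth")
  case True
  then obtain r C where g: "growth_function \<Phi>" and r: "1 \<le> r" and C: "0 < C" "\<And>s t. 1 \<le> t \<Longrightarrow> 0 < s \<Longrightarrow> \<Phi> (s * t) \<le> C * t powr r * \<Phi> s"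
    unfolding upper_growth_def upper_growth_type_def upper_type_def by auto
  show ?thesis
  proof (rule that[of "max 1 C" r])
    fix s t :: real assume st: "0 < s" "1 \<le> t"
    have "C * t powr r * \<Phi> s \<le> max 1 C * t powr r * \<Phi> s"
      using growth_function_nonneg[OF g, of s] st by (intro mult_right_mono) auto
    then show "\<Phi> (s * t) \<le> max 1 C * t powr r * \<Phi> s"
      using C(2)[OF st(2,1)] by simp
  qed (use g r in auto)
next
  case False
  then have g: "growth_function \<Phi>" and anti: "antimono_on {0<..} (\<lambda>t. \<Phi> t / t)"
    using assms unfolding lower_growth_def lower_growth_type_def by auto
  show ?thesis
  proof (rule that[of 1 1])
    fix s t :: real assume st: "0 < s" "1 \<le> t"
    have "\<Phi> (s * t) / (s * t) \<le> \<Phi> s / s"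
      using anti st by (auto simp: monotone_on_def)
    then show "\<Phi> (s * t) \<le> 1 * t powr 1 * \<Phi> s"
      using st by (simp add: field_simps)
  qed (use g in auto)
qed

text \<open>Logarithms turn polynomial growth into an additive error. For \<open>t \<ge> 1\<close>
  the growth bound is used, for \<open>t < 1\<close> monotonicity; the case
  \<open>\<Phi> (s * t) \<le> 1\<close> is split off because the left side is 0 there.\<close>

lemma ln_plus_dilate:
  assumes g: "growth_function \<Phi>" and C: "1 \<le> C" and r: "0 \<le> r"
    and up: "\<And>s t. 0 < s \<Longrightarrow> 1 \<le> t \<Longrightarrow> \<Phi> (s * t) \<le> C * t powr r * \<Phi> s"
    and s: "0 < s" and t: "0 < t"
  shows "ln_plus (\<Phi> (s * t)) \<le> ln_plus (\<Phi> s) + ln C + r * \<bar>ln t\<bar>"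
proof (cases "\<Phi> (s * t) \<le> 1")
  case True
  then have "ln_plus (\<Phi> (s * t)) = 0"
    using growth_function_nonneg[OF g, of "s * t"] s t
    by (cases "\<Phi> (s * t) = 0") (auto simp: ln_plus_def)
  then show ?thesis using C r by (simp add: ln_plus_def)
next
  case False
  then have lp: "ln_plus (\<Phi> (s * t)) = ln (\<Phi> (s * t))" by (simp add: ln_plus_def)
  show ?thesis
  proof (cases "1 \<le> t")
    case t1: True
    have pos: "0 < \<Phi> s"
      using up[OF s t1] False growth_function_nonneg[OF g, of s] s by (cases "\<Phi> s = 0") auto
    have "ln (\<Phi> (s * t)) \<le> ln (C * t powr r * \<Phi> s)"
      using up[OF s t1] False by simp
    also have "\<dots> = ln C + r * ln t + ln (\<Phi> s)"
      using C t pos by (simp add: ln_mult ln_powr)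
    finally show ?thesis using lp t1 by (simp add: ln_plus_def)
  next
    case t1: False
    have "\<Phi> (s * t) \<le> \<Phi> s"
      using s t t1 by (intro growth_function_mono[OF g]) (auto simp: mult_le_cancel_left1)
    then have "ln (\<Phi> (s * t)) \<le> ln (\<Phi> s)" using False by simp
    moreover have "0 \<le> ln C" "0 \<le> r * \<bar>ln t\<bar>" using C r by auto
    ultimately show ?thesis using lp by (simp add: ln_plus_def)
  qed
qed

lemma log_weight_ge_1: "\<epsilon> \<in> {0, 1} \<times> {0, 1} \<Longrightarrow> 1 \<le> log_weight \<Phi> \<epsilon> t"
  by (auto simp: log_weight_def ln_plus_def)

text \<open>The term with \<open>\<Phi> (1 / t)\<close> is a dilation of \<open>1 / s\<close> by
  \<open>1 / t\<close>, whose logarithm has the same modulus as that of \<open>t\<close>. The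
  doubled constants account for the two terms of the weight.\<close>

lemma log_weight_dilate:
  assumes \<Phi>: "\<Phi> \<in> lower_growth \<union> upper_growth" and \<epsilon>: "\<epsilon> \<in> {0, 1} \<times> {0, 1}"
  obtains D E where "0 \<le> D" "0 \<le> E" "\<And>s t. 0 < s \<Longrightarrow> 0 < t \<Longrightarrow> log_weight \<Phi> \<epsilon> (s * t) \<le> log_weight \<Phi> \<epsilon> s + D + E * \<bar>ln t\<bar>"
proof -
  obtain C r where g: "growth_function \<Phi>" "1 \<le> C" "0 \<le> r" "\<And>s t. 0 < s \<Longrightarrow> 1 \<le> t \<Longrightarrow> \<Phi> (s * t) \<le> C * t powr r * \<Phi> s"
    using growth_upper_bound[OF \<Phi>] by blast
  show ?thesis
  proof (rule that[of "2 * ln C" "2 * r"])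
    fix s t :: real assume st: "0 < s" "0 < t"
    have "ln_plus (\<Phi> (1 / (s * t))) \<le> ln_plus (\<Phi> (1 / s)) + ln C + r * \<bar>ln t\<bar>"
      using ln_plus_dilate[OF g, of "1 / s" "1 / t"] st by (simp add: ln_div)
    moreover have "ln_plus (\<Phi> (s * t)) \<le> ln_plus (\<Phi> s) + ln C + r * \<bar>ln t\<bar>"
      using ln_plus_dilate[OF g st] .
    moreover have "0 \<le> ln C" "0 \<le> r * \<bar>ln t\<bar>" using g by auto
    ultimately show "log_weight \<Phi> \<epsilon> (s * t) \<le> log_weight \<Phi> \<epsilon> s + 2 * ln C + 2 * r * \<bar>ln t\<bar>"
      using \<epsilon> by (auto simp: log_weight_def)
  qed (use g in auto)
qed

lemma measurable_log_weight:
  assumes "growth_function \<Phi>"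
  shows "(\<lambda>y. log_weight \<Phi> \<epsilon> y powr k) \<in> borel_measurable (restrict_space borel {0<..})"
proof -
  have cont: "continuous_on {0..} \<Phi>" using assms by (simp add: growth_function_def)
  have [measurable]: "\<Phi> \<in> borel_measurable (restrict_space borel {0<..})"
    by (intro borel_measurable_continuous_on_restrict continuous_on_subset[OF cont]) auto
  have [measurable]: "(\<lambda>y. \<Phi> (1 / y)) \<in> borel_measurable (restrict_space borel {0<..})"
    by (intro borel_measurable_continuous_on_restrict continuous_on_compose2[OF cont] continuous_intros) auto
  show ?thesis unfolding log_weight_def ln_plus_def by measurable
qed

text \<open>The upper comparison of \<open>x\<close> with \<open>y\<close> serves
  \<open>k \<ge> 0\<close>, the lower one \<open>k < 0\<close>.\<close>

lemma powr_comparable: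
  fixes x y \<rho> k :: real
  assumes "1 \<le> x" "1 \<le> y" "x \<le> \<rho> * y" "y \<le> \<rho> * x"
  shows "x powr k \<le> \<rho> powr \<bar>k\<bar> * y powr k"
proof -
  have \<rho>: "0 < \<rho>" using assms by (smt (verit) mult_nonpos_nonneg)
  show ?thesis
  proof (cases "0 \<le> k")
    case True
    then have "x powr k \<le> (\<rho> * y) powr k" using assms by (intro powr_mono2) auto
    then show ?thesis using True assms \<rho> by (simp add: powr_mult)
  next
    case False
    have "y / \<rho> \<le> x" using assms \<rho> by (simp add: field_simps)
    then have "x powr k \<le> (y / \<rho>) powr k" using False assms \<rho> by (intro powr_mono2') auto
    also have "\<dots> = \<rho> powr (- k) * y powr k" using assms \<rho> by (simp add: powr_divide powr_minus field_simps)
    finally show ?thesis using False by simp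
  qed
qed

text \<open>As the weight is at least 1, an additive oscillation \<open>D + E * ln M\<close> amounts
  to at most a factor \<open>1 + D + E * ln M\<close>, and the logarithm is dominated by any
  positive power of \<open>M = max t (1 / t)\<close>.\<close>

lemma log_weight_powr_dilate:
  assumes \<Phi>: "\<Phi> \<in> lower_growth \<union> upper_growth" and \<epsilon>: "\<epsilon> \<in> {0, 1} \<times> {0, 1}" and \<delta>: "0 < \<delta>"
  obtains A where "0 \<le> A" "\<And>t v. 0 < t \<Longrightarrow> 0 < v \<Longrightarrow>
    log_weight \<Phi> \<epsilon> (v / t) powr k \<le> A * max t (1 / t) powr \<delta> * log_weight \<Phi> \<epsilon> v powr k"
proof -
  obtain D E where D: "0 \<le> D" "0 \<le> E" and dil: "\<And>s t. 0 < s \<Longrightarrow> 0 < t \<Longrightarrow> log_weight \<Phi> \<epsilon> (s * t) \<le> log_weight \<Phi> \<epsilon> s + D + E * \<bar>ln t\<bar>"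
    using log_weight_dilate[OF \<Phi> \<epsilon>] by blast
  \<comment> \<open>After raising to the power \<open>\<bar>k\<bar>\<close> the exponent must not
    exceed \<open>\<delta>\<close>; the summand 1 avoids a division by 0 when
    \<open>k = 0\<close>.\<close>
  define \<eta> where "\<eta> = \<delta> / (\<bar>k\<bar> + 1)"
  have \<eta>: "0 < \<eta>" "\<eta> * \<bar>k\<bar> \<le> \<delta>" using \<delta> by (auto simp: \<eta>_def field_simps)
  define A where "A = 1 + D + E / \<eta>"
  have A: "0 \<le> A" using D \<eta> by (simp add: A_def)
  show ?thesis
  proof (rule that[of "A powr \<bar>k\<bar>"])
    fix t v :: real assume t: "0 < t" and v: "0 < v"
    let ?\<omega> = "log_weight \<Phi> \<epsilon>"
    define M where "M = max t (1 / t)"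
    have M: "1 \<le> M" using t by (cases "1 \<le> t") (auto simp: M_def le_max_iff_disj field_simps)
    have lnM: "\<bar>ln t\<bar> = ln M"
    proof (cases "1 \<le> t")
      case True
      then have "1 / t \<le> t" using t by (simp add: field_simps) (metis mult_le_cancel_left1 mult_mono order_trans zero_le_one mult_1 linorder_not_le)
      then show ?thesis using True by (simp add: M_def max_def)
    next
      case False
      then have "t \<le> 1 / t" using t by (simp add: field_simps) (smt (verit) mult_le_one)
      then have "M = 1 / t" by (simp add: M_def)
      then show ?thesis using False t by (simp add: ln_div)
    qed
    define \<rho> where "\<rho> = 1 + D + E * ln M"
    have \<rho>1: "1 \<le> \<rho>" using D M by (simp add: \<rho>_def)
    have ineq: "x \<le> \<rho> * y" if "x \<le> y + D + E * ln M" "1 \<le> y" for x y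
    proof -
      have "(D + E * ln M) * 1 \<le> (D + E * ln M) * y" using that D M by (intro mult_left_mono) auto
      then show ?thesis using that by (simp add: \<rho>_def algebra_simps)
    qed
    have \<omega>1: "1 \<le> ?\<omega> y" for y using log_weight_ge_1[OF \<epsilon>] .
    have "?\<omega> (v / t) \<le> \<rho> * ?\<omega> v"
      using dil[OF v, of "1 / t"] t \<omega>1 by (intro ineq) (auto simp: ln_div lnM)
    moreover have "?\<omega> v \<le> \<rho> * ?\<omega> (v / t)"
      using dil[of "v / t" t] t v \<omega>1 by (intro ineq) (auto simp: lnM)
    ultimately have "?\<omega> (v / t) powr k \<le> \<rho> powr \<bar>k\<bar> * ?\<omega> v powr k"
      using \<omega>1 by (intro powr_comparable) auto
    also have "\<rho> powr \<bar>k\<bar> \<le> A powr \<bar>k\<bar> * M powr \<delta>"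
    proof -
      have "ln M \<le> M powr \<eta> / \<eta>" using M \<eta> by (intro ln_powr_bound) auto
      then have "E * ln M \<le> E / \<eta> * M powr \<eta>" using D by (metis mult_left_mono times_divide_eq_left times_divide_eq_right)
      moreover have "1 \<le> M powr \<eta>" using M \<eta> by (simp add: ge_one_powr_ge_zero)
      then have "(1 + D) * 1 \<le> (1 + D) * M powr \<eta>" using D by (intro mult_left_mono) auto
      ultimately have "\<rho> \<le> A * M powr \<eta>" by (simp add: \<rho>_def A_def algebra_simps)
      then have "\<rho> powr \<bar>k\<bar> \<le> (A * M powr \<eta>) powr \<bar>k\<bar>" using \<rho>1 by (intro powr_mono2) auto
      also have "\<dots> = A powr \<bar>k\<bar> * M powr (\<eta> * \<bar>k\<bar>)" using A by (simp add: powr_mult powr_powr)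
      also have "\<dots> \<le> A powr \<bar>k\<bar> * M powr \<delta>" using M \<eta> by (intro mult_left_mono powr_mono) auto
      finally show ?thesis .
    qed
    finally show "?\<omega> (v / t) powr k \<le> A powr \<bar>k\<bar> * max t (1 / t) powr \<delta> * ?\<omega> v powr k"
      unfolding M_def[symmetric] by (simp add: mult_right_mono)
  qed simp
qed

text \<open>The weight is slowly varying at \<open>0\<close>: either it is constantly \<open>1\<close> there or it tends to
  infinity, and then the bounded oscillation on a window of fixed logarithmic length is negligible.\<close>

lemma log_weight_powr_window:
  assumes \<Phi>: "\<Phi> \<in> lower_growth \<union> upper_growth" and \<epsilon>: "\<epsilon> \<in> {0, 1} \<times> {0, 1}" and ab: "0 < a" "a \<le> b"
  obtains l m where "0 < l" "0 < m" "\<And>y. l * a \<le> y \<Longrightarrow> y \<le> l * b \<Longrightarrow>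
    m \<le> log_weight \<Phi> \<epsilon> y powr k \<and> log_weight \<Phi> \<epsilon> y powr k \<le> 2 * m"
proof -
  let ?\<omega> = "log_weight \<Phi> \<epsilon>"
  have \<omega>1: "1 \<le> ?\<omega> y" for y using log_weight_ge_1[OF \<epsilon>] .
  obtain D E where D: "0 \<le> D" "0 \<le> E" and dil: "\<And>s t. 0 < s \<Longrightarrow> 0 < t \<Longrightarrow> ?\<omega> (s * t) \<le> ?\<omega> s + D + E * \<bar>ln t\<bar>"
    using log_weight_dilate[OF \<Phi> \<epsilon>] by blast
  obtain C r where g: "growth_function \<Phi>" using growth_upper_bound[OF \<Phi>] by blast
  define H where "H = D + E * (\<bar>ln a\<bar> + \<bar>ln b\<bar>)"
  have H: "0 \<le> H" using D by (simp add: H_def)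
  \<comment> \<open>Weights within the factor \<open>\<theta>\<close> of each other have
    \<open>k\<close>-th powers within \<open>sqrt 2\<close>. Measured from the value at
    \<open>l\<close> this is \<open>sqrt 2\<close> upwards and downwards, hence 2 in total.\<close>
  define \<theta> :: real where "\<theta> = 2 powr (1 / (2 * (\<bar>k\<bar> + 1)))"
  have \<theta>: "1 < \<theta>" unfolding \<theta>_def by (intro gr_one_powr) auto
  have \<theta>k: "\<theta> powr \<bar>k\<bar> \<le> sqrt 2"
  proof -
    have "\<theta> powr \<bar>k\<bar> = 2 powr (\<bar>k\<bar> / (2 * (\<bar>k\<bar> + 1)))" unfolding \<theta>_def by (simp add: powr_powr)
    also have "\<dots> \<le> 2 powr (1 / 2)" by (intro powr_mono) (auto simp: field_simps)
    finally show ?thesis by (simp add: powr_half_sqrt)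
  qed
  \<comment> \<open>Where the weight is at least \<open>N\<close>, the additive oscillation
    \<open>H\<close> over the window is at most \<open>\<theta> - 1\<close> times the
    weight.\<close>
  define N where "N = H / (\<theta> - 1)"
  \<comment> \<open>The alternative is decided by \<open>fst \<epsilon>\<close>: for small
    \<open>y\<close> the term with \<open>\<Phi> y\<close> is 0, whereas
    \<open>\<Phi> (1 / y)\<close> exceeds any bound.\<close>
  have "\<exists>t0>0. (\<forall>y. 0 < y \<longrightarrow> y \<le> t0 \<longrightarrow> ?\<omega> y = 1) \<or> (\<forall>y. 0 < y \<longrightarrow> y \<le> t0 \<longrightarrow> N \<le> ?\<omega> y)"
  proof (cases "fst \<epsilon> = 0")
    case True
    obtain t0 where t0: "0 < t0" "\<Phi> t0 = 1" using growth_function_attains[OF g, of 1] by auto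
    have "?\<omega> y = 1" if y: "0 < y" "y \<le> t0" for y
    proof -
      have "0 \<le> \<Phi> y" "\<Phi> y \<le> 1" using growth_function_mono[OF g, of y t0] growth_function_nonneg[OF g, of y] y t0 by auto
      then have "ln_plus (\<Phi> y) = 0" by (cases "\<Phi> y = 0") (auto simp: ln_plus_def)
      then show ?thesis using True by (simp add: log_weight_def)
    qed
    then show ?thesis using t0 by blast
  next
    case False
    then have \<epsilon>1: "fst \<epsilon> = 1" using \<epsilon> by auto
    obtain s0 where s0: "0 < s0" "\<Phi> s0 = exp N" using growth_function_attains[OF g, of "exp N"] by auto
    have "N \<le> ?\<omega> y" if y: "0 < y" "y \<le> 1 / s0" for y
    proof -
      have "s0 \<le> 1 / y" using y s0 by (simp add: field_simps)
      then have "exp N \<le> \<Phi> (1 / y)" using growth_function_mono[OF g, of s0 "1 / y"] s0 by auto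
      then have "N \<le> ln (\<Phi> (1 / y))" by (metis exp_gt_zero less_le_trans ln_ge_iff)
      then have "N \<le> ln_plus (\<Phi> (1 / y))" by (simp add: ln_plus_def)
      moreover have "0 \<le> snd \<epsilon> * ln_plus (\<Phi> y)" using \<epsilon> by (auto simp: ln_plus_def)
      ultimately show ?thesis using \<epsilon>1 by (simp add: log_weight_def)
    qed
    then show ?thesis using s0 by (intro exI[of _ "1 / s0"]) auto
  qed
  then obtain t0 where t0: "0 < t0" and alt: "(\<forall>y. 0 < y \<longrightarrow> y \<le> t0 \<longrightarrow> ?\<omega> y = 1) \<or> (\<forall>y. 0 < y \<longrightarrow> y \<le> t0 \<longrightarrow> N \<le> ?\<omega> y)"
    by blast
  have close: "?\<omega> x \<le> \<theta> * ?\<omega> y" if "0 < x" "x \<le> t0" "0 < y" "y \<le> t0" "?\<omega> x \<le> ?\<omega> y + H" for x y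
    using alt
  proof
    assume "\<forall>y. 0 < y \<longrightarrow> y \<le> t0 \<longrightarrow> ?\<omega> y = 1"
    then show ?thesis using that \<theta> by simp
  next
    assume "\<forall>y. 0 < y \<longrightarrow> y \<le> t0 \<longrightarrow> N \<le> ?\<omega> y"
    then have "N \<le> ?\<omega> y" using that by blast
    then have "H \<le> (\<theta> - 1) * ?\<omega> y" using \<theta> by (simp add: N_def divide_le_eq mult.commute)
    then show ?thesis using that by (simp add: algebra_simps)
  qed
  \<comment> \<open>The maximum with 1 keeps the reference point \<open>l\<close> itself below
    \<open>t0\<close>, even if \<open>b < 1\<close>.\<close>
  define l where "l = t0 / max 1 b"
  have l: "0 < l" "l \<le> t0" "l * b \<le> t0"
  proof -
    have "l * b \<le> l * max 1 b" using t0 by (intro mult_left_mono) (auto simp: l_def)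
    then show "l * b \<le> t0" by (simp add: l_def)
    have "l * 1 \<le> l * max 1 b" using t0 by (intro mult_left_mono) (auto simp: l_def)
    then show "l \<le> t0" by (simp add: l_def)
  qed (use t0 in \<open>auto simp: l_def\<close>)
  show ?thesis
  proof (rule that[of l "?\<omega> l powr k / sqrt 2"])
    show "0 < ?\<omega> l powr k / sqrt 2" using \<omega>1[of l] by simp
    fix y assume y: "l * a \<le> y" "y \<le> l * b"
    define t where "t = y / l"
    have t: "a \<le> t" "t \<le> b" "y = l * t" using y l by (auto simp: t_def field_simps)
    have t_pos: "0 < t" using t ab by auto
    have ypos: "0 < y" using t l t_pos by simp
    have "\<bar>ln t\<bar> \<le> \<bar>ln a\<bar> + \<bar>ln b\<bar>"
    proof -
      have "ln a \<le> ln t" "ln t \<le> ln b" using t ab t_pos by auto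
      then show ?thesis by linarith
    qed
    then have HH: "D + E * \<bar>ln t\<bar> \<le> H" unfolding H_def using D by (intro add_left_mono mult_left_mono) auto
    have 1: "?\<omega> y \<le> \<theta> * ?\<omega> l"
      by (rule close[OF ypos order_trans[OF y(2) l(3)] l(1,2)]) (use dil[OF l(1) t_pos] HH t in simp)
    have 2: "?\<omega> l \<le> \<theta> * ?\<omega> y"
    proof (rule close)
      have "?\<omega> (y * (1 / t)) \<le> ?\<omega> y + D + E * \<bar>ln (1 / t)\<bar>" by (rule dil) (use ypos t_pos in auto)
      then show "?\<omega> l \<le> ?\<omega> y + H" using HH t t_pos by (simp add: ln_div)
    qed (use y l ypos in auto)
    have "?\<omega> y powr k \<le> \<theta> powr \<bar>k\<bar> * ?\<omega> l powr k" by (rule powr_comparable[OF \<omega>1 \<omega>1 1 2])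
    also have "\<dots> \<le> sqrt 2 * ?\<omega> l powr k" using \<theta>k by (intro mult_right_mono) auto
    also have "\<dots> = 2 * (?\<omega> l powr k / sqrt 2)"
    proof -
      have d: "2 / sqrt 2 = sqrt 2" by (rule real_div_sqrt) simp
      have "2 * (x / sqrt 2) = 2 / sqrt 2 * x" for x :: real by simp
      then show ?thesis by (simp only: d)
    qed
    finally have upper: "?\<omega> y powr k \<le> 2 * (?\<omega> l powr k / sqrt 2)" .
    have "?\<omega> l powr k \<le> \<theta> powr \<bar>k\<bar> * ?\<omega> y powr k" by (rule powr_comparable[OF \<omega>1 \<omega>1 2 1])
    also have "\<dots> \<le> sqrt 2 * ?\<omega> y powr k" using \<theta>k by (intro mult_right_mono) auto
    finally have "?\<omega> l powr k / sqrt 2 \<le> ?\<omega> y powr k" by (simp add: field_simps)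
    then show "?\<omega> l powr k / sqrt 2 \<le> ?\<omega> y powr k \<and> ?\<omega> y powr k \<le> 2 * (?\<omega> l powr k / sqrt 2)"
      using upper by simp
  qed (use l in auto)
qed

section \<open>Necessity\<close>

text \<open>If \<open>c\<close> were 0, the projection would be 0 and every element of the Bergman
  space orthogonal to itself; but \<open>(z + \<i>) powr (- (2 + \<beta>))\<close> is a nonzero
  element.\<close>

lemma bergman_constant_nonzero:
  assumes \<beta>: "-1 < \<beta>" and c: "bergman_constant \<beta> c"
  shows "c \<noteq> 0"
proof
  assume c0: "c = 0"
  define g where "g z = (z + \<i>) powr (- of_real (2 + \<beta>))" for z :: complex
  have nz: "z + \<i> \<notin> \<real>\<^sub>\<le>\<^sub>0" if "z \<in> upper_half_plane" for z
    using that by (auto simp: upper_half_plane_def complex_nonpos_Reals_iff)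
  have hol: "g holomorphic_on upper_half_plane"
    unfolding g_def by (intro holomorphic_intros) (use nz in auto)
  have cont: "continuous_on upper_half_plane g" by (rule holomorphic_on_imp_continuous_on[OF hol])
  define g' where "g' z = indicator upper_half_plane z *\<^sub>R g z" for z
  have g' [measurable]: "g' \<in> borel_measurable borel"
    unfolding g'_def using cont by (intro borel_measurable_continuous_on_indicator) auto
  have g'_eq: "g' z = g z" if "z \<in> upper_half_plane" for z using that by (simp add: g'_def)
  have g_meas: "g \<in> borel_measurable (half_plane_measure \<beta>)"
    using measurable_half_plane_measure[OF borel_measurable_lebesgue_onI[OF g'], of \<beta>]
    by (subst (asm) measurable_cong[where g = g]) (auto simp: g'_eq)
  have norm_g: "(cmod (g' (Complex u v)))\<^sup>2 = cmod (Complex u (1 + v)) powr - (4 + 2 * \<beta>)" if "0 < v" for u v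
  proof -
    have "Complex u v \<in> upper_half_plane" "Complex u v + \<i> \<noteq> 0" "Complex u v + \<i> = Complex u (1 + v)"
      using that by (auto simp: upper_half_plane_def complex_eq_iff)
    then have "cmod (g' (Complex u v)) = cmod (Complex u (1 + v)) powr - (2 + \<beta>)"
      by (simp add: g'_eq g_def powr_def del: Complex_eq_0)
    moreover have "- (4 + 2 * \<beta>) = - (2 + \<beta>) + - (2 + \<beta>)" by simp
    ultimately show ?thesis by (simp only: power2_eq_square powr_add)
  qed
  have "(\<integral>\<^sup>+z. ennreal ((cmod (g' z))\<^sup>2) \<partial>half_plane_measure \<beta>)
      = (\<integral>\<^sup>+v. (\<integral>\<^sup>+u. ennreal ((cmod (g' (Complex u v)))\<^sup>2) \<partial>lborel) * ennreal (v powr \<beta>) * indicator {0<..} v \<partial>lborel)"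
    by (rule nn_integral_half_plane) measurable
  \<comment> \<open>The exponents are arranged as in \<open>hardy_constant_finite\<close> with
    \<open>a = 2 + \<beta>\<close>, \<open>b = 2 + 2 * \<beta>\<close>, \<open>d = 0\<close>, which
    then gives finiteness.\<close>
  also have "\<dots> = (\<integral>\<^sup>+v. (\<integral>\<^sup>+s. ennreal (cmod (Complex s 1) powr - (4 + 2 * \<beta>)) \<partial>lborel)
      * (ennreal (v powr ((2 + 2 * \<beta>) - (2 + \<beta>)) * (1 + v) powr (-1 - (2 + 2 * \<beta>)) * max v (1 / v) powr 0) * indicator {0<..} v) \<partial>lborel)"
  proof (rule nn_integral_cong)
    fix v :: real
    show "(\<integral>\<^sup>+u. ennreal ((cmod (g' (Complex u v)))\<^sup>2) \<partial>lborel) * ennreal (v powr \<beta>) * indicator {0<..} v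
      = (\<integral>\<^sup>+s. ennreal (cmod (Complex s 1) powr - (4 + 2 * \<beta>)) \<partial>lborel)
      * (ennreal (v powr ((2 + 2 * \<beta>) - (2 + \<beta>)) * (1 + v) powr (-1 - (2 + 2 * \<beta>)) * max v (1 / v) powr 0) * indicator {0<..} v)"
    proof (cases "0 < v")
      case True
      then have "max v (1 / v) \<noteq> 0" by (auto simp: max_def)
      moreover have "- 1 - (2 + 2 * \<beta>) = 1 - (4 + 2 * \<beta>)" "(2 + 2 * \<beta>) - (2 + \<beta>) = \<beta>" by auto
      moreover have "0 < 1 + v" using True by simp
      ultimately show ?thesis using True nn_integral_kernel_line[of "1 + v" "4 + 2 * \<beta>"]
        by (simp only: norm_g) (simp add: ennreal_mult mult_ac)
    qed simp
  qed
  also have "\<dots> = (\<integral>\<^sup>+s. ennreal (cmod (Complex s 1) powr - (4 + 2 * \<beta>)) \<partial>lborel)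
      * (\<integral>\<^sup>+v. (ennreal (v powr ((2 + 2 * \<beta>) - (2 + \<beta>)) * (1 + v) powr (-1 - (2 + 2 * \<beta>)) * max v (1 / v) powr 0) * indicator {0<..} v) \<partial>lborel)"
    by (rule nn_integral_cmult) measurable
  also have "\<dots> < top"
    using nn_integral_kernel_line_finite[of "4 + 2 * \<beta>"] hardy_constant_finite[of 0 "2 + \<beta>" "2 + 2 * \<beta>"] \<beta>
    by (simp add: ennreal_mult_less_top)
  finally have fin: "(\<integral>\<^sup>+z. ennreal ((cmod (g' z))\<^sup>2) \<partial>half_plane_measure \<beta>) < top" .
  have "(\<integral>\<^sup>+z. ennreal ((cmod (g z))\<^sup>2) \<partial>half_plane_measure \<beta>) = (\<integral>\<^sup>+z. ennreal ((cmod (g' z))\<^sup>2) \<partial>half_plane_measure \<beta>)"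
    by (rule nn_integral_cong) (auto simp: g'_eq)
  then have int: "integrable (half_plane_measure \<beta>) (\<lambda>z. (cmod (g z))\<^sup>2)"
    using g_meas fin by (intro integrableI_bounded) auto
  have gL2: "g \<in> half_plane_L2 \<beta>" using g_meas int by (simp add: half_plane_L2_def)
  then have "g \<in> bergman_L2 \<beta>" using hol by (simp add: bergman_L2_def)
  then have "(LINT z|half_plane_measure \<beta>. (g z - integral_op \<beta> (bergman_kernel c \<beta>) g z) * cnj (g z)) = 0"
    using c gL2 unfolding bergman_constant_def by blast
  then have "(LINT z|half_plane_measure \<beta>. complex_of_real ((cmod (g z))\<^sup>2)) = 0"
    by (simp add: c0 integral_op_def bergman_kernel_def complex_norm_square del: of_real_power)
  then have "(LINT z|half_plane_measure \<beta>. (cmod (g z))\<^sup>2) = 0"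
    by (simp only: integral_complex_of_real of_real_eq_0_iff)
  then have "AE z in half_plane_measure \<beta>. (cmod (g z))\<^sup>2 = 0"
    using integral_nonneg_eq_0_iff_AE[OF int] by simp
  then have "AE z in half_plane_measure \<beta>. False"
    using AE_space
  proof eventually_elim
    case (elim z)
    then show ?case using nz[of z] by (auto simp: g_def)
  qed
  \<comment> \<open>The half-plane is not a null set: the integral of \<open>top\<close> over it is
    a mixed norm of the constant \<open>top\<close>, already known to be infinite.\<close>
  then have "(\<integral>\<^sup>+z. top \<partial>half_plane_measure \<beta>) = (\<integral>\<^sup>+z. 0 \<partial>half_plane_measure \<beta>)"
    by (intro nn_integral_cong_AE) auto
  moreover have "(\<integral>\<^sup>+z. top \<partial>half_plane_measure \<beta>) = mixed_nn_norm 1 1 (\<lambda>_. 1) \<beta> (\<lambda>_. top)"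
    unfolding mixed_nn_norm_def by (subst nn_integral_half_plane) auto
  ultimately show False
    using mixed_nn_norm_top[of 1 1 "\<lambda>_. 1" \<beta>] by simp
qed

section \<open>Lower bounds from test functions\<close>

lemma nn_integral_inverse_Icc:
  fixes a b :: real
  assumes "0 < a" "a \<le> b"
  shows "(\<integral>\<^sup>+x. ennreal (1 / x) * indicator {a..b} x \<partial>lborel) = ennreal (ln (b / a))"
proof -
  have "(\<integral>\<^sup>+x. ennreal (1 / x) * indicator {a..b} x \<partial>lborel) = ennreal (ln b - ln a)"
    by (rule nn_integral_FTC_Icc) (use assms in \<open>auto intro!: derivative_eq_intros\<close>)
  then show ?thesis using assms by (simp add: ln_div)
qed

text \<open>The real part is \<open>cmod \<zeta> powr -s\<close> times the cosine of
  \<open>s\<close> times the argument of \<open>\<zeta>\<close>, and the cosine exceeds 1/2 in a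
  sector narrow enough for \<open>s\<close>.\<close>

lemma Re_inverse_powr_sector:
  fixes s :: real
  obtains A where "1 \<le> A" "\<And>\<zeta>. 0 < Im \<zeta> \<Longrightarrow> A * Im \<zeta> \<le> Re \<zeta> \<Longrightarrow> cmod \<zeta> powr -s / 2 \<le> Re (1 / \<zeta> powr of_real s)"
proof -
  have "isCont (\<lambda>t. cos (s * arctan t)) 0" by (intro continuous_intros)
  then have "((\<lambda>t. cos (s * arctan t)) \<longlongrightarrow> 1) (at 0)" by (simp add: isCont_def)
  then have "eventually (\<lambda>t. 1 / 2 < cos (s * arctan t)) (at 0)"
    by (rule order_tendstoD) simp
  then obtain d where d: "0 < d" "\<And>t. t \<noteq> 0 \<Longrightarrow> dist t 0 < d \<Longrightarrow> 1 / 2 < cos (s * arctan t)"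
    unfolding eventually_at by auto
  show ?thesis
  proof (rule that[of "max 1 (2 / d)"])
    fix \<zeta> :: complex assume \<zeta>: "0 < Im \<zeta>" "max 1 (2 / d) * Im \<zeta> \<le> Re \<zeta>"
    have "1 * Im \<zeta> \<le> max 1 (2 / d) * Im \<zeta>" "2 / d * Im \<zeta> \<le> max 1 (2 / d) * Im \<zeta>"
      by (rule mult_right_mono; use \<zeta>(1) in simp)+
    then have Re: "0 < Re \<zeta>" "2 / d * Im \<zeta> \<le> Re \<zeta>" using \<zeta> by linarith+
    have nz: "\<zeta> \<noteq> 0" using \<zeta> by auto
    have tle: "Im \<zeta> / Re \<zeta> \<le> d / 2" using Re d(1) by (simp add: field_simps)
    have "1 / 2 < cos (s * arctan (Im \<zeta> / Re \<zeta>))"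
    proof (rule d(2))
      have "0 \<le> Im \<zeta> / Re \<zeta>" using \<zeta> Re by simp
      then show "dist (Im \<zeta> / Re \<zeta>) 0 < d" using tle d(1) by (simp only: dist_real_def)
      show "Im \<zeta> / Re \<zeta> \<noteq> 0" using \<zeta> Re by simp
    qed
    also have "arctan (Im \<zeta> / Re \<zeta>) = Im (Ln \<zeta>)" using Re by (simp add: Im_Ln_eq[OF nz])
    finally have "1 / 2 < cos (s * Im (Ln \<zeta>))" .
    moreover have "1 / \<zeta> powr of_real s = exp (- (of_real s * Ln \<zeta>))"
      using nz by (simp add: powr_def exp_minus field_simps)
    then have "Re (1 / \<zeta> powr of_real s) = cmod \<zeta> powr -s * cos (s * Im (Ln \<zeta>))"
      using nz by (simp add: Re_exp powr_def)
    ultimately show "cmod \<zeta> powr -s / 2 \<le> Re (1 / \<zeta> powr of_real s)"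
      using mult_left_mono[of "1 / 2" "cos (s * Im (Ln \<zeta>))" "cmod \<zeta> powr -s"] by simp
  qed simp
qed

text \<open>The hypothesis on \<open>e\<close> says that \<open>e K(z, u)\<close> has no cancellation as long as \<open>z - cnj u\<close> stays in
  a narrow sector around the positive real axis; this holds when \<open>u\<close> lies over the negative axis and
  \<open>z\<close> far to the right of its height.\<close>

lemma integral_op_lower_bound:
  fixes K :: "complex \<Rightarrow> complex \<Rightarrow> complex" and \<phi> g :: "real \<Rightarrow> real"
  assumes K: "\<And>z u. z \<in> upper_half_plane \<Longrightarrow> u \<in> upper_half_plane \<Longrightarrow> A * Im (z - cnj u) \<le> Re (z - cnj u)
      \<Longrightarrow> b * cmod (z - cnj u) powr (-2 - \<beta>) \<le> Re (e * K z u)"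
    and e: "cmod e = 1" and b: "0 \<le> b" and A: "1 \<le> A" and \<beta>: "-1 < \<beta>"
    and [measurable]: "\<phi> \<in> borel_measurable borel" "g \<in> borel_measurable borel"
    and nonneg: "\<And>u. 0 \<le> \<phi> u" "\<And>v. 0 \<le> g v"
    and supp: "\<And>u. 0 \<le> u \<Longrightarrow> \<phi> u = 0" "\<And>v. l < v \<Longrightarrow> g v = 0"
    and y: "0 < y" "l \<le> y" and x: "2 * A * y \<le> x" "x \<le> 4 * A * y"
    and int: "integrable (half_plane_measure \<beta>) (\<lambda>u. K (Complex x y) u * of_real (\<phi> (Re u) * g (Im u)))"
  shows "ennreal (b * ((4 * A + 3) * y) powr (-2 - \<beta>))
      * ((\<integral>\<^sup>+u. ennreal (\<phi> u) * indicator {-y<..} u \<partial>lborel) * (\<integral>\<^sup>+v. ennreal (g v * v powr \<beta>) * indicator {0<..} v \<partial>lborel))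
    \<le> ennreal (cmod (integral_op \<beta> K (\<lambda>u. of_real (\<phi> (Re u) * g (Im u))) (Complex x y)))"
proof -
  let ?z = "Complex x y"
  let ?f = "\<lambda>u. \<phi> (Re u) * g (Im u)"
  let ?F = "\<lambda>u. e * (K ?z u * of_real (?f u))"
  have z: "?z \<in> upper_half_plane" using y by (simp add: upper_half_plane_def)
  have lower: "b * cmod (?z - cnj u) powr (-2 - \<beta>) * ?f u \<le> Re (?F u)" if u: "u \<in> upper_half_plane" for u
  proof (cases "?f u = 0")
    case True
    then show ?thesis by (metis mult_zero_right of_real_0 order_refl zero_complex.sel(1))
  next
    case False
    then have uv: "Re u < 0" "Im u \<le> l" using supp by (auto simp: not_le[symmetric])
    \<comment> \<open>Here \<open>Im (z - cnj u) \<le> 2 * y\<close> because \<open>u\<close> is no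
      higher than \<open>y\<close>, and \<open>Re (z - cnj u) \<ge> x\<close> because
      \<open>u\<close> lies over the negative axis; hence the requirement
      \<open>2 * A * y \<le> x\<close>.\<close>
    have "A * Im (?z - cnj u) \<le> A * (2 * y)" using uv y A by (intro mult_left_mono) auto
    also have "\<dots> \<le> Re (?z - cnj u)" using x uv by simp
    finally have "b * cmod (?z - cnj u) powr (-2 - \<beta>) * ?f u \<le> Re (e * K ?z u) * ?f u"
      using nonneg by (intro mult_right_mono K z u) auto
    also have "\<dots> = Re (?F u)"
    proof -
      have "Re (a * complex_of_real r) = Re a * r" for a r by simp
      then show ?thesis by (simp only: mult.assoc[symmetric])
    qed
    finally show ?thesis .
  qed
  have intF: "integrable (half_plane_measure \<beta>) ?F" using int by simp
  have nn: "0 \<le> Re (?F u)" if "u \<in> upper_half_plane" for u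
    by (rule order_trans[OF _ lower[OF that]]) (use b nonneg in auto)
  \<comment> \<open>For \<open>- y < Re u\<close> on the support, the real part of
    \<open>z - cnj u\<close> is at most \<open>x + y\<close> and the imaginary part at most
    \<open>2 * y\<close>, together \<open>(4 * A + 3) * y\<close>. The remaining \<open>u\<close>
    may be dropped because the integrand is nonnegative.\<close>
  have kernel: "b * ((4 * A + 3) * y) powr (-2 - \<beta>) * (\<phi> (Re u) * indicator {-y<..} (Re u) * g (Im u)) \<le> Re (?F u)"
    if u: "u \<in> upper_half_plane" for u
  proof (cases "?f u = 0 \<or> Re u \<le> - y")
    case True
    then show ?thesis using nn[OF u] by auto
  next
    case False
    then have uv: "Re u < 0" "Im u \<le> l" "- y < Re u" using supp by (auto simp: not_le[symmetric])
    have pos: "0 < Im u" using u by (simp add: upper_half_plane_def)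
    have "cmod (?z - cnj u) \<le> \<bar>Re (?z - cnj u)\<bar> + \<bar>Im (?z - cnj u)\<bar>" by (rule cmod_le)
    also have "\<dots> \<le> (4 * A + 3) * y"
    proof -
      have "0 \<le> x" using x(1) A y by (smt (verit) mult_nonneg_nonneg)
      then show ?thesis using uv y x pos by (simp add: algebra_simps)
    qed
    finally have le: "cmod (?z - cnj u) \<le> (4 * A + 3) * y" .
    have "0 < cmod (?z - cnj u)" using y pos by (auto simp: complex_eq_iff)
    then have "((4 * A + 3) * y) powr (-2 - \<beta>) \<le> cmod (?z - cnj u) powr (-2 - \<beta>)"
      using le \<beta> by (intro powr_mono2') auto
    then have "b * ((4 * A + 3) * y) powr (-2 - \<beta>) * ?f u \<le> b * cmod (?z - cnj u) powr (-2 - \<beta>) * ?f u"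
      using b nonneg by (intro mult_right_mono mult_left_mono) auto
    also have "\<dots> \<le> Re (?F u)" by (rule lower[OF u])
    finally show ?thesis using uv by simp
  qed
  define c0 where "c0 = b * ((4 * A + 3) * y) powr (-2 - \<beta>)"
  have c0: "0 \<le> c0" using b by (simp add: c0_def)
  have "(\<integral>\<^sup>+u. ennreal (c0 * (\<phi> (Re u) * indicator {-y<..} (Re u) * g (Im u))) \<partial>half_plane_measure \<beta>)
    = (\<integral>\<^sup>+v. (\<integral>\<^sup>+u. ennreal (c0 * (\<phi> u * indicator {-y<..} u * g v)) \<partial>lborel) * ennreal (v powr \<beta>) * indicator {0<..} v \<partial>lborel)"
  proof (subst nn_integral_half_plane)
    have [measurable]: "Re \<in> borel_measurable borel" "Im \<in> borel_measurable borel"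
      by (intro borel_measurable_continuous_onI continuous_intros)+
    have [measurable]: "(indicator {-y<..} :: real \<Rightarrow> real) \<in> borel_measurable borel" by simp
    have "(\<lambda>u. \<phi> (Re u)) \<in> borel_measurable borel" "(\<lambda>u. g (Im u)) \<in> borel_measurable borel"
      "(\<lambda>u. indicator {-y<..} (Re u) :: real) \<in> borel_measurable borel"
      by (rule measurable_compose[where N = borel]; measurable)+
    then show "(\<lambda>u. ennreal (c0 * (\<phi> (Re u) * indicator {-y<..} (Re u) * g (Im u)))) \<in> borel_measurable borel"
      by (intro measurable_compose[OF _ measurable_ennreal] borel_measurable_times borel_measurable_const)
  qed simp
  also have "\<dots> = (\<integral>\<^sup>+v. (ennreal c0 * (\<integral>\<^sup>+u. ennreal (\<phi> u) * indicator {-y<..} u \<partial>lborel)) * (ennreal (g v * v powr \<beta>) * indicator {0<..} v) \<partial>lborel)"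
  proof (rule nn_integral_cong)
    fix v :: real
    have "(\<integral>\<^sup>+u. ennreal (c0 * (\<phi> u * indicator {-y<..} u * g v)) \<partial>lborel)
      = (\<integral>\<^sup>+u. ennreal c0 * (ennreal (\<phi> u) * indicator {-y<..} u) * ennreal (g v) \<partial>lborel)"
      using c0 nonneg by (intro nn_integral_cong) (auto simp: indicator_def ennreal_mult mult.assoc)
    also have "\<dots> = ennreal c0 * (\<integral>\<^sup>+u. ennreal (\<phi> u) * indicator {-y<..} u \<partial>lborel) * ennreal (g v)"
      by (simp add: nn_integral_multc nn_integral_cmult)
    finally show "(\<integral>\<^sup>+u. ennreal (c0 * (\<phi> u * indicator {-y<..} u * g v)) \<partial>lborel) * ennreal (v powr \<beta>) * indicator {0<..} v
      = (ennreal c0 * (\<integral>\<^sup>+u. ennreal (\<phi> u) * indicator {-y<..} u \<partial>lborel)) * (ennreal (g v * v powr \<beta>) * indicator {0<..} v)"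
      using nonneg by (simp add: ennreal_mult mult.assoc)
  qed
  also have "\<dots> = ennreal c0 * ((\<integral>\<^sup>+u. ennreal (\<phi> u) * indicator {-y<..} u \<partial>lborel) * (\<integral>\<^sup>+v. ennreal (g v * v powr \<beta>) * indicator {0<..} v \<partial>lborel))"
    by (subst nn_integral_cmult) (auto simp: mult.assoc)
  finally have "ennreal c0 * ((\<integral>\<^sup>+u. ennreal (\<phi> u) * indicator {-y<..} u \<partial>lborel) * (\<integral>\<^sup>+v. ennreal (g v * v powr \<beta>) * indicator {0<..} v \<partial>lborel))
    = (\<integral>\<^sup>+u. ennreal (c0 * (\<phi> (Re u) * indicator {-y<..} (Re u) * g (Im u))) \<partial>half_plane_measure \<beta>)" by (rule sym)
  also have "\<dots> \<le> (\<integral>\<^sup>+u. ennreal (Re (?F u)) \<partial>half_plane_measure \<beta>)"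
    unfolding c0_def by (intro nn_integral_mono ennreal_leI kernel) simp
  also have "\<dots> = ennreal (LINT u|half_plane_measure \<beta>. Re (?F u))"
    by (rule nn_integral_eq_integral) (use intF nn in \<open>auto simp del: times_complex.sel\<close>)
  also have "(LINT u|half_plane_measure \<beta>. Re (?F u)) = Re (LINT u|half_plane_measure \<beta>. ?F u)"
    using intF by (rule integral_Re)
  also have "(LINT u|half_plane_measure \<beta>. ?F u) = e * integral_op \<beta> K (\<lambda>u. of_real (?f u)) ?z"
    unfolding integral_op_def by simp
  also have "ennreal (Re (e * integral_op \<beta> K (\<lambda>u. of_real (?f u)) ?z)) \<le> ennreal (cmod (integral_op \<beta> K (\<lambda>u. of_real (?f u)) ?z))"
    using complex_Re_le_cmod[of "e * integral_op \<beta> K (\<lambda>u. of_real (?f u)) ?z"] e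
    by (intro ennreal_leI) (simp add: norm_mult del: times_complex.sel)
  finally show ?thesis unfolding c0_def .
qed

text \<open>The inequality obtained by testing boundedness on \<open>\<psi>(u / l) v powr (-1 - \<beta>)\<close> for
  \<open>l a \<le> v \<le> l\<close>, where \<open>l\<close> is so small that the weight is almost constant on all heights involved.
  The scale \<open>l\<close> cancels.\<close>

lemma boundedness_test:
  fixes K :: "complex \<Rightarrow> complex \<Rightarrow> complex" and w :: "real \<Rightarrow> real" and p q \<alpha> \<beta> A b :: real
  assumes K: "\<And>z u. z \<in> upper_half_plane \<Longrightarrow> u \<in> upper_half_plane \<Longrightarrow> A * Im (z - cnj u) \<le> Re (z - cnj u)
      \<Longrightarrow> b * cmod (z - cnj u) powr (-2 - \<beta>) \<le> Re (e * K z u)"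
    and e: "cmod e = 1" and b: "0 < b" and A: "1 \<le> A" and \<beta>: "-1 < \<beta>" and p: "1 \<le> p" and q: "1 \<le> q"
    and bounded: "integral_op_bounded \<beta> K p q w \<alpha>"
    and window: "\<And>a b. 0 < a \<Longrightarrow> a \<le> b \<Longrightarrow> \<exists>l m. 0 < l \<and> 0 < m \<and> (\<forall>y. l * a \<le> y \<longrightarrow> y \<le> l * b \<longrightarrow> m \<le> w y \<and> w y \<le> 2 * m)"
    and \<kappa>: "q * (\<beta> + 1) \<le> \<alpha> + 1"
  obtains M where "0 \<le> M" "\<And>a \<psi> \<tau> S y0 y1. \<lbrakk>0 < a; a < 1; 1 \<le> y0; y0 \<le> y1; 0 \<le> \<tau>; 0 \<le> S;
      \<psi> \<in> borel_measurable borel; \<And>u. 0 \<le> \<psi> u; \<And>u. 0 \<le> u \<Longrightarrow> \<psi> u = 0;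
      (\<integral>\<^sup>+u. ennreal (\<psi> u powr p) \<partial>lborel) \<le> ennreal S;
      \<And>\<eta>. y0 \<le> \<eta> \<Longrightarrow> \<eta> \<le> y1 \<Longrightarrow> ennreal (\<tau> * \<eta> powr (1 - 1 / p)) \<le> (\<integral>\<^sup>+u. ennreal (\<psi> u) * indicator {-\<eta><..} u \<partial>lborel)\<rbrakk>
      \<Longrightarrow> (\<tau> * ln (1 / a)) powr q * ln (y1 / y0) \<le> M * S powr (q / p) * ln (1 / a)"
proof -
  obtain C0 where C0: "\<And>f. f \<in> mixed_space p q w \<alpha> \<Longrightarrow>
      (\<forall>z\<in>upper_half_plane. integrable (half_plane_measure \<beta>) (\<lambda>u. K z u * f u)) \<and>
        integral_op \<beta> K f \<in> mixed_space p q w \<alpha> \<and>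
        mixed_norm p q w \<alpha> (integral_op \<beta> K f) \<le> ennreal C0 * mixed_norm p q w \<alpha> f"
    using bounded unfolding integral_op_bounded_def by blast
  define C where "C = max C0 0"
  have C: "0 \<le> C" "ennreal C0 = ennreal C" by (auto simp: C_def max_def ennreal_neg)
  \<comment> \<open>The kernel bound at height \<open>y\<close> times the \<open>p\<close>-th root
    of the length \<open>2 * A * y\<close> of the interval of admissible \<open>x\<close>, with the
    powers of \<open>y\<close> left out.\<close>
  define c1 where "c1 = b * (4 * A + 3) powr (-2 - \<beta>) * (2 * A) powr (1 / p)"
  have c1: "0 < c1" using b A by (simp add: c1_def)
  \<comment> \<open>The excess over the critical exponent. As \<open>k \<ge> 0\<close>,
    \<open>y powr k\<close> is at most \<open>l powr k\<close> at the heights of the test function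
    and at least \<open>l powr k\<close> at those of the image, so \<open>l powr k\<close> can
    replace it on both sides.\<close>
  define k where "k = \<alpha> + 1 - q * (\<beta> + 1)"
  have k: "0 \<le> k" using \<kappa> by (simp add: k_def)
  have powr_q: "(y powr (-1 - \<beta>)) powr q * y powr \<alpha> = y powr k * (1 / y)" if "0 < y" for y :: real
  proof -
    have "(y powr (-1 - \<beta>)) powr q * y powr \<alpha> = y powr ((-1 - \<beta>) * q + \<alpha>)"
      by (simp add: powr_powr powr_add)
    also have "(-1 - \<beta>) * q + \<alpha> = k - 1" by (simp add: k_def algebra_simps)
    finally show ?thesis using that by (simp add: powr_diff)
  qed
  show ?thesis
  proof (rule that[of "2 * C powr q / c1 powr q"])
    show "0 \<le> 2 * C powr q / c1 powr q" by simp
    fix a \<tau> S y0 y1 :: real and \<psi> :: "real \<Rightarrow> real"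
    assume a: "0 < a" "a < 1" and y01: "1 \<le> y0" "y0 \<le> y1" and \<tau>: "0 \<le> \<tau>" and S: "0 \<le> S"
      and [measurable]: "\<psi> \<in> borel_measurable borel" and \<psi>: "\<And>u. 0 \<le> \<psi> u" "\<And>u. 0 \<le> u \<Longrightarrow> \<psi> u = 0"
      and \<psi>p: "(\<integral>\<^sup>+u. ennreal (\<psi> u powr p) \<partial>lborel) \<le> ennreal S"
      and J: "\<And>\<eta>. y0 \<le> \<eta> \<Longrightarrow> \<eta> \<le> y1 \<Longrightarrow> ennreal (\<tau> * \<eta> powr (1 - 1 / p)) \<le> (\<integral>\<^sup>+u. ennreal (\<psi> u) * indicator {-\<eta><..} u \<partial>lborel)"
    \<comment> \<open>One window covers the heights \<open>l * a\<close> to \<open>l\<close> of the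
      test function and \<open>l * y0\<close> to \<open>l * y1\<close> of the image.\<close>
    obtain l m where l: "0 < l" and m: "0 < m" and lm: "\<And>y. l * a \<le> y \<Longrightarrow> y \<le> l * y1 \<Longrightarrow> m \<le> w y \<and> w y \<le> 2 * m"
      using window[of a y1] a y01 by auto
    define L where "L = ln (1 / a)"
    have L: "0 < L" using a by (simp add: L_def)
    define \<phi> where "\<phi> u = \<psi> (u / l)" for u
    \<comment> \<open>On its support \<open>g v * v powr \<beta> = 1 / v\<close>, with integral
      \<open>L\<close>, and \<open>g v powr q * v powr \<alpha> = v powr k / v\<close>.\<close>
    define g where "g v = v powr (-1 - \<beta>) * indicator {l * a..l} v" for v :: real
    have [measurable]: "\<phi> \<in> borel_measurable borel" "g \<in> borel_measurable borel"
      unfolding \<phi>_def g_def by measurable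
    have \<phi>: "0 \<le> \<phi> u" "0 \<le> u \<Longrightarrow> \<phi> u = 0" for u using \<psi> l by (auto simp: \<phi>_def)
    have g: "0 \<le> g v" "l < v \<Longrightarrow> g v = 0" for v by (auto simp: g_def)
    define f where "f u = complex_of_real (\<phi> (Re u) * g (Im u))" for u
    have f_borel: "f \<in> borel_measurable borel"
    proof -
      have [measurable]: "Re \<in> borel_measurable borel" "Im \<in> borel_measurable borel"
        by (intro borel_measurable_continuous_onI continuous_intros)+
      have "(\<lambda>u. \<phi> (Re u)) \<in> borel_measurable borel" "(\<lambda>u. g (Im u)) \<in> borel_measurable borel"
        by (rule measurable_compose[where N = borel]; measurable)+
      then have "(\<lambda>u. \<phi> (Re u) * g (Im u)) \<in> borel_measurable borel"
        by (rule borel_measurable_times)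
      then show ?thesis unfolding f_def by measurable
    qed
    define W where "W y = ennreal (w y * y powr \<alpha>) * indicator {0<..} y" for y
    have W0: "W y = 0" if "y \<le> 0" for y using that by (simp add: W_def)
    have \<phi>p: "(\<integral>\<^sup>+x. ennreal (\<phi> x powr p) \<partial>lborel) \<le> ennreal (l * S)"
    proof -
      have "(\<integral>\<^sup>+x. ennreal (\<phi> x powr p) \<partial>lborel) = ennreal l * (\<integral>\<^sup>+x. ennreal (\<psi> x powr p) \<partial>lborel)"
        using l by (subst nn_integral_real_affine[where c = l and t = 0]) (auto simp: \<phi>_def)
      also have "\<dots> \<le> ennreal l * ennreal S" by (intro mult_left_mono \<psi>p) simp
      finally show ?thesis using l S by (simp add: ennreal_mult)
    qed
    have row_f: "row_norm p (\<lambda>u. ennreal (cmod (f u))) v \<le> ennreal ((l * S) powr (1 / p) * g v)" for v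
    proof -
      have "(\<integral>\<^sup>+x. ennreal_powr (ennreal (cmod (f (Complex x v)))) p \<partial>lborel)
          = (\<integral>\<^sup>+x. ennreal (\<phi> x powr p) * ennreal (g v powr p) \<partial>lborel)"
        using \<phi> g by (intro nn_integral_cong)
          (simp add: f_def ennreal_powr_ennreal norm_mult ennreal_powr_mult ennreal_mult)
      also have "\<dots> = (\<integral>\<^sup>+x. ennreal (\<phi> x powr p) \<partial>lborel) * ennreal (g v powr p)"
        by (rule nn_integral_multc) measurable
      also have "\<dots> \<le> ennreal (l * S) * ennreal (g v powr p)" by (intro mult_right_mono \<phi>p) simp
      also have "\<dots> = ennreal (l * S * g v powr p)" using l S by (simp add: ennreal_mult)
      finally have "row_norm p (\<lambda>u. ennreal (cmod (f u))) v \<le> ennreal_powr (ennreal (l * S * g v powr p)) (1 / p)"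
        unfolding row_norm_def by (rule ennreal_powr_mono[rotated]) (use p in simp)
      also have "\<dots> = ennreal ((l * S) powr (1 / p) * g v)"
        using l S p g by (simp add: ennreal_powr_ennreal powr_mult powr_powr)
      finally show ?thesis .
    qed
    define R where "R = (\<integral>\<^sup>+y. ennreal_powr (row_norm p (\<lambda>u. ennreal (cmod (f u))) y) q * W y \<partial>lborel)"
    have R: "R \<le> ennreal ((l * S) powr (q / p) * (2 * m * l powr k) * L)"
    proof -
      have "R \<le> (\<integral>\<^sup>+y. ennreal ((l * S) powr (q / p) * (2 * m * l powr k)) * (ennreal (1 / y) * indicator {l * a..l} y) \<partial>lborel)"
        unfolding R_def
      proof (rule nn_integral_mono)
        fix y :: real
        show "ennreal_powr (row_norm p (\<lambda>u. ennreal (cmod (f u))) y) q * W y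
          \<le> ennreal ((l * S) powr (q / p) * (2 * m * l powr k)) * (ennreal (1 / y) * indicator {l * a..l} y)"
        proof (cases "y \<in> {l * a..l}")
          case True
          have ypos: "0 < y" using True l a by (auto intro: less_le_trans[of 0 "l * a"])
          have "l * 1 \<le> l * y1" using l y01 by (intro mult_left_mono) auto
          then have wy: "m \<le> w y" "w y \<le> 2 * m" using lm[of y] True by auto
          have "ennreal_powr (row_norm p (\<lambda>u. ennreal (cmod (f u))) y) q * W y
            \<le> ennreal_powr (ennreal ((l * S) powr (1 / p) * g y)) q * ennreal (2 * m * y powr \<alpha>)"
            using row_f[of y] q wy ypos
            by (intro mult_mono ennreal_powr_mono) (auto simp: W_def intro!: ennreal_leI mult_right_mono)
          also have "\<dots> = ennreal ((l * S) powr (q / p) * (2 * m) * ((y powr (-1 - \<beta>)) powr q * y powr \<alpha>))"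
            using True l S m
            by (simp add: g_def ennreal_powr_ennreal powr_mult powr_powr ennreal_mult[symmetric] mult_ac)
          also have "\<dots> \<le> ennreal ((l * S) powr (q / p) * (2 * m) * (l powr k * (1 / y)))"
            unfolding powr_q[OF ypos] using True ypos k m
            by (intro ennreal_leI mult_left_mono mult_right_mono powr_mono2) auto
          also have "\<dots> = ennreal ((l * S) powr (q / p) * (2 * m * l powr k)) * (ennreal (1 / y) * indicator {l * a..l} y)"
            using True m ypos by (simp add: ennreal_mult[symmetric] mult_ac)
          finally show ?thesis .
        next
          case False
          then have "row_norm p (\<lambda>u. ennreal (cmod (f u))) y = 0"
            using row_f[of y] by (simp add: g_def)
          then show ?thesis by simp
        qed
      qed
      also have "\<dots> = ennreal ((l * S) powr (q / p) * (2 * m * l powr k)) * ennreal (ln (l / (l * a)))"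
        by (subst nn_integral_cmult, measurable, subst nn_integral_inverse_Icc) (use l a in auto)
      also have "ln (l / (l * a)) = L" using l by (simp add: L_def)
      finally show ?thesis using L m by (simp add: ennreal_mult)
    qed
    have norm_f: "mixed_norm p q w \<alpha> f = ennreal_powr R (1 / q)"
      unfolding mixed_norm_eq R_def W_def by (rule mixed_nn_norm_eq_row_norm) (use p in simp)
    have f_space: "f \<in> mixed_space p q w \<alpha>"
      unfolding mixed_space_def using borel_measurable_lebesgue_onI[OF f_borel] le_less_trans[OF R]
      by (simp add: norm_f)
    define Pf where "Pf = integral_op \<beta> K f"
    define Q where "Q = (\<integral>\<^sup>+y. ennreal_powr (row_norm p (\<lambda>u. ennreal (cmod (Pf u))) y) q * W y \<partial>lborel)"
    have QR: "Q \<le> ennreal (C powr q) * R"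
    proof -
      have "ennreal_powr Q (1 / q) = mixed_norm p q w \<alpha> Pf"
        unfolding mixed_norm_eq Q_def W_def by (rule mixed_nn_norm_eq_row_norm[symmetric]) (use p in simp)
      also have "\<dots> \<le> ennreal C * ennreal_powr R (1 / q)"
        using C0[OF f_space] unfolding Pf_def norm_f C(2) by blast
      finally have "ennreal_powr (ennreal_powr Q (1 / q)) q \<le> ennreal_powr (ennreal C * ennreal_powr R (1 / q)) q"
        by (rule ennreal_powr_mono[rotated]) (use q in simp)
      then show ?thesis using q C by (simp add: ennreal_powr_mult ennreal_powr_ennreal)
    qed
    have B: "(\<integral>\<^sup>+v. ennreal (g v * v powr \<beta>) * indicator {0<..} v \<partial>lborel) = ennreal L"
    proof -
      have "(\<integral>\<^sup>+v. ennreal (g v * v powr \<beta>) * indicator {0<..} v \<partial>lborel) = (\<integral>\<^sup>+v. ennreal (1 / v) * indicator {l * a..l} v \<partial>lborel)"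
      proof (rule nn_integral_cong)
        fix v :: real
        show "ennreal (g v * v powr \<beta>) * indicator {0<..} v = ennreal (1 / v) * indicator {l * a..l} v"
        proof (cases "v \<in> {l * a..l}")
          case True
          have vpos: "0 < v" using True l a by (auto intro: less_le_trans[of 0 "l * a"])
          have "v powr (-1 - \<beta>) * v powr \<beta> = 1 / v" using vpos by (simp add: powr_add[symmetric] powr_minus_divide)
          then show ?thesis using True vpos by (simp add: g_def)
        qed (auto simp: g_def)
      qed
      also have "\<dots> = ennreal (ln (l / (l * a)))" by (rule nn_integral_inverse_Icc) (use l a in auto)
      also have "ln (l / (l * a)) = L" using l by (simp add: L_def)
      finally show ?thesis .
    qed
    have J': "ennreal (\<tau> * l powr (1 / p) * y powr (1 - 1 / p)) \<le> (\<integral>\<^sup>+u. ennreal (\<phi> u) * indicator {-y<..} u \<partial>lborel)"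
      if y: "l * y0 \<le> y" "y \<le> l * y1" for y
    proof -
      have ypos: "0 < y" using y(1) l y01 by (auto intro: less_le_trans[of 0 "l * y0"])
      have yl: "y0 \<le> y / l" "y / l \<le> y1" using y l by (auto simp: field_simps)
      have "y powr (1 - 1 / p) = l powr (1 - 1 / p) * (y / l) powr (1 - 1 / p)"
        using l ypos by (simp add: powr_divide)
      moreover have "l powr (1 / p) * l powr (1 - 1 / p) = l" using l by (simp add: powr_add[symmetric])
      ultimately have "\<tau> * l powr (1 / p) * y powr (1 - 1 / p) = l * (\<tau> * (y / l) powr (1 - 1 / p))"
        by simp
      then have "ennreal (\<tau> * l powr (1 / p) * y powr (1 - 1 / p)) = ennreal l * ennreal (\<tau> * (y / l) powr (1 - 1 / p))"
        using l \<tau> by (simp only: ennreal_mult[symmetric] less_imp_le mult_nonneg_nonneg powr_ge_zero)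
      also have "\<dots> \<le> ennreal l * (\<integral>\<^sup>+u. ennreal (\<psi> u) * indicator {-(y / l)<..} u \<partial>lborel)"
        by (intro mult_left_mono J yl) simp
      also have "(\<integral>\<^sup>+u. ennreal (\<psi> u) * indicator {-(y / l)<..} u \<partial>lborel) = (\<integral>\<^sup>+u. ennreal (\<phi> (l * u)) * indicator {-y<..} (l * u) \<partial>lborel)"
        using l by (intro nn_integral_cong) (auto simp: \<phi>_def indicator_def field_simps)
      also have "ennreal l * \<dots> = (\<integral>\<^sup>+u. ennreal (\<phi> u) * indicator {-y<..} u \<partial>lborel)"
        using l nn_integral_real_affine[of "\<lambda>u. ennreal (\<phi> u) * indicator {-y<..} u" l 0] by simp
      finally show ?thesis .
    qed
    have row_Pf: "ennreal (c1 * \<tau> * L * l powr (1 / p) * y powr (-1 - \<beta>)) \<le> row_norm p (\<lambda>u. ennreal (cmod (Pf u))) y"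
      if y: "l * y0 \<le> y" "y \<le> l * y1" for y
    proof -
      have "l * 1 \<le> l * y0" using l y01 by (intro mult_left_mono) auto
      then have yl: "l \<le> y" "0 < y" using y l by linarith+
      define N where "N = b * ((4 * A + 3) * y) powr (-2 - \<beta>) * (\<tau> * l powr (1 / p) * y powr (1 - 1 / p) * L)"
      have N: "0 \<le> N" using b \<tau> L by (simp add: N_def)
      have ptw: "ennreal (N powr p) * indicator {2 * A * y..4 * A * y} x \<le> ennreal_powr (ennreal (cmod (Pf (Complex x y)))) p" for x
      proof (cases "x \<in> {2 * A * y..4 * A * y}")
        case True
        have "ennreal N = ennreal (b * ((4 * A + 3) * y) powr (-2 - \<beta>)) * (ennreal (\<tau> * l powr (1 / p) * y powr (1 - 1 / p)) * ennreal L)"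
          using b \<tau> L by (simp add: N_def ennreal_mult)
        also have "\<dots> \<le> ennreal (b * ((4 * A + 3) * y) powr (-2 - \<beta>))
          * ((\<integral>\<^sup>+u. ennreal (\<phi> u) * indicator {-y<..} u \<partial>lborel) * (\<integral>\<^sup>+v. ennreal (g v * v powr \<beta>) * indicator {0<..} v \<partial>lborel))"
          unfolding B by (intro mult_left_mono mult_right_mono J' y) auto
        also have "\<dots> \<le> ennreal (cmod (Pf (Complex x y)))"
          unfolding Pf_def f_def
        proof (rule integral_op_lower_bound[where A = A and e = e and l = l])
          show "integrable (half_plane_measure \<beta>) (\<lambda>u. K (Complex x y) u * complex_of_real (\<phi> (Re u) * g (Im u)))"
            using C0[OF f_space] yl unfolding f_def by (auto simp: upper_half_plane_def)
        qed (use K e b A \<beta> \<phi> g yl True in auto)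
        finally have "ennreal_powr (ennreal N) p \<le> ennreal_powr (ennreal (cmod (Pf (Complex x y)))) p"
          by (rule ennreal_powr_mono[rotated]) (use p in simp)
        then show ?thesis using True N by (simp add: ennreal_powr_ennreal)
      qed simp
      have "(\<integral>\<^sup>+x. ennreal (N powr p) * indicator {2 * A * y..4 * A * y} x \<partial>lborel)
          \<le> (\<integral>\<^sup>+x. ennreal_powr (ennreal (cmod (Pf (Complex x y)))) p \<partial>lborel)"
        by (rule nn_integral_mono) (rule ptw)
      moreover have "(\<integral>\<^sup>+x. ennreal (N powr p) * indicator {2 * A * y..4 * A * y} x \<partial>lborel) = ennreal (N powr p * (2 * A * y))"
        using A yl by (subst nn_integral_cmult_indicator) (auto simp: ennreal_mult mult.assoc)
      ultimately have "ennreal_powr (ennreal (N powr p * (2 * A * y))) (1 / p) \<le> row_norm p (\<lambda>u. ennreal (cmod (Pf u))) y"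
        unfolding row_norm_def using p by (intro ennreal_powr_mono) auto
      moreover have "(N powr p * (2 * A * y)) powr (1 / p) = c1 * \<tau> * L * l powr (1 / p) * y powr (-1 - \<beta>)"
      proof -
        have "(N powr p * (2 * A * y)) powr (1 / p) = N * ((2 * A) powr (1 / p) * y powr (1 / p))"
          using N p A yl by (simp add: powr_mult powr_powr)
        also have "\<dots> = c1 * \<tau> * L * l powr (1 / p) * (y powr (-2 - \<beta>) * y powr (1 - 1 / p) * y powr (1 / p))"
          using A yl by (simp add: N_def c1_def powr_mult mult_ac)
        \<comment> \<open>The lower bound for the image has the same decay in height as the test
          function, so its norm is again governed by the integral of \<open>1 / y\<close>.\<close>
        also have "y powr (-2 - \<beta>) * y powr (1 - 1 / p) * y powr (1 / p) = y powr (-1 - \<beta>)"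
          unfolding powr_add[symmetric] by (rule arg_cong[where f = "\<lambda>t. y powr t"]) simp
        finally show ?thesis .
      qed
      ultimately show ?thesis using N A yl by (simp add: ennreal_powr_ennreal)
    qed
    have Q: "ennreal ((c1 * \<tau> * L * l powr (1 / p)) powr q * (m * l powr k) * ln (y1 / y0)) \<le> Q"
    proof -
      have c: "0 \<le> c1 * \<tau> * L * l powr (1 / p)" using c1 \<tau> L by simp
      have "ennreal ((c1 * \<tau> * L * l powr (1 / p)) powr q * (m * l powr k) * ln (y1 / y0))
        = ennreal ((c1 * \<tau> * L * l powr (1 / p)) powr q * (m * l powr k)) * ennreal (ln ((l * y1) / (l * y0)))"
        using l m y01 by (simp add: ennreal_mult)
      also have "\<dots> = (\<integral>\<^sup>+y. ennreal ((c1 * \<tau> * L * l powr (1 / p)) powr q * (m * l powr k)) * (ennreal (1 / y) * indicator {l * y0..l * y1} y) \<partial>lborel)"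
        by (subst nn_integral_cmult, measurable, subst nn_integral_inverse_Icc) (use l y01 in auto)
      also have "\<dots> \<le> Q"
        unfolding Q_def
      proof (rule nn_integral_mono)
        fix y :: real
        show "ennreal ((c1 * \<tau> * L * l powr (1 / p)) powr q * (m * l powr k)) * (ennreal (1 / y) * indicator {l * y0..l * y1} y)
          \<le> ennreal_powr (row_norm p (\<lambda>u. ennreal (cmod (Pf u))) y) q * W y"
        proof (cases "y \<in> {l * y0..l * y1}")
          case True
          have "l * 1 \<le> l * y0" "l * a \<le> l * y0" using l y01 a by (auto intro!: mult_left_mono)
          then have yl: "l \<le> y" "0 < y" "l * a \<le> y" using True l unfolding atLeastAtMost_iff by linarith+
          have wy: "m \<le> w y" using lm[of y] True yl by auto
          have "ennreal ((c1 * \<tau> * L * l powr (1 / p)) powr q * (m * l powr k)) * (ennreal (1 / y) * indicator {l * y0..l * y1} y)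
            = ennreal ((c1 * \<tau> * L * l powr (1 / p)) powr q * m * (l powr k * (1 / y)))"
            using True m yl by (simp add: ennreal_mult[symmetric] mult_ac)
          also have "\<dots> \<le> ennreal ((c1 * \<tau> * L * l powr (1 / p)) powr q * m * ((y powr (-1 - \<beta>)) powr q * y powr \<alpha>))"
            unfolding powr_q[OF yl(2)] using yl l k m
            by (intro ennreal_leI mult_left_mono mult_right_mono powr_mono2) auto
          also have "\<dots> = ennreal_powr (ennreal (c1 * \<tau> * L * l powr (1 / p) * y powr (-1 - \<beta>))) q * ennreal (m * y powr \<alpha>)"
          proof -
            have "ennreal (x powr q * m * (t powr q * y powr \<alpha>)) = ennreal_powr (ennreal (x * t)) q * ennreal (m * y powr \<alpha>)"
              if "0 \<le> x" "0 \<le> t" for x t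
              using that m by (simp add: ennreal_powr_ennreal powr_mult ennreal_mult[symmetric] mult_ac)
            from this[OF c] show ?thesis by simp
          qed
          also have "\<dots> \<le> ennreal_powr (row_norm p (\<lambda>u. ennreal (cmod (Pf u))) y) q * W y"
            using row_Pf[of y] True q wy yl
            by (intro mult_mono ennreal_powr_mono) (auto simp: W_def intro!: ennreal_leI mult_right_mono)
          finally show ?thesis .
        qed simp
      qed
      finally show ?thesis .
    qed
    note Q
    also note QR
    also have "ennreal (C powr q) * R \<le> ennreal (C powr q) * ennreal ((l * S) powr (q / p) * (2 * m * l powr k) * L)"
      by (intro mult_left_mono R) simp
    also have "\<dots> = ennreal (C powr q * ((l * S) powr (q / p) * (2 * m * l powr k) * L))"
      using m L by (simp add: ennreal_mult)
    finally have "(c1 * \<tau> * L * l powr (1 / p)) powr q * (m * l powr k) * ln (y1 / y0)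
        \<le> C powr q * ((l * S) powr (q / p) * (2 * m * l powr k) * L)"
      using m L by (subst (asm) ennreal_le_iff) auto
    moreover have "(c1 * \<tau> * L * l powr (1 / p)) powr q = c1 powr q * (\<tau> * L) powr q * l powr (q / p)"
      using c1 \<tau> L l by (simp add: powr_mult powr_powr mult_ac)
    moreover have "(l * S) powr (q / p) = l powr (q / p) * S powr (q / p)" using l S by (simp add: powr_mult)
    \<comment> \<open>Both sides carry \<open>l powr (q / p) * (m * l powr k)\<close>; once it is
      cancelled, no trace of the window or of the weight remains.\<close>
    ultimately have "(l powr (q / p) * (m * l powr k)) * (c1 powr q * ((\<tau> * L) powr q * ln (y1 / y0)))
        \<le> (l powr (q / p) * (m * l powr k)) * (2 * C powr q * S powr (q / p) * L)"
      by (simp add: mult_ac)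
    then have "c1 powr q * ((\<tau> * L) powr q * ln (y1 / y0)) \<le> 2 * C powr q * S powr (q / p) * L"
      using l m by (subst (asm) mult_le_cancel_left_pos) auto
    then show "(\<tau> * ln (1 / a)) powr q * ln (y1 / y0) \<le> 2 * C powr q / c1 powr q * S powr (q / p) * ln (1 / a)"
      unfolding L_def[symmetric] using c1 by (simp add: field_simps)
  qed
qed

text \<open>With \<open>L = ln (1 / a)\<close> the test compares
  \<open>(\<tau> * L) powr q * ln (y1 / y0)\<close> with \<open>M * S powr (q / p) * L\<close>. For
  \<open>q > 1\<close> a large \<open>L\<close> suffices. For \<open>q = 1\<close> it cancels, and
  \<open>ln (y1 / y0)\<close> has to grow while \<open>\<tau>\<close> stays bounded below. This is
  automatic for \<open>p = 1\<close>; for \<open>p > 1\<close> a fixed profile of bounded support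
  only admits \<open>\<tau>\<close> of order \<open>y1 powr (1 / p - 1)\<close>, so the profile must
  be spread over all scales.\<close>

lemma integral_op_bounded_necessary:
  fixes K :: "complex \<Rightarrow> complex \<Rightarrow> complex" and w :: "real \<Rightarrow> real" and p q \<alpha> \<beta> A b :: real
  assumes K: "\<And>z u. z \<in> upper_half_plane \<Longrightarrow> u \<in> upper_half_plane \<Longrightarrow> A * Im (z - cnj u) \<le> Re (z - cnj u)
      \<Longrightarrow> b * cmod (z - cnj u) powr (-2 - \<beta>) \<le> Re (e * K z u)"
    and e: "cmod e = 1" and b: "0 < b" and A: "1 \<le> A" and \<beta>: "-1 < \<beta>" and p: "1 \<le> p" and q: "1 \<le> q"
    and bounded: "integral_op_bounded \<beta> K p q w \<alpha>"
    and window: "\<And>a b. 0 < a \<Longrightarrow> a \<le> b \<Longrightarrow> \<exists>l m. 0 < l \<and> 0 < m \<and> (\<forall>y. l * a \<le> y \<longrightarrow> y \<le> l * b \<longrightarrow> m \<le> w y \<and> w y \<le> 2 * m)"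
  shows "\<alpha> + 1 < q * (\<beta> + 1)"
proof (rule ccontr)
  assume "\<not> ?thesis"
  then have \<kappa>: "q * (\<beta> + 1) \<le> \<alpha> + 1" by simp
  obtain M where M: "0 \<le> M" and test: "\<And>a \<psi> \<tau> S y0 y1. \<lbrakk>0 < a; a < 1; 1 \<le> y0; y0 \<le> y1; 0 \<le> \<tau>; 0 \<le> S;
      \<psi> \<in> borel_measurable borel; \<And>u. 0 \<le> \<psi> u; \<And>u. 0 \<le> u \<Longrightarrow> \<psi> u = 0;
      (\<integral>\<^sup>+u. ennreal (\<psi> u powr p) \<partial>lborel) \<le> ennreal S;
      \<And>\<eta>. y0 \<le> \<eta> \<Longrightarrow> \<eta> \<le> y1 \<Longrightarrow> ennreal (\<tau> * \<eta> powr (1 - 1 / p)) \<le> (\<integral>\<^sup>+u. ennreal (\<psi> u) * indicator {-\<eta><..} u \<partial>lborel)\<rbrakk>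
      \<Longrightarrow> (\<tau> * ln (1 / a)) powr q * ln (y1 / y0) \<le> M * S powr (q / p) * ln (1 / a)"
    using boundedness_test[OF K e b A \<beta> p q bounded window \<kappa>] by blast
  \<comment> \<open>For \<open>\<psi>\<close> the indicator of the unit interval left of 0, the mass
    is 1 whenever \<open>\<eta> \<ge> 1\<close>; this admits every \<open>\<tau>\<close> with
    \<open>\<tau> * y1 powr (1 - 1 / p) \<le> 1\<close>.\<close>
  have unit: "(\<tau> * L) powr q * ln y1 \<le> M * L"
    if "0 < L" "1 \<le> y1" "0 \<le> \<tau>" "\<tau> * y1 powr (1 - 1 / p) \<le> 1" for \<tau> L y1
  proof -
    have "(\<tau> * ln (1 / exp (- L))) powr q * ln (y1 / 1) \<le> M * 1 powr (q / p) * ln (1 / exp (- L))"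
    proof (rule test[where \<psi> = "indicator {-1<..<0::real}"])
      have "(\<integral>\<^sup>+u. ennreal (indicator {-1<..<0::real} u powr p) \<partial>lborel) = (\<integral>\<^sup>+u. indicator {-1<..<0::real} u \<partial>lborel)"
        by (intro nn_integral_cong) (auto simp: indicator_def)
      then show "(\<integral>\<^sup>+u. ennreal (indicator {-1<..<0::real} u powr p) \<partial>lborel) \<le> ennreal 1" by simp
      fix \<eta> :: real assume \<eta>: "1 \<le> \<eta>" "\<eta> \<le> y1"
      have "(\<integral>\<^sup>+u. ennreal (indicator {-1<..<0::real} u) * indicator {-\<eta><..} u \<partial>lborel) = (\<integral>\<^sup>+u. indicator {-1<..<0::real} u \<partial>lborel)"
        using \<eta> by (intro nn_integral_cong) (auto simp: indicator_def)
      also have "\<dots> = 1" by simp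
      finally have 1: "(\<integral>\<^sup>+u. ennreal (indicator {-1<..<0::real} u) * indicator {-\<eta><..} u \<partial>lborel) = 1" .
      have "\<tau> * \<eta> powr (1 - 1 / p) \<le> \<tau> * y1 powr (1 - 1 / p)"
        using \<eta> p that by (intro mult_left_mono powr_mono2) auto
      then have "\<tau> * \<eta> powr (1 - 1 / p) \<le> 1" using that by simp
      then show "ennreal (\<tau> * \<eta> powr (1 - 1 / p)) \<le> (\<integral>\<^sup>+u. ennreal (indicator {-1<..<0::real} u) * indicator {-\<eta><..} u \<partial>lborel)"
        unfolding 1 by (metis ennreal_1 ennreal_leI)
    qed (use that in auto)
    moreover have "ln (1 / exp (- L)) = L" by (simp add: ln_div)
    ultimately show ?thesis by simp
  qed
  consider "1 < q" | "q = 1" "p = 1" | "q = 1" "1 < p" using p q by linarith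
  then show False
  proof cases
    case 1
    define \<tau> :: real where "\<tau> = 2 powr (1 / p - 1)"
    have \<tau>: "0 < \<tau>" "\<tau> * 2 powr (1 - 1 / p) \<le> 1" by (auto simp: \<tau>_def powr_add[symmetric])
    define c where "c = \<tau> powr q * ln 2"
    have c: "0 < c" using \<tau> by (simp add: c_def)
    \<comment> \<open>Chosen so that \<open>c * L powr (q - 1) = M + 1\<close>, whereas the test
      allows at most \<open>M\<close>.\<close>
    define L where "L = ((M + 1) / c) powr (1 / (q - 1))"
    have L: "0 < L" using M c by (simp add: L_def)
    have "(\<tau> * L) powr q * ln 2 \<le> M * L" using unit[OF L, of 2 \<tau>] \<tau> by simp
    moreover have "(\<tau> * L) powr q * ln 2 = c * L powr (q - 1) * L"
      using \<tau> L by (simp add: c_def powr_mult powr_diff)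
    moreover have "L powr (q - 1) = (M + 1) / c" using 1 M c by (simp add: L_def powr_powr)
    ultimately have "(M + 1) * L \<le> M * L" using c by simp
    then show False using L by simp
  next
    case 2
    \<comment> \<open>As \<open>1 - 1 / p = 0\<close>, the choice \<open>\<tau> = 1\<close> is
      admissible for every \<open>y1\<close>; with \<open>ln y1 = M + 1\<close> and
      \<open>L = 1\<close> the test reads \<open>M + 1 \<le> M\<close>.\<close>
    then show False using unit[of 1 "exp (M + 1)" 1] M by simp
  next
    case 3
    \<comment> \<open>Solves \<open>T = (4 * M + 4) * T powr (1 / p)\<close>. With
      \<open>ln X = T\<close> the left side of the test is about \<open>T / 2\<close>, the right
      side \<open>M * T powr (1 / p)\<close>.\<close>
    define T where "T = (4 * M + 4) powr (p / (p - 1))"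
    define X where "X = exp T"
    have T1: "1 \<le> T" using M 3 by (auto simp: T_def intro!: ge_one_powr_ge_zero)
    have X2: "2 \<le> X" using T1 exp_ge_add_one_self[of T] unfolding X_def by linarith
    \<comment> \<open>The \<open>p\<close>-th power is \<open>1 / \<bar>u\<bar>\<close>, with
      integral \<open>ln X = T\<close>, while the mass over \<open>- \<eta> < u\<close> is of order
      \<open>\<eta> powr (1 - 1 / p)\<close> for all \<open>\<eta>\<close> from 2 to
      \<open>X\<close>.\<close>
    define \<psi> where "\<psi> u = (- u) powr (- (1 / p)) * indicator {-X..-1} u" for u :: real
    have "(1 / 2 * ln (1 / exp (- 1))) powr q * ln (X / 2) \<le> M * T powr (q / p) * ln (1 / exp (-1))"
    proof (rule test[where \<psi> = \<psi>])
      show "\<psi> \<in> borel_measurable borel" unfolding \<psi>_def by measurable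
      have "(\<integral>\<^sup>+u. ennreal (\<psi> u powr p) \<partial>lborel) = (\<integral>\<^sup>+u. ennreal (1 / (- u)) * indicator {1..X} (- u) \<partial>lborel)"
      proof (rule nn_integral_cong)
        fix u :: real
        show "ennreal (\<psi> u powr p) = ennreal (1 / (- u)) * indicator {1..X} (- u)"
        proof (cases "u \<in> {-X..-1}")
          case True
          have "((- u) powr (- (1 / p))) powr p = (- u) powr (- 1)"
            using 3 by (simp add: powr_powr)
          also have "\<dots> = 1 / (- u)" using True by (subst powr_minus_divide) simp
          finally show ?thesis using True by (simp add: \<psi>_def)
        next
          case False
          then have "- u \<notin> {1..X}" by auto
          then show ?thesis using False by (simp add: \<psi>_def)
        qed
      qed
      also have "\<dots> = (\<integral>\<^sup>+u. ennreal (1 / u) * indicator {1..X} u \<partial>lborel)"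
        using nn_integral_real_affine[of "\<lambda>u. ennreal (1 / u) * indicator {1..X} u" "-1" 0] by simp
      also have "\<dots> = ennreal T"
        using T1 by (subst nn_integral_inverse_Icc) (auto simp: X_def)
      finally show "(\<integral>\<^sup>+u. ennreal (\<psi> u powr p) \<partial>lborel) \<le> ennreal T" by simp
      fix \<eta> :: real assume \<eta>: "2 \<le> \<eta>" "\<eta> \<le> X"
      have "1 / 2 * \<eta> powr (1 - 1 / p) = \<eta> powr (- (1 / p)) * (\<eta> / 2)"
        using \<eta> by (simp add: powr_diff powr_minus_divide)
      \<comment> \<open>The interval from \<open>- \<eta>\<close> to \<open>-1\<close> has length
        \<open>\<eta> - 1\<close>, which is at least \<open>\<eta> / 2\<close> from
        \<open>\<eta> = 2\<close> on; hence \<open>y0 = 2\<close>.\<close>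
      also have "\<dots> \<le> \<eta> powr (- (1 / p)) * (\<eta> - 1)"
        using \<eta> by (intro mult_left_mono) auto
      finally have "ennreal (1 / 2 * \<eta> powr (1 - 1 / p)) \<le> ennreal (\<eta> powr (- (1 / p))) * emeasure lborel {-\<eta><..-1}"
        using \<eta> by (simp add: ennreal_mult[symmetric] ennreal_leI)
      also have "\<dots> = (\<integral>\<^sup>+u. ennreal (\<eta> powr (- (1 / p))) * indicator {-\<eta><..-1} u \<partial>lborel)"
        by (rule nn_integral_cmult_indicator[symmetric]) simp
      also have "\<dots> \<le> (\<integral>\<^sup>+u. ennreal (\<psi> u) * indicator {-\<eta><..} u \<partial>lborel)"
      proof (rule nn_integral_mono)
        fix u :: real
        show "ennreal (\<eta> powr (- (1 / p))) * indicator {-\<eta><..-1} u \<le> ennreal (\<psi> u) * indicator {-\<eta><..} u"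
        proof (cases "u \<in> {-\<eta><..-1}")
          case True
          then have "\<eta> powr (- (1 / p)) \<le> (- u) powr (- (1 / p))" using 3 by (intro powr_mono2') auto
          then show ?thesis using True \<eta> by (simp add: \<psi>_def ennreal_leI)
        qed simp
      qed
      finally show "ennreal (1 / 2 * \<eta> powr (1 - 1 / p)) \<le> (\<integral>\<^sup>+u. ennreal (\<psi> u) * indicator {-\<eta><..} u \<partial>lborel)" .
    qed (use X2 T1 in \<open>auto simp: \<psi>_def\<close>)
    then have "(T - ln 2) / 2 \<le> M * T powr (1 / p)"
      using 3 X2 by (simp add: ln_div X_def)
    moreover have "T = (4 * M + 4) * T powr (1 / p)"
    proof -
      have "T powr (1 - 1 / p) = 4 * M + 4"
      proof -
        have exponent: "p / (p - 1) * (1 - 1 / p) = 1" using 3 by (simp add: field_simps)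
        show ?thesis unfolding T_def powr_powr exponent using M by simp
      qed
      moreover have "T = T powr (1 - 1 / p) * T powr (1 / p)" using T1 by (simp add: powr_add[symmetric])
      ultimately show ?thesis by simp
    qed
    moreover have "1 \<le> T powr (1 / p)" using T1 p by (simp add: ge_one_powr_ge_zero)
    then have "0 \<le> M * T powr (1 / p)" using M by simp
    moreover have "ln (2::real) \<le> 1" using ln_le_minus_one[of "2::real"] by simp
    ultimately show False using \<open>1 \<le> T powr (1 / p)\<close> by (simp add: algebra_simps)
  qed
qed

theorem theorem1:
  fixes p q \<alpha> \<beta> k :: real
    and \<Phi> :: "real \<Rightarrow> real"
    and \<epsilon> :: "real \<times> real"
    and c :: complex
  assumes "1 \<le> p" and "1 \<le> q"
    and "\<alpha> > -1" and "\<beta> > -1"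
    and "\<Phi> \<in> lower_growth \<union> upper_growth"
    and "\<epsilon> \<in> {0, 1} \<times> {0, 1}"
    and "bergman_constant \<beta> c"
  shows "(integral_op_bounded \<beta> (bergman_kernel c \<beta>) p q (\<lambda>y. log_weight \<Phi> \<epsilon> y powr k) \<alpha>
           \<longleftrightarrow> integral_op_bounded \<beta> (abs_bergman_kernel c \<beta>) p q (\<lambda>y. log_weight \<Phi> \<epsilon> y powr k) \<alpha>)
       \<and> (integral_op_bounded \<beta> (abs_bergman_kernel c \<beta>) p q (\<lambda>y. log_weight \<Phi> \<epsilon> y powr k) \<alpha>
           \<longleftrightarrow> \<alpha> + 1 < q * (\<beta> + 1))"
proof -
  note p = assms(1) and q = assms(2) and \<alpha> = assms(3) and \<beta> = assms(4) and \<Phi> = assms(5) and \<epsilon> = assms(6)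
  let ?w = "\<lambda>y. log_weight \<Phi> \<epsilon> y powr k"
  have c: "c \<noteq> 0" by (rule bergman_constant_nonzero[OF \<beta> assms(7)])
  obtain C r where growth: "growth_function \<Phi>" using growth_upper_bound[OF \<Phi>] by blast
  have w_meas: "?w \<in> borel_measurable (restrict_space borel {0<..})"
    by (rule measurable_log_weight[OF growth])
  have w_pos: "0 < ?w y" for y using log_weight_ge_1[OF \<epsilon>, of \<Phi> y] by simp
  have suff: "integral_op_bounded \<beta> (bergman_kernel c \<beta>) p q ?w \<alpha> \<and> integral_op_bounded \<beta> (abs_bergman_kernel c \<beta>) p q ?w \<alpha>"
    if less: "\<alpha> + 1 < q * (\<beta> + 1)"
  proof -
    \<comment> \<open>Any positive \<open>\<delta>\<close> below both \<open>\<alpha> + 1\<close>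
      and \<open>q * (\<beta> + 1) - (\<alpha> + 1)\<close> would do; the second quantity is
      positive by (c).\<close>
    define \<delta> where "\<delta> = min ((\<alpha> + 1) / 2) ((q * (\<beta> + 1) - (\<alpha> + 1)) / 2)"
    have \<delta>: "0 < \<delta>" "\<delta> < \<alpha> + 1" "\<alpha> + 1 + \<delta> < q * (\<beta> + 1)"
      using less \<alpha> by (auto simp: \<delta>_def min_def field_simps)
    obtain A where A: "0 \<le> A" "\<And>t v. 0 < t \<Longrightarrow> 0 < v \<Longrightarrow> ?w (v / t) \<le> A * max t (1 / t) powr \<delta> * ?w v"
      using log_weight_powr_dilate[OF \<Phi> \<epsilon> \<delta>(1)] by blast
    obtain C where C: "0 \<le> C" "\<And>h. h \<in> borel_measurable borel \<Longrightarrow>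
        mixed_nn_norm p q ?w \<alpha> (positive_op \<beta> h) \<le> ennreal C * mixed_nn_norm p q ?w \<alpha> h"
      using positive_op_bound[OF p q \<beta> w_meas A(1), of \<delta> \<alpha>] A(2) \<delta> by auto
    show ?thesis
    proof
      show "integral_op_bounded \<beta> (bergman_kernel c \<beta>) p q ?w \<alpha>"
        by (rule integral_op_boundedI[OF measurable_bergman_kernel cmod_bergman_kernel norm_ge_zero p q \<beta> w_meas w_pos C])
      show "integral_op_bounded \<beta> (abs_bergman_kernel c \<beta>) p q ?w \<alpha>"
        by (rule integral_op_boundedI[OF measurable_abs_bergman_kernel _ norm_ge_zero[of c] p q \<beta> w_meas w_pos C])
           (simp_all add: cmod_abs_bergman_kernel cmod_bergman_kernel)
    qed
  qed
  obtain A where A: "1 \<le> A" and sector: "\<And>\<zeta>. 0 < Im \<zeta> \<Longrightarrow> A * Im \<zeta> \<le> Re \<zeta> \<Longrightarrow> cmod \<zeta> powr -(2 + \<beta>) / 2 \<le> Re (1 / \<zeta> powr of_real (2 + \<beta>))"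
    using Re_inverse_powr_sector[of "2 + \<beta>"] by blast
  have window: "\<exists>l m. 0 < l \<and> 0 < m \<and> (\<forall>y. l * a \<le> y \<longrightarrow> y \<le> l * b \<longrightarrow> m \<le> ?w y \<and> ?w y \<le> 2 * m)"
    if "0 < a" "a \<le> b" for a b
    using log_weight_powr_window[OF \<Phi> \<epsilon> that] by metis
  have b: "0 < cmod c / 2" using c by simp
  \<comment> \<open>The unimodular factor rotates \<open>c\<close> to \<open>cmod c\<close>, and the
    sector estimate supplies the factor 1/2.\<close>
  have "\<alpha> + 1 < q * (\<beta> + 1)" if "integral_op_bounded \<beta> (bergman_kernel c \<beta>) p q ?w \<alpha>"
  proof (rule integral_op_bounded_necessary[where A = A and b = "cmod c / 2" and e = "cnj c / of_real (cmod c)", OF _ _ b A \<beta> p q that window])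
    show "cmod (cnj c / complex_of_real (cmod c)) = 1" using c by (simp add: norm_divide)
    fix z u assume zu: "z \<in> upper_half_plane" "u \<in> upper_half_plane" "A * Im (z - cnj u) \<le> Re (z - cnj u)"
    have s: "-2 - \<beta> = -(2 + \<beta>)" by simp
    have "cnj c / of_real (cmod c) * c = of_real (cmod c)"
      using c complex_norm_square[of c] by (simp add: field_simps power2_eq_square)
    then have "cnj c / of_real (cmod c) * bergman_kernel c \<beta> z u = of_real (cmod c) * (1 / (z - cnj u) powr of_real (2 + \<beta>))"
      unfolding bergman_kernel_def by (metis mult.right_neutral times_divide_eq_right)
    then have "Re (cnj c / of_real (cmod c) * bergman_kernel c \<beta> z u) = cmod c * Re (1 / (z - cnj u) powr of_real (2 + \<beta>))"
      by (simp only: Re_complex_of_real times_complex.sel Im_complex_of_real mult_zero_left diff_zero)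
    moreover have "cmod c * (cmod (z - cnj u) powr -(2 + \<beta>) / 2) \<le> cmod c * Re (1 / (z - cnj u) powr of_real (2 + \<beta>))"
      using zu by (intro mult_left_mono sector) (auto simp: upper_half_plane_def)
    ultimately show "cmod c / 2 * cmod (z - cnj u) powr (-2 - \<beta>) \<le> Re (cnj c / of_real (cmod c) * bergman_kernel c \<beta> z u)"
      unfolding s by simp
  qed
  \<comment> \<open>The modulus kernel is real and equals twice the required lower bound, so
    \<open>e = 1\<close>.\<close>
  moreover have "\<alpha> + 1 < q * (\<beta> + 1)" if "integral_op_bounded \<beta> (abs_bergman_kernel c \<beta>) p q ?w \<alpha>"
  proof (rule integral_op_bounded_necessary[where A = A and b = "cmod c / 2" and e = 1, OF _ _ b A \<beta> p q that window])
    fix z u assume "z \<in> upper_half_plane" "u \<in> upper_half_plane"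
    then show "cmod c / 2 * cmod (z - cnj u) powr (-2 - \<beta>) \<le> Re (1 * abs_bergman_kernel c \<beta> z u)"
      using cmod_bergman_kernel[of z u c \<beta>] by (simp add: abs_bergman_kernel_def)
  qed simp
  ultimately show ?thesis using suff by blast
qed

end
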